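(* Let $A_1,\dots,A_n$ be finite dimensional complex vector spaces, and for $1\le j\le m$ let $k^j_1,\dots,k^j_n$ be positive integers with $k^j_i\le\dim A_i$ for all $i$. Consider the join $$\mathbf{J}:=\mathbf{J}\bigl(Sub_{k^1_1,\dots,k^1_n}(A_1\otimes\cdots\otimes A_n),\dots,Sub_{k^m_1,\dots,k^m_n}(A_1\otimes\cdots\otimes A_n)\bigr).$$ Then: (i) $\mathbf{J}$ is non-defective if $\dim A_i\ge\sum_{1\le j\le m}k^j_i$ for each $1\le i\le n$; (ii) $\mathbf{J}$ is defective if $\prod_{1\le i\le n}\dim A_i<\sum_{1\le j\le m}\prod_{1\le i\le n}k^j_i$; (iii) the defect of $\mathbf{J}$ is at least $\sum_{1\le j\le m}\prod_{1\le i\le n}k^j_i-\prod_{1\le i\le n}\dim A_i$.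
   Context: For $T\in A_1\otimes\cdots\otimes A_n$, $T(A_i^* )\subset\bigotimes_{j\ne i}A_j$ denotes the image of the linear map $A_i^*\to\bigotimes_{j\neq i}A_j$ defined by $T$. The subspace variety is $$Sub_{k_1,\dots,k_n}(A_1\otimes\cdots\otimes A_n):=\overline{\{[T]\in\mathbb{P}(A_1\otimes\cdots\otimes A_n)\mid\forall i\ \exists A_i'\subset A_i,\ \dim A_i'=k_i,\ T\in A_1'\otimes\cdots\otimes A_n'\}},$$ equivalently $\{[T]\mid\forall i\ \dim T(A_i^* )\le k_i\}$. For projective varieties $X_1,\dots,X_m\subset\mathbb{P}V$ with affine cones $\hat X_i\subset V$, the join is the Zariski closure $$\mathbf{J}(X_1,\dots,X_m):=\overline{\bigcup\{\langle[P_1],\dots,[P_m]\rangle\mid P_i\in\hat X_i,\ 1\le i\le m,\ P_1,\dots,P_m\text{ linearly independent in }V\}}\subset\mathbb{P}V,$$ where $\langle\cdot\rangle$ is the projective linear span; joins are considered for $m\le\dim\mathbb{P}V$. With $d_i=\dim X_i$ (projective dimension), the defect of the join is $$\delta(\mathbf{J}(X_1,\dots,X_m))=d_1+\cdots+d_m+m-1-\dim\mathbf{J}(X_1,\dots,X_m).$$ The join is defective if its defect is positive, and non-defective otherwise.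
   Formalization: Part (i) is proved under the added assumption n ≥ 3 or m = 1; for n ≤ 2 and m ≥ 2 it is false (e.g. n = 2, dim A_1 = dim A_2 = 2, m = 2, all k = 1: the join is P^3 and the defect is 2). Parts (ii) and (iii) are unrestricted. *)

theory Defs
  imports Complex_Main "HOL-Library.FuncSet"
begin

text \<open>
  Complex vector spaces are given by their scalar multiplication \<open>s\<close>, an instance of the
  locale \<^locale>\<open>vector_space\<close>. The factors \<open>A\<^sub>1, \<dots>, A\<^sub>n\<close> are subspaces of one common type,
  which is no restriction since any finite family of spaces embeds into its direct sum.
\<close>

subsection \<open>Tensor products\<close>

definition multilinear_on ::
  "(complex \<Rightarrow> 'v::ab_group_add \<Rightarrow> 'v) \<Rightarrow> (complex \<Rightarrow> 'w::ab_group_add \<Rightarrow> 'w) \<Rightarrow>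
    nat \<Rightarrow> (nat \<Rightarrow> 'v set) \<Rightarrow> ((nat \<Rightarrow> 'v) \<Rightarrow> 'w) \<Rightarrow> bool" where
  "multilinear_on sV sW n A g \<longleftrightarrow>
    (\<forall>v \<in> (\<Pi>\<^sub>E i\<in>{1..n}. A i). \<forall>i\<in>{1..n}.
      (\<forall>x\<in>A i. \<forall>y\<in>A i. g (v(i := x + y)) = g (v(i := x)) + g (v(i := y))) \<and>
      (\<forall>c. \<forall>x\<in>A i. g (v(i := sV c x)) = sW c (g (v(i := x)))))"

text \<open>
  The whole space \<open>'w\<close> is \<open>A\<^sub>1 \<otimes> \<dots> \<otimes> A\<^sub>n\<close>, where \<open>\<tau> v\<close> is the tensor \<open>v\<^sub>1 \<otimes> \<dots> \<otimes> v\<^sub>n\<close>.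
  One cannot quantify over the type of the target in the universal property. Over a field the
  target \<open>\<complex>\<close> is enough: existence of the factorization makes the products of basis vectors
  independent, and its uniqueness makes them span.
\<close>
definition tensor_product ::
  "(complex \<Rightarrow> 'v::ab_group_add \<Rightarrow> 'v) \<Rightarrow> (complex \<Rightarrow> 'w::ab_group_add \<Rightarrow> 'w) \<Rightarrow>
    nat \<Rightarrow> (nat \<Rightarrow> 'v set) \<Rightarrow> ((nat \<Rightarrow> 'v) \<Rightarrow> 'w) \<Rightarrow> bool" where
  "tensor_product sV sW n A \<tau> \<longleftrightarrow>
    multilinear_on sV sW n A \<tau> \<and>
    (\<forall>g. multilinear_on sV (*) n A g \<longrightarrow>
      (\<exists>!h. Vector_Spaces.linear sW (*) h \<and> (\<forall>v \<in> (\<Pi>\<^sub>E i\<in>{1..n}. A i). h (\<tau> v) = g v)))"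

subsection \<open>Projective space and its Zariski topology\<close>

text \<open>A point of \<open>\<P>V\<close> is a line in \<open>V\<close>; \<open>proj_pt s v\<close> is \<open>[v]\<close>, used only for \<open>v \<noteq> 0\<close>.\<close>

definition proj_pt :: "(complex \<Rightarrow> 'w::ab_group_add \<Rightarrow> 'w) \<Rightarrow> 'w \<Rightarrow> 'w set" where
  "proj_pt s v = module.span s {v}"

definition proj_space :: "(complex \<Rightarrow> 'w::ab_group_add \<Rightarrow> 'w) \<Rightarrow> 'w set set" where
  "proj_space s = {proj_pt s v | v. v \<noteq> 0}"

definition affine_cone :: "(complex \<Rightarrow> 'w::ab_group_add \<Rightarrow> 'w) \<Rightarrow> 'w set set \<Rightarrow> 'w set" where
  "affine_cone s X = insert 0 {v. v \<noteq> 0 \<and> proj_pt s v \<in> X}"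

definition proj_span :: "(complex \<Rightarrow> 'w::ab_group_add \<Rightarrow> 'w) \<Rightarrow> 'w set \<Rightarrow> 'w set set" where
  "proj_span s S = {proj_pt s v | v. v \<noteq> 0 \<and> v \<in> module.span s S}"

text \<open>Homogeneous polynomials of degree \<open>d\<close>: sums of products of \<open>d\<close> linear forms.\<close>
inductive hom_poly ::
  "(complex \<Rightarrow> 'w::ab_group_add \<Rightarrow> 'w) \<Rightarrow> nat \<Rightarrow> ('w \<Rightarrow> complex) \<Rightarrow> bool"
  for s where
  const: "hom_poly s 0 (\<lambda>_. c)"
| add: "hom_poly s d f \<Longrightarrow> hom_poly s d g \<Longrightarrow> hom_poly s d (\<lambda>v. f v + g v)"
| mult: "Vector_Spaces.linear s (*) l \<Longrightarrow> hom_poly s d f \<Longrightarrow> hom_poly s (Suc d) (\<lambda>v. l v * f v)"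

definition zariski_closed :: "(complex \<Rightarrow> 'w::ab_group_add \<Rightarrow> 'w) \<Rightarrow> 'w set set \<Rightarrow> bool" where
  "zariski_closed s Z \<longleftrightarrow>
    (\<exists>F. (\<forall>f\<in>F. \<exists>d. hom_poly s d f) \<and>
         Z = {p \<in> proj_space s. \<forall>f\<in>F. \<forall>v\<in>p. f v = 0})"

definition zariski_closure :: "(complex \<Rightarrow> 'w::ab_group_add \<Rightarrow> 'w) \<Rightarrow> 'w set set \<Rightarrow> 'w set set" where
  "zariski_closure s S = \<Inter>{Z. zariski_closed s Z \<and> S \<subseteq> Z}"

definition irreducible_closed :: "(complex \<Rightarrow> 'w::ab_group_add \<Rightarrow> 'w) \<Rightarrow> 'w set set \<Rightarrow> bool" where
  "irreducible_closed s Z \<longleftrightarrow>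
    zariski_closed s Z \<and> Z \<noteq> {} \<and>
    (\<forall>Z1 Z2. zariski_closed s Z1 \<and> zariski_closed s Z2 \<and> Z = Z1 \<union> Z2 \<longrightarrow> Z = Z1 \<or> Z = Z2)"

text \<open>
  Krull dimension of a Zariski closed set \<open>X\<close>, with \<open>dim \<emptyset> = -1\<close>. For \<open>V\<close> of finite dimension
  the lengths of chains are bounded, so the supremum in \<^typ>\<open>nat\<close> is a maximum.
\<close>
definition proj_dim :: "(complex \<Rightarrow> 'w::ab_group_add \<Rightarrow> 'w) \<Rightarrow> 'w set set \<Rightarrow> int" where
  "proj_dim s X =
    (if X = {} then -1
     else int (Sup {r. \<exists>Z. (\<forall>i\<le>r. irreducible_closed s (Z i) \<and> Z i \<subseteq> X) \<and>
                           (\<forall>i<r. Z i \<subset> Z (Suc i))}))"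

subsection \<open>Subspace varieties and joins\<close>

text \<open>The subspace \<open>A'\<^sub>1 \<otimes> \<dots> \<otimes> A'\<^sub>n\<close> of \<open>A\<^sub>1 \<otimes> \<dots> \<otimes> A\<^sub>n\<close> is the span of the \<open>v\<^sub>1 \<otimes> \<dots> \<otimes> v\<^sub>n\<close>
  with \<open>v\<^sub>i \<in> A'\<^sub>i\<close>.\<close>
definition subspace_variety ::
  "(complex \<Rightarrow> 'v::ab_group_add \<Rightarrow> 'v) \<Rightarrow> (complex \<Rightarrow> 'w::ab_group_add \<Rightarrow> 'w) \<Rightarrow>
    nat \<Rightarrow> (nat \<Rightarrow> 'v set) \<Rightarrow> ((nat \<Rightarrow> 'v) \<Rightarrow> 'w) \<Rightarrow> (nat \<Rightarrow> nat) \<Rightarrow> 'w set set" where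
  "subspace_variety sV sW n A \<tau> k =
    zariski_closure sW {proj_pt sW T | T. T \<noteq> 0 \<and>
      (\<exists>A'. (\<forall>i\<in>{1..n}. module.subspace sV (A' i) \<and> A' i \<subseteq> A i \<and>
                        vector_space.dim sV (A' i) = k i) \<and>
            T \<in> module.span sW (\<tau> ` (\<Pi>\<^sub>E i\<in>{1..n}. A' i)))}"

definition proj_join ::
  "(complex \<Rightarrow> 'w::ab_group_add \<Rightarrow> 'w) \<Rightarrow> nat \<Rightarrow> (nat \<Rightarrow> 'w set set) \<Rightarrow> 'w set set" where
  "proj_join s m X =
    zariski_closure s (\<Union>{proj_span s (P ` {1..m}) | P.
      (\<forall>j\<in>{1..m}. P j \<in> affine_cone s (X j)) \<and>
      inj_on P {1..m} \<and> \<not> module.dependent s (P ` {1..m})})"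

definition join_defect ::
  "(complex \<Rightarrow> 'w::ab_group_add \<Rightarrow> 'w) \<Rightarrow> nat \<Rightarrow> (nat \<Rightarrow> 'w set set) \<Rightarrow> int" where
  "join_defect s m X =
    (\<Sum>j\<in>{1..m}. proj_dim s (X j)) + int m - 1 - proj_dim s (proj_join s m X)"

definition join_defective ::
  "(complex \<Rightarrow> 'w::ab_group_add \<Rightarrow> 'w) \<Rightarrow> nat \<Rightarrow> (nat \<Rightarrow> 'w set set) \<Rightarrow> bool" where
  "join_defective s m X \<longleftrightarrow> join_defect s m X > 0"

end

theory Submission
  imports Defs "HOL-Computational_Algebra.Polynomial"
begin

text \<open>
  A strict inclusion of irreducible closed sets raises the growth of the Hilbert function by one
  degree, so a set covered by finitely many polynomial charts in \<open>t\<close> parameters (normalised up to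
  scaling) has only chains of length at most \<open>t\<close>. Conversely, a polynomial map into a closed
  \<open>J\<close> that has \<open>r\<close> linear coordinate forms whose linear parts at a point are the \<open>r\<close> parameters
  yields a chain of length \<open>r - 1\<close> in \<open>J\<close>, by restricting it to a flag of coordinate subspaces.

  The subspace variety of \<open>k\<close> contains a linear space of dimension \<open>\<Prod>k\<^sub>i - 1\<close>, and the join lies in a
  projective space of dimension \<open>\<Prod>a\<^sub>i - 1\<close>; this gives the lower bound on the defect. For the
  non-defective case, first shrink each \<open>k\<close> to a concise one with the same variety. Graphs over
  coordinate subspaces then give charts with \<open>\<Prod>k\<^sub>i + \<Sum>k\<^sub>i(a\<^sub>i - k\<^sub>i) - 1\<close> parameters. If the blocks of
  the summands are disjoint in every factor and \<open>n \<ge> 3\<close>, the tangent spaces of the summands at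
  suitable 0/1 tensors occupy different coordinates of the tensor space.
\<close>

subsection \<open>Polynomial functions\<close>

text \<open>No dimension theory is assumed: \<open>proj_dim\<close> is a supremum of lengths of
  chains, so every bound comes from counting independent forms of degree d. Crude counts are enough,
  because only the exponents in \<open>q ^ s \<le> K * (C * q + 1) ^ t\<close> matter. One-sided
  bounds are combined: for (i) an upper bound for each subspace variety and a lower bound for the
  join, for (iii) the opposite pair.

  In (i) the condition \<open>3 \<le> n \<or> m = 1\<close> is essential. For 2x2 matrices with m =
  2 and all k equal to 1, each variety is the quadric surface of rank one matrices in P^3 and the
  join is P^3, so the defect is 2 + 2 + 1 - 3 = 2, although 2 >= 1 + 1 in both factors.

  Shrinking k is forced by the count: if some k_i exceeds the product of the others, a chart can
  have more parameters than the variety has dimensions, and then they cannot all be independent to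
  first order. Points are certified to lie in the join only where the summands are linearly
  independent, hence near the base point; a polynomial that vanishes near 0 on every ray vanishes
  everywhere, which removes this restriction.\<close>

inductive polyfun :: "'i set \<Rightarrow> nat \<Rightarrow> (('i \<Rightarrow> complex) \<Rightarrow> complex) \<Rightarrow> bool" for V where
  const: "polyfun V D (\<lambda>_. c)"
| add: "polyfun V D p \<Longrightarrow> polyfun V D q \<Longrightarrow> polyfun V D (\<lambda>x. p x + q x)"
| var: "i \<in> V \<Longrightarrow> polyfun V D p \<Longrightarrow> polyfun V (Suc D) (\<lambda>x. x i * p x)"

lemma polyfun_cong_rhs: "polyfun V D p \<Longrightarrow> (\<And>x. p x = q x) \<Longrightarrow> polyfun V D q"
  by (metis ext)

lemma polyfun_mono: "polyfun V D p \<Longrightarrow> D \<le> E \<Longrightarrow> polyfun V E p"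
proof (induction arbitrary: E rule: polyfun.induct)
  case (var i D p)
  then obtain E' where "E = Suc E'" "D \<le> E'" by (metis Suc_le_D Suc_le_mono)
  with var show ?case by (auto intro: polyfun.var)
qed (auto intro: polyfun.intros)

lemma polyfun_cmult: "polyfun V D p \<Longrightarrow> polyfun V D (\<lambda>x. c * p x)"
proof (induction rule: polyfun.induct)
  case (add D p q)
  then show ?case by (auto simp: distrib_left intro: polyfun.intros)
next
  case (var i D p)
  have "polyfun V (Suc D) (\<lambda>x. x i * (c * p x))" using var by (auto intro: polyfun.intros)
  then show ?case by (rule polyfun_cong_rhs) (simp add: ac_simps)
qed (auto intro: polyfun.intros)

lemma polyfun_mult: "polyfun V D p \<Longrightarrow> polyfun V E q \<Longrightarrow> polyfun V (D + E) (\<lambda>x. p x * q x)"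
proof (induction rule: polyfun.induct)
  case (const D c)
  then show ?case using polyfun_cmult polyfun_mono by (metis le_add2)
next
  case (add D p p')
  then show ?case by (auto simp: distrib_right intro: polyfun.intros)
next
  case (var i D p)
  have "polyfun V (Suc (D + E)) (\<lambda>x. x i * (p x * q x))" using var by (auto intro: polyfun.intros)
  then show ?case by (auto intro: polyfun_cong_rhs simp: ac_simps)
qed

lemma polyfun_var: "i \<in> V \<Longrightarrow> polyfun V 1 (\<lambda>x. x i)"
  using polyfun.var[OF _ polyfun.const[of V 0 1]] by simp

lemma polyfun_sum: "(\<And>a. a \<in> A \<Longrightarrow> polyfun V D (p a)) \<Longrightarrow> polyfun V D (\<lambda>x. \<Sum>a\<in>A. p a x)"
  by (induction A rule: infinite_finite_induct) (auto intro: polyfun.intros)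

lemma polyfun_prod:
  "(\<And>a. a \<in> A \<Longrightarrow> polyfun V D (p a)) \<Longrightarrow> polyfun V (card A * D) (\<lambda>x. \<Prod>a\<in>A. p a x)"
proof (induction A rule: infinite_finite_induct)
  case (insert a A)
  then have "polyfun V (D + card A * D) (\<lambda>x. p a x * (\<Prod>a\<in>A. p a x))"
    by (intro polyfun_mult) auto
  with insert show ?case by simp
qed (auto intro: polyfun.intros)

lemma polyfun_restrict_vars:
  "polyfun V D p \<Longrightarrow> polyfun V' D (\<lambda>x. p (\<lambda>i. if i \<in> V' then x i else 0))"
proof (induction rule: polyfun.induct)
  case (var i D p)
  show ?case
  proof (cases "i \<in> V'")
    case True
    with var show ?thesis by (auto intro: polyfun.intros)
  next
    case False
    then show ?thesis by (auto intro: polyfun.intros)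
  qed
qed (auto intro: polyfun.intros)

text \<open>Restriction to a line turns questions about zeros into questions about the roots of one
  univariate polynomial.\<close>

lemma polyfun_line: "polyfun V D p \<Longrightarrow> \<exists>q. \<forall>t. p (\<lambda>i. a i + t * b i) = poly q t"
proof (induction rule: polyfun.induct)
  case (const D c)
  show ?case by (rule exI[of _ "[:c:]"]) simp
next
  case (add D p p')
  then show ?case by (metis poly_add)
next
  case (var i D p)
  then obtain q where q: "\<forall>t. p (\<lambda>i. a i + t * b i) = poly q t" by blast
  show ?case by (rule exI[of _ "[:a i, b i:] * q"]) (simp add: q algebra_simps)
qed

text \<open>On the line from a point where \<open>p\<close> is nonzero to a point where
  \<open>q\<close> is nonzero, both restrict to nonzero univariate polynomials, and these form an
  integral domain.\<close>

lemma polyfun_mult_eq_0: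
  assumes "polyfun V D p" "polyfun V E q" "\<And>x. p x * q x = 0"
  shows "(\<forall>x. p x = 0) \<or> (\<forall>x. q x = 0)"
proof (rule ccontr)
  assume "\<not> ?thesis"
  then obtain x y where xy: "p x \<noteq> 0" "q y \<noteq> 0" by blast
  obtain P where P: "\<And>t. p (\<lambda>i. x i + t * (y i - x i)) = poly P t"
    using polyfun_line[OF assms(1), of x "\<lambda>i. y i - x i"] by blast
  obtain Q where Q: "\<And>t. q (\<lambda>i. x i + t * (y i - x i)) = poly Q t"
    using polyfun_line[OF assms(2), of x "\<lambda>i. y i - x i"] by blast
  have "poly P 0 \<noteq> 0" "poly Q 1 \<noteq> 0" using P[of 0] Q[of 1] xy by simp_all
  then have "P \<noteq> 0" "Q \<noteq> 0" by (metis poly_0)+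
  then have "P * Q \<noteq> 0" by simp
  moreover have "poly (P * Q) t = 0" for t unfolding poly_mult P[symmetric] Q[symmetric] by (rule assms(3))
  ultimately show False using poly_all_0_iff_0 by blast
qed

text \<open>The small positive reals are already infinitely many roots along the ray through
  \<open>y\<close>.\<close>

lemma polyfun_zero_near_0:
  assumes "polyfun V D p" "\<forall>\<^sub>F t in at_right 0. p (\<lambda>i. complex_of_real t * y i) = 0"
  shows "p y = 0"
proof -
  obtain P where P: "\<And>t. p (\<lambda>i. 0 + t * y i) = poly P t"
    using polyfun_line[OF assms(1), of "\<lambda>_. 0" y] by blast
  from assms(2) obtain \<epsilon> where \<epsilon>: "\<epsilon> > 0" "\<And>t. 0 < t \<Longrightarrow> t < \<epsilon> \<Longrightarrow> p (\<lambda>i. complex_of_real t * y i) = 0"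
    unfolding eventually_at_right_field by auto
  have "P = 0"
  proof (rule ccontr)
    assume "P \<noteq> 0"
    then have "finite {x. poly P x = 0}" by (rule poly_roots_finite)
    moreover have "complex_of_real ` {0<..<\<epsilon>} \<subseteq> {x. poly P x = 0}" using \<epsilon> by (auto simp flip: P)
    ultimately have "finite {0<..<\<epsilon>}"
      by (meson finite_imageD finite_subset inj_of_real inj_on_subset subset_UNIV)
    then show False using \<epsilon>(1) infinite_Ioo by blast
  qed
  then show ?thesis using P[of 1] by simp
qed

subsection \<open>Monomials\<close>

definition monom_fun :: "'i set \<Rightarrow> ('i \<Rightarrow> nat) \<Rightarrow> ('i \<Rightarrow> complex) \<Rightarrow> complex" where
  "monom_fun V \<alpha> x = (\<Prod>i\<in>V. x i ^ \<alpha> i)"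

text \<open>Exponents range over a box rather than over total degree at most \<open>D\<close>. The
  box is larger but has the same order of growth, and its size is the plain power (D +
  1)^|V|.\<close>

lemma polyfun_monomials:
  assumes "polyfun V D p" "finite V"
  shows "\<exists>c. \<forall>x. p x = (\<Sum>\<alpha>\<in>PiE V (\<lambda>_. {..D}). c \<alpha> * monom_fun V \<alpha> x)"
  using assms(1)
proof (induction rule: polyfun.induct)
  case (const D c)
  let ?z = "\<lambda>i\<in>V. 0"
  have z: "?z \<in> PiE V (\<lambda>_. {..D})" by auto
  have "(\<Sum>\<alpha>\<in>PiE V (\<lambda>_. {..D}). (if \<alpha> = ?z then c else 0) * monom_fun V \<alpha> x)
      = c" for x
  proof -
    have "(\<Sum>\<alpha>\<in>PiE V (\<lambda>_. {..D}). (if \<alpha> = ?z then c else 0) * monom_fun V \<alpha> x)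
      = (\<Sum>\<alpha>\<in>PiE V (\<lambda>_. {..D}). if \<alpha> = ?z then c * monom_fun V ?z x else 0)"
      by (intro sum.cong) auto
    also have "\<dots> = c * monom_fun V ?z x" using z assms(2) by (subst sum.delta) (auto intro: finite_PiE)
    also have "\<dots> = c" by (simp add: monom_fun_def)
    finally show ?thesis .
  qed
  then show ?case by (intro exI[of _ "\<lambda>\<alpha>. if \<alpha> = ?z then c else 0"]) simp
next
  case (add D p q)
  then obtain c d where "\<forall>x. p x = (\<Sum>\<alpha>\<in>PiE V (\<lambda>_. {..D}). c \<alpha> * monom_fun V \<alpha> x)"
    "\<forall>x. q x = (\<Sum>\<alpha>\<in>PiE V (\<lambda>_. {..D}). d \<alpha> * monom_fun V \<alpha> x)" by blast
  then show ?case
    by (intro exI[of _ "\<lambda>\<alpha>. c \<alpha> + d \<alpha>"]) (simp add: distrib_right sum.distrib)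
next
  case (var i D p)
  then obtain c where c: "\<forall>x. p x = (\<Sum>\<alpha>\<in>PiE V (\<lambda>_. {..D}). c \<alpha> * monom_fun V \<alpha> x)" by blast
  let ?up = "\<lambda>\<alpha>. \<alpha>(i := Suc (\<alpha> i))"
  have inj: "inj_on ?up (PiE V (\<lambda>_. {..D}))"
  proof (rule inj_onI)
    fix a b assume "?up a = ?up b"
    then have "a j = b j" for j by (metis fun_upd_apply nat.inject)
    then show "a = b" by blast
  qed
  have sub: "?up ` PiE V (\<lambda>_. {..D}) \<subseteq> PiE V (\<lambda>_. {..Suc D})"
    using var(1) by (auto simp: PiE_iff extensional_def) (meson le_SucI)
  have up: "monom_fun V (?up \<alpha>) x = x i * monom_fun V \<alpha> x" for \<alpha> x
  proof -
    have "monom_fun V (?up \<alpha>) x = x i ^ Suc (\<alpha> i) * (\<Prod>j\<in>V-{i}. x j ^ \<alpha> j)"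
      unfolding monom_fun_def using var(1) assms(2)
      by (subst prod.remove[of V i]) (auto intro!: prod.cong)
    also have "\<dots> = x i * monom_fun V \<alpha> x"
      unfolding monom_fun_def using var(1) assms(2) by (simp add: prod.remove[of V i])
    finally show ?thesis .
  qed
  \<comment> \<open>Raising the exponent of \<open>i\<close> is injective, so the coefficients of
    \<open>p\<close> are carried along \<open>?up\<close>; exponents outside its image get
    0.\<close>
  define d where "d = (\<lambda>\<beta>. if \<beta> \<in> ?up ` PiE V (\<lambda>_. {..D}) then c (the_inv_into (PiE V (\<lambda>_. {..D})) ?up \<beta>) else 0)"
  have "x i * p x = (\<Sum>\<beta>\<in>PiE V (\<lambda>_. {..Suc D}). d \<beta> * monom_fun V \<beta> x)" for x
  proof -
    have "(\<Sum>\<beta>\<in>PiE V (\<lambda>_. {..Suc D}). d \<beta> * monom_fun V \<beta> x)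
        = (\<Sum>\<beta>\<in>?up ` PiE V (\<lambda>_. {..D}). d \<beta> * monom_fun V \<beta> x)"
      using assms(2) by (intro sum.mono_neutral_right finite_PiE sub) (auto simp: d_def)
    also have "\<dots> = (\<Sum>\<alpha>\<in>PiE V (\<lambda>_. {..D}). d (?up \<alpha>) * monom_fun V (?up \<alpha>) x)"
      by (subst sum.reindex[OF inj]) simp
    also have "\<dots> = (\<Sum>\<alpha>\<in>PiE V (\<lambda>_. {..D}). x i * (c \<alpha> * monom_fun V \<alpha> x))"
      by (intro sum.cong refl) (simp add: d_def the_inv_into_f_f[OF inj] up del: fun_upd_apply)
    also have "\<dots> = x i * p x" using c by (simp add: sum_distrib_left)
    finally show ?thesis by simp
  qed
  then show ?case by blast
qed

lemma monomials_independent: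
  assumes "finite V" "\<And>x. (\<Sum>\<alpha>\<in>PiE V (\<lambda>_. {..D}). c \<alpha> * monom_fun V \<alpha> x) = 0"
  shows "\<forall>\<alpha>\<in>PiE V (\<lambda>_. {..D}). c \<alpha> = 0"
  using assms
proof (induction V arbitrary: c rule: finite_induct)
  case empty
  then show ?case by (simp add: monom_fun_def)
next
  case (insert v V)
  let ?Q = "PiE V (\<lambda>_. {..D})"
  have mf: "monom_fun (insert v V) (\<alpha>(v := k)) (x(v := t)) = t ^ k * monom_fun V \<alpha> x" for \<alpha> k x t
    proof -
    have "(\<Prod>i\<in>V. (x(v := t)) i ^ (\<alpha>(v := k)) i) = (\<Prod>i\<in>V. x i ^ \<alpha> i)"
      using insert.hyps by (intro prod.cong) auto
    then show ?thesis using insert.hyps by (simp add: monom_fun_def)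
  qed
  \<comment> \<open>With the other variables fixed this is a univariate polynomial in the value
    \<open>t\<close> of \<open>v\<close>; its coefficients vanish for every \<open>x\<close>, and
    the induction hypothesis applies to each of them.\<close>
  have sum_eq: "(\<Sum>k\<le>D. (\<Sum>\<alpha>\<in>?Q. c (\<alpha>(v := k)) * monom_fun V \<alpha> x) * t ^ k) = 0" for x t
  proof -
    have "0 = (\<Sum>\<beta>\<in>PiE (insert v V) (\<lambda>_. {..D}). c \<beta> * monom_fun (insert v V) \<beta> (x(v := t)))"
      using insert.prems by simp
    also have "\<dots> = (\<Sum>(k, \<alpha>)\<in>{..D} \<times> ?Q. c (\<alpha>(v := k)) * monom_fun (insert v V) (\<alpha>(v := k)) (x(v := t)))"
      unfolding PiE_insert_eq
      using sum.reindex[OF inj_combinator[OF insert.hyps(2), of "\<lambda>_. {..D}"]]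
      by (simp add: case_prod_unfold)
    also have "\<dots> = (\<Sum>k\<le>D. (\<Sum>\<alpha>\<in>?Q. c (\<alpha>(v := k)) * monom_fun V \<alpha> x) * t ^ k)"
      unfolding mf by (subst sum.cartesian_product[symmetric]) (simp add: sum_distrib_left sum_distrib_right ac_simps)
    finally show ?thesis by simp
  qed
  then have "\<forall>k\<le>D. (\<Sum>\<alpha>\<in>?Q. c (\<alpha>(v := k)) * monom_fun V \<alpha> x) = 0" for x
    using polyfun_eq_0[of "\<lambda>k. \<Sum>\<alpha>\<in>?Q. c (\<alpha>(v := k)) * monom_fun V \<alpha> x" D] by blast
  then have *: "\<forall>\<alpha>\<in>?Q. c (\<alpha>(v := k)) = 0" if "k \<le> D" for k
    using insert.IH[of "\<lambda>\<alpha>. c (\<alpha>(v := k))"] that by blast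
  show ?case
  proof
    fix \<beta> assume "\<beta> \<in> PiE (insert v V) (\<lambda>_. {..D})"
    then obtain k \<alpha> where "\<beta> = \<alpha>(v := k)" "k \<le> D" "\<alpha> \<in> ?Q" unfolding PiE_insert_eq by auto
    with * show "c \<beta> = 0" by blast
  qed
qed

subsection \<open>Linear independence of families of functions\<close>

text \<open>Families are indexed, so a repeated function makes a family dependent, and only values
  on \<open>Y\<close> count: this is independence of restrictions.\<close>

definition indep_fam :: "'i set \<Rightarrow> ('i \<Rightarrow> 'a \<Rightarrow> complex) \<Rightarrow> 'a set \<Rightarrow> bool" where
  "indep_fam I g Y \<longleftrightarrow> (\<forall>c. (\<forall>y\<in>Y. (\<Sum>i\<in>I. c i * g i y) = 0) \<longrightarrow> (\<forall>i\<in>I. c i = 0))"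

text \<open>Gaussian elimination: an equation with a nonzero entry determines one unknown from the
  others, and both are removed.\<close>

lemma homogeneous_system:
  fixes M :: "'i \<Rightarrow> 'b \<Rightarrow> complex"
  assumes "finite B" "finite I" "card B < card I"
  shows "\<exists>c. (\<exists>i\<in>I. c i \<noteq> 0) \<and> (\<forall>b\<in>B. (\<Sum>i\<in>I. c i * M i b) = 0)"
  using assms
proof (induction B arbitrary: I M rule: finite_induct)
  case empty
  then obtain i where "i \<in> I" by fastforce
  then show ?case by (intro exI[of _ "\<lambda>_. 1"]) auto
next
  case (insert b B)
  show ?case
  proof (cases "\<forall>i\<in>I. M i b = 0")
    case True
    obtain c where "\<exists>i\<in>I. c i \<noteq> 0" "\<forall>b\<in>B. (\<Sum>i\<in>I. c i * M i b) = 0"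
      using insert.IH[of I M] insert.prems insert.hyps by auto
    then show ?thesis using True by (intro exI[of _ c]) auto
  next
    case False
    then obtain k where k: "k \<in> I" "M k b \<noteq> 0" by blast
    let ?J = "I - {k}"
    define M' where "M' = (\<lambda>i x. M i x - M i b / M k b * M k x)"
    have "card B < card ?J" using insert.prems insert.hyps k by simp
    then obtain c where c: "\<exists>i\<in>?J. c i \<noteq> 0" "\<forall>x\<in>B. (\<Sum>i\<in>?J. c i * M' i x) = 0"
      using insert.IH[of ?J M'] insert.prems by auto
    define d where "d = c(k := - (\<Sum>i\<in>?J. c i * M i b / M k b))"
    have d: "(\<Sum>i\<in>I. d i * M i x) = (\<Sum>i\<in>?J. c i * M' i x)" for x
    proof -
      have "(\<Sum>i\<in>I. d i * M i x) = d k * M k x + (\<Sum>i\<in>?J. d i * M i x)"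
        using k insert.prems by (subst sum.remove[of I k]) auto
      also have "(\<Sum>i\<in>?J. d i * M i x) = (\<Sum>i\<in>?J. c i * M i x)"
        by (intro sum.cong) (auto simp: d_def)
      also have "d k * M k x = - (\<Sum>i\<in>?J. c i * M i b / M k b * M k x)"
        by (simp add: d_def sum_distrib_right)
      finally show ?thesis by (simp add: M'_def algebra_simps sum_subtractf)
    qed
    have "(\<Sum>i\<in>I. d i * M i b) = 0" unfolding d using k by (simp add: M'_def)
    moreover have "\<exists>i\<in>I. d i \<noteq> 0" using c(1) by (auto simp: d_def)
    ultimately show ?thesis using d c(2) by (intro exI[of _ d]) auto
  qed
qed

lemma indep_fam_card_le:
  assumes "indep_fam I g Y" "finite I" "finite B"
    and "\<And>i. i \<in> I \<Longrightarrow> \<exists>c. \<forall>y\<in>Y. g i y = (\<Sum>b\<in>B. c b * w b y)"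
  shows "card I \<le> card B"
proof (rule ccontr)
  assume "\<not> card I \<le> card B"
  obtain M where M: "\<And>i y. i \<in> I \<Longrightarrow> y \<in> Y \<Longrightarrow> g i y = (\<Sum>b\<in>B. M i b * w b y)"
    using assms(4) by metis
  obtain c where c: "\<exists>i\<in>I. c i \<noteq> 0" "\<forall>b\<in>B. (\<Sum>i\<in>I. c i * M i b) = 0"
    using homogeneous_system[of B I M] assms \<open>\<not> card I \<le> card B\<close> by auto
  have "(\<Sum>i\<in>I. c i * g i y) = 0" if "y \<in> Y" for y
  proof -
    have "(\<Sum>i\<in>I. c i * g i y) = (\<Sum>i\<in>I. \<Sum>b\<in>B. c i * M i b * w b y)"
      using M that by (simp add: sum_distrib_left ac_simps)
    also have "\<dots> = (\<Sum>b\<in>B. (\<Sum>i\<in>I. c i * M i b) * w b y)"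
      by (subst sum.swap) (simp add: sum_distrib_right)
    finally show ?thesis using c by simp
  qed
  then show False using assms(1) c(1) unfolding indep_fam_def by blast
qed

text \<open>Every comparison of dimensions below ends here: two counts of forms, of orders s and t
  in q, are set against each other.\<close>

lemma power_growth_contradiction:
  fixes s t K C :: nat
  assumes "\<And>q. q ^ s \<le> K * (C * q + 1) ^ t"
  shows "s \<le> t"
proof (rule ccontr)
  assume "\<not> s \<le> t"
  \<comment> \<open>One more than the constant left after
    \<open>C * q + 1 \<le> (C + 1) * q\<close>, so that a single surplus factor \<open>q\<close> is
    too large.\<close>
  define q where "q = Suc (K * (C + 1) ^ t)"
  have "q * q ^ t = q ^ Suc t" by simp
  also have "\<dots> \<le> q ^ s" using \<open>\<not> s \<le> t\<close> by (intro power_increasing) (auto simp: q_def)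
  also have "\<dots> \<le> K * (C * q + 1) ^ t" by (rule assms)
  also have "\<dots> \<le> K * ((C + 1) * q) ^ t"
    by (intro mult_left_mono power_mono) (auto simp: q_def)
  also have "\<dots> = (K * (C + 1) ^ t) * q ^ t" unfolding power_mult_distrib by simp
  finally have "q \<le> K * (C + 1) ^ t" by (simp add: q_def)
  then show False by (simp add: q_def)
qed

subsection \<open>Homogeneous polynomials and Zariski closed sets\<close>

locale complex_space = vector_space s for s :: "complex \<Rightarrow> 'w::ab_group_add \<Rightarrow> 'w"
begin

abbreviation linform :: "('w \<Rightarrow> complex) \<Rightarrow> bool" where
  "linform l \<equiv> Vector_Spaces.linear s (*) l"

lemma form_pair: "vector_space_pair s ((*) :: complex \<Rightarrow> complex \<Rightarrow> complex)"
  by unfold_locales (auto simp: algebra_simps)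

lemmas linform_0 = vector_space_pair.linear_0[OF form_pair]
  and linform_add = vector_space_pair.linear_add[OF form_pair]
  and linform_scale = vector_space_pair.linear_scale[OF form_pair]
  and linform_sum = vector_space_pair.linear_sum[OF form_pair]
  and linform_diff = vector_space_pair.linear_diff[OF form_pair]
  and linform_extend = vector_space_pair.linear_independent_extend[OF form_pair]

lemma linform_iff:
  "linform l \<longleftrightarrow> (\<forall>x y. l (x + y) = l x + l y) \<and> (\<forall>c x. l (s c x) = c * l x)"
  using form_pair by (simp add: Vector_Spaces.linear_iff vector_space_pair_def)

definition proj_image :: "'w set \<Rightarrow> 'w set set" where
  "proj_image A = {proj_pt s v | v. v \<noteq> 0 \<and> v \<in> A}"

text \<open>Testing against all linear forms avoids choosing a basis of the target.\<close>

definition polymap :: "'i set \<Rightarrow> nat \<Rightarrow> (('i \<Rightarrow> complex) \<Rightarrow> 'w) \<Rightarrow> bool" where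
  "polymap V e \<phi> \<longleftrightarrow> (\<forall>l. linform l \<longrightarrow> polyfun V e (\<lambda>x. l (\<phi> x)))"

lemma linform_separates:
  assumes "v \<noteq> 0"
  obtains l where "linform l" "l v \<noteq> 0"
proof -
  obtain l where "linform l" "\<forall>x\<in>{v}. l x = 1"
    using linform_extend[of "{v}" "\<lambda>_. 1"] assms by auto
  then show thesis using that by simp
qed

lemma linform_zero: "linform (\<lambda>_. 0)"
  by (simp add: linform_iff)

lemma linform_linear_combination: "linform l \<Longrightarrow> linform h \<Longrightarrow> linform (\<lambda>v. l v - c * h v)"
  by (simp add: linform_iff algebra_simps)

section \<open>Algebra of homogeneous forms\<close>

lemma hom_poly_cong: "hom_poly s d f \<Longrightarrow> (\<And>v. f v = g v) \<Longrightarrow> d = e \<Longrightarrow> hom_poly s e g"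
  using ext[of f g] by simp

lemma hom_poly_0: "hom_poly s d (\<lambda>_. 0)"
proof (induction d)
  case (Suc d)
  then show ?case using hom_poly.mult[OF linform_zero Suc] by simp
qed (rule hom_poly.const)

lemma hom_poly_cmult: "hom_poly s d f \<Longrightarrow> hom_poly s d (\<lambda>v. c * f v)"
proof (induction rule: hom_poly.induct)
  case (const c')
  show ?case by (rule hom_poly.const)
next
  case (add d f g)
  then show ?case using hom_poly.add by (simp add: distrib_left)
next
  case (mult l d f)
  then have "hom_poly s (Suc d) (\<lambda>v. l v * (c * f v))" by (intro hom_poly.mult)
  then show ?case by (rule hom_poly_cong) (simp_all add: ac_simps)
qed

lemma hom_poly_sum: "(\<And>i. i \<in> I \<Longrightarrow> hom_poly s d (f i)) \<Longrightarrow> hom_poly s d (\<lambda>v. \<Sum>i\<in>I. f i v)"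
  by (induction I rule: infinite_finite_induct) (auto intro: hom_poly_0 hom_poly.add)

lemma hom_poly_mult: "hom_poly s d f \<Longrightarrow> hom_poly s e g \<Longrightarrow> hom_poly s (d + e) (\<lambda>v. f v * g v)"
proof (induction rule: hom_poly.induct)
  case (const c)
  then show ?case by (simp add: hom_poly_cmult)
next
  case (add d f f')
  then show ?case using hom_poly.add by (simp add: distrib_right)
next
  case (mult l d f)
  then have "hom_poly s (Suc (d + e)) (\<lambda>v. l v * (f v * g v))" by (intro hom_poly.mult)
  then show ?case by (rule hom_poly_cong) (simp_all add: ac_simps)
qed

lemma hom_poly_power: "linform l \<Longrightarrow> hom_poly s k (\<lambda>v. l v ^ k)"
  by (induction k) (auto intro: hom_poly.mult hom_poly.const)

lemma hom_poly_prod: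
  "finite I \<Longrightarrow> (\<And>i. i \<in> I \<Longrightarrow> hom_poly s (d i) (f i)) \<Longrightarrow> hom_poly s (\<Sum>i\<in>I. d i) (\<lambda>v. \<Prod>i\<in>I. f i v)"
  by (induction I rule: finite_induct) (auto intro: hom_poly_mult hom_poly.const)

lemma hom_poly_scale: "hom_poly s d f \<Longrightarrow> f (s c v) = c ^ d * f v"
  by (induction rule: hom_poly.induct) (simp_all add: linform_scale algebra_simps)

lemma hom_poly_on_proj_pt: "hom_poly s d f \<Longrightarrow> (\<forall>w\<in>proj_pt s v. f w = 0) \<longleftrightarrow> f v = 0"
  unfolding proj_pt_def span_singleton by (auto simp: hom_poly_scale)

lemma polyfun_hom_poly: "hom_poly s d f \<Longrightarrow> polymap V e \<phi> \<Longrightarrow> polyfun V (e * d) (\<lambda>x. f (\<phi> x))"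
proof (induction rule: hom_poly.induct)
  case (mult l d f)
  then have "polyfun V (e + e * d) (\<lambda>x. l (\<phi> x) * f (\<phi> x))"
    by (intro polyfun_mult) (auto simp: polymap_def)
  then show ?case by simp
qed (auto intro: polyfun.intros)

lemma polymap_restrict_vars:
  "polymap V e \<phi> \<Longrightarrow> polymap V' e (\<lambda>x. \<phi> (\<lambda>i. if i \<in> V' then x i else 0))"
  unfolding polymap_def using polyfun_restrict_vars by blast

section \<open>Points, closed sets and closures\<close>

lemma proj_space_eq: "proj_space s = proj_image UNIV"
  by (simp add: proj_space_def proj_image_def)

lemma proj_span_eq: "proj_span s S = proj_image (span S)"
  by (simp add: proj_span_def proj_image_def)

lemma proj_image_mono: "A \<subseteq> B \<Longrightarrow> proj_image A \<subseteq> proj_image B"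
  by (auto simp: proj_image_def)

lemma proj_pt_in_image: "v \<in> A \<Longrightarrow> v \<noteq> 0 \<Longrightarrow> proj_pt s v \<in> proj_image A"
  by (auto simp: proj_image_def)

lemma in_proj_pt: "v \<in> proj_pt s v"
  by (simp add: proj_pt_def span_base)

lemma proj_pt_in_proj_space: "proj_pt s v \<in> proj_space s \<longleftrightarrow> v \<noteq> 0"
proof
  assume "proj_pt s v \<in> proj_space s"
  then obtain w where "w \<noteq> 0" "proj_pt s v = proj_pt s w" by (auto simp: proj_space_def)
  then show "v \<noteq> 0" using in_proj_pt[of w] by (auto simp: proj_pt_def)
qed (auto simp: proj_space_def)

lemma proj_image_subset: "proj_image A \<subseteq> proj_space s"
  by (auto simp: proj_image_def proj_space_def)

lemma proj_space_closed: "zariski_closed s (proj_space s)"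
  unfolding zariski_closed_def by (rule exI[of _ "{}"]) auto

lemma zariski_closed_subset: "zariski_closed s Z \<Longrightarrow> Z \<subseteq> proj_space s"
  by (auto simp: zariski_closed_def)

text \<open>Membership is tested against all forms vanishing on \<open>Z\<close>, which hides the
  particular family that defines \<open>Z\<close>.\<close>

lemma zariski_closed_memI:
  assumes "zariski_closed s Z" "v \<noteq> 0"
    and "\<And>d f. hom_poly s d f \<Longrightarrow> \<forall>w\<in>\<Union>Z. f w = 0 \<Longrightarrow> f v = 0"
  shows "proj_pt s v \<in> Z"
proof -
  obtain F where F: "\<forall>f\<in>F. \<exists>d. hom_poly s d f" "Z = {p \<in> proj_space s. \<forall>f\<in>F. \<forall>v\<in>p. f v = 0}"
    using assms(1) by (auto simp: zariski_closed_def)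
  have "\<forall>w\<in>proj_pt s v. f w = 0" if f: "f \<in> F" for f
  proof -
    obtain d where d: "hom_poly s d f" using F(1) f by blast
    have "\<forall>w\<in>\<Union>Z. f w = 0" using F(2) f by blast
    then show ?thesis using assms(3)[OF d] hom_poly_on_proj_pt[OF d] by blast
  qed
  then show ?thesis using F(2) assms(2) by (simp add: proj_pt_in_proj_space)
qed

lemma zariski_closed_vanishing:
  "zariski_closed s {p \<in> proj_space s. \<forall>d f. hom_poly s d f \<and> P f \<longrightarrow> (\<forall>v\<in>p. f v = 0)}"
  unfolding zariski_closed_def by (rule exI[of _ "{f. (\<exists>d. hom_poly s d f) \<and> P f}"]) auto

lemma zariski_closed_Int_zeros:
  assumes "zariski_closed s Z" "hom_poly s d f"
  shows "zariski_closed s {p \<in> Z. \<forall>v\<in>p. f v = 0}"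
proof -
  obtain F where F: "\<forall>f\<in>F. \<exists>d. hom_poly s d f" "Z = {p \<in> proj_space s. \<forall>f\<in>F. \<forall>v\<in>p. f v = 0}"
    using assms(1) by (auto simp: zariski_closed_def)
  then show ?thesis
    unfolding zariski_closed_def using assms(2) by (intro exI[of _ "insert f F"]) auto
qed

lemma closure_subset: "S \<subseteq> zariski_closure s S"
  by (auto simp: zariski_closure_def)

lemma closure_minimal: "S \<subseteq> Z \<Longrightarrow> zariski_closed s Z \<Longrightarrow> zariski_closure s S \<subseteq> Z"
  by (auto simp: zariski_closure_def)

lemma closure_mono: "S \<subseteq> T \<Longrightarrow> zariski_closure s S \<subseteq> zariski_closure s T"
  by (auto simp: zariski_closure_def)

lemma closure_vanishing:
  assumes "hom_poly s d f" "\<And>v. v \<in> A \<Longrightarrow> v \<noteq> 0 \<Longrightarrow> f v = 0" "w \<in> \<Union>(zariski_closure s (proj_image A))"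
  shows "f w = 0"
proof -
  let ?Z = "{p \<in> proj_space s. \<forall>v\<in>p. f v = 0}"
  have "zariski_closed s ?Z" using zariski_closed_Int_zeros[OF proj_space_closed assms(1)] .
  moreover have "proj_image A \<subseteq> ?Z"
    using hom_poly_on_proj_pt[OF assms(1)] assms(2) by (auto simp: proj_image_def proj_space_def)
  ultimately have "zariski_closure s (proj_image A) \<subseteq> ?Z" by (rule closure_minimal[rotated])
  with assms(3) show ?thesis by blast
qed

text \<open>The intersection of all closed supersets is the zero set of all forms vanishing on
  \<open>S\<close>. The assumption ensures that there is a closed superset at all.\<close>

lemma zariski_closed_closure:
  assumes "S \<subseteq> proj_space s"
  shows "zariski_closed s (zariski_closure s S)"
proof -
  let ?Z = "{p \<in> proj_space s. \<forall>d f. hom_poly s d f \<and> (\<forall>v\<in>\<Union>S. f v = 0) \<longrightarrow> (\<forall>v\<in>p. f v = 0)}"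
  have cl: "zariski_closed s ?Z" by (rule zariski_closed_vanishing)
  have "zariski_closure s S = ?Z"
  proof
    show "zariski_closure s S \<subseteq> ?Z" by (rule closure_minimal[OF _ cl]) (use assms in blast)
    show "?Z \<subseteq> zariski_closure s S"
    proof
      fix p assume p: "p \<in> ?Z"
      then obtain v where v: "p = proj_pt s v" "v \<noteq> 0" by (auto simp: proj_space_def)
      have "p \<in> Z" if Z: "zariski_closed s Z" "S \<subseteq> Z" for Z
        unfolding v(1)
      proof (rule zariski_closed_memI[OF Z(1) v(2)])
        fix d f assume "hom_poly s d f" "\<forall>w\<in>\<Union>Z. f w = 0"
        then show "f v = 0" using p v(1) Z(2) in_proj_pt[of v] by blast
      qed
      then show "p \<in> zariski_closure s S" by (auto simp: zariski_closure_def)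
    qed
  qed
  with cl show ?thesis by simp
qed

section \<open>Irreducible closed sets\<close>

lemma irreducible_closed_nonempty:
  assumes "irreducible_closed s Z"
  shows "\<exists>v\<in>\<Union>Z. v \<noteq> 0"
proof -
  have "zariski_closed s Z" "Z \<noteq> {}" using assms by (simp_all add: irreducible_closed_def)
  then obtain v where "proj_pt s v \<in> Z" "v \<noteq> 0"
    using zariski_closed_subset[of Z] by (auto simp: proj_space_def)
  then show ?thesis using in_proj_pt[of v] by blast
qed

text \<open>The vanishing ideal is prime: the zeros of \<open>f\<close> and of \<open>g\<close>
  would otherwise split \<open>Z\<close> into two proper closed pieces.\<close>

lemma irreducible_closed_mult:
  assumes Z: "irreducible_closed s Z" and f: "hom_poly s d f" and g: "hom_poly s e g"
    and fg: "\<And>v. v \<in> \<Union>Z \<Longrightarrow> f v * g v = 0"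
  shows "(\<forall>v\<in>\<Union>Z. f v = 0) \<or> (\<forall>v\<in>\<Union>Z. g v = 0)"
proof -
  let ?Z1 = "{p \<in> Z. \<forall>v\<in>p. f v = 0}" and ?Z2 = "{p \<in> Z. \<forall>v\<in>p. g v = 0}"
  have cl: "zariski_closed s Z" using Z by (simp add: irreducible_closed_def)
  have "p \<in> ?Z1 \<union> ?Z2" if p: "p \<in> Z" for p
  proof -
    obtain v where v: "p = proj_pt s v"
      using zariski_closed_subset[OF cl] p by (auto simp: proj_space_def)
    have "f v = 0 \<or> g v = 0" using fg[of v] p v in_proj_pt[of v] by auto
    then show ?thesis using hom_poly_on_proj_pt[OF f, of v] hom_poly_on_proj_pt[OF g, of v] p v by auto
  qed
  then have "Z = ?Z1 \<union> ?Z2" by blast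
  moreover have "zariski_closed s ?Z1" "zariski_closed s ?Z2"
    using zariski_closed_Int_zeros[OF cl] f g by blast+
  ultimately have "Z = ?Z1 \<or> Z = ?Z2" using Z unfolding irreducible_closed_def by blast
  then show ?thesis by blast
qed

lemma zariski_closed_psubset:
  assumes "zariski_closed s Z" "zariski_closed s Z'" "Z \<subset> Z'"
  obtains d f where "hom_poly s d f" "\<forall>v\<in>\<Union>Z. f v = 0" "\<not> (\<forall>v\<in>\<Union>Z'. f v = 0)"
proof -
  obtain p where p: "p \<in> Z'" "p \<notin> Z" using assms(3) by blast
  then obtain v where v: "p = proj_pt s v" "v \<noteq> 0"
    using zariski_closed_subset[OF assms(2)] by (auto simp: proj_space_def)
  obtain d f where "hom_poly s d f" "\<forall>w\<in>\<Union>Z. f w = 0" "f v \<noteq> 0"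
    using zariski_closed_memI[OF assms(1) v(2)] p v by blast
  moreover have "v \<in> \<Union>Z'" using p v in_proj_pt by blast
  ultimately show thesis using that by blast
qed

text \<open>Pulled back along \<open>\<phi>\<close>, forms become polynomial functions of the
  parameters, which have no zero divisors. A decomposition into two proper closed sets would yield
  two nonzero pullbacks with product zero.\<close>

lemma irreducible_closure_range:
  assumes \<phi>: "polymap V e \<phi>" and x0: "\<phi> x0 \<noteq> 0"
  shows "irreducible_closed s (zariski_closure s (proj_image (range \<phi>)))"
proof -
  let ?C = "zariski_closure s (proj_image (range \<phi>))"
  have cl: "zariski_closed s ?C" by (rule zariski_closed_closure[OF proj_image_subset])
  have in_C: "proj_pt s (\<phi> x) \<in> ?C" if "\<phi> x \<noteq> 0" for x
    using closure_subset[of "proj_image (range \<phi>)"] proj_pt_in_image[of "\<phi> x" "range \<phi>"] that by blast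
  have "?C = Z1 \<or> ?C = Z2" if Z: "zariski_closed s Z1" "zariski_closed s Z2" "?C = Z1 \<union> Z2" for Z1 Z2
  proof (rule ccontr)
    assume "\<not> (?C = Z1 \<or> ?C = Z2)"
    then have "Z1 \<subset> ?C" "Z2 \<subset> ?C" using Z(3) by blast+
    then obtain d1 f1 d2 f2 where
      f1: "hom_poly s d1 f1" "\<forall>v\<in>\<Union>Z1. f1 v = 0" "\<not> (\<forall>v\<in>\<Union>?C. f1 v = 0)" and
      f2: "hom_poly s d2 f2" "\<forall>v\<in>\<Union>Z2. f2 v = 0" "\<not> (\<forall>v\<in>\<Union>?C. f2 v = 0)"
      using zariski_closed_psubset[OF Z(1) cl] zariski_closed_psubset[OF Z(2) cl] by metis
    obtain l where l: "linform l" "l (\<phi> x0) \<noteq> 0" using linform_separates[OF x0] by blast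
    have p: "polyfun V (e * d1) (\<lambda>x. f1 (\<phi> x))" "polyfun V (e * d2) (\<lambda>x. f2 (\<phi> x))"
      "polyfun V e (\<lambda>x. l (\<phi> x))"
      using polyfun_hom_poly[OF f1(1) \<phi>] polyfun_hom_poly[OF f2(1) \<phi>] \<phi> l(1)
      by (auto simp: polymap_def)
    \<comment> \<open>The factor \<open>l\<close> takes care of the parameters with \<open>\<phi> x = 0\<close>, which have no image in \<open>\<P>V\<close>.\<close>
    have "f1 (\<phi> x) * f2 (\<phi> x) * l (\<phi> x) = 0" for x
    proof (cases "\<phi> x = 0")
      case True
      then show ?thesis using linform_0[OF l(1)] by simp
    next
      case False
      then have "proj_pt s (\<phi> x) \<in> Z1 \<union> Z2" using in_C Z(3) by blast
      then show ?thesis using f1(2) f2(2) in_proj_pt[of "\<phi> x"] by auto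
    qed
    from polyfun_mult_eq_0[OF polyfun_mult[OF p(1,2)] p(3) this] l(2)
    have "f1 (\<phi> x) * f2 (\<phi> x) = 0" for x by blast
    from polyfun_mult_eq_0[OF p(1,2) this]
    have "(\<forall>v\<in>\<Union>?C. f1 v = 0) \<or> (\<forall>v\<in>\<Union>?C. f2 v = 0)"
      using closure_vanishing[OF f1(1), of "range \<phi>"] closure_vanishing[OF f2(1), of "range \<phi>"] by blast
    with f1(3) f2(3) show False by blast
  qed
  then show ?thesis unfolding irreducible_closed_def using cl in_C[OF x0] by blast
qed

subsection \<open>Hilbert functions and lengths of chains\<close>

text \<open>A lower bound for the Hilbert function of \<open>X\<close>, that is, for the dimension
  of the degree \<open>d\<close> part of its homogeneous coordinate ring. The predicate form avoids
  quotient spaces and questions of finiteness.\<close>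

definition hilb_ge :: "nat \<Rightarrow> 'w set set \<Rightarrow> nat \<Rightarrow> bool" where
  "hilb_ge d X N \<longleftrightarrow> (\<exists>g. (\<forall>i<N. hom_poly s d (g i)) \<and> indep_fam {..<N} g (\<Union>X))"

lemma hilb_geI:
  assumes "finite I" "\<And>i. i \<in> I \<Longrightarrow> hom_poly s d (g i)" "indep_fam I g (\<Union>X)"
  shows "hilb_ge d X (card I)"
proof -
  obtain b where b: "bij_betw b {..<card I} I"
    using ex_bij_betw_nat_finite[OF assms(1)] by (auto simp: atLeast0LessThan)
  have "indep_fam {..<card I} (\<lambda>i. g (b i)) (\<Union>X)"
    unfolding indep_fam_def
  proof (intro allI impI)
    fix c assume c: "\<forall>y\<in>\<Union>X. (\<Sum>i<card I. c i * g (b i) y) = 0"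
    let ?c = "\<lambda>i. c (inv_into {..<card I} b i)"
    have "(\<Sum>i\<in>I. ?c i * g i y) = (\<Sum>i<card I. c i * g (b i) y)" for y
      using b by (subst sum.reindex_bij_betw[OF b, symmetric])
        (auto intro!: sum.cong simp: bij_betw_inv_into_left)
    with c have "\<forall>y\<in>\<Union>X. (\<Sum>i\<in>I. ?c i * g i y) = 0" by simp
    then have "\<forall>i\<in>I. ?c i = 0"
      using assms(3) unfolding indep_fam_def by (elim allE[of _ ?c]) blast
    show "\<forall>i\<in>{..<card I}. c i = 0"
    proof
      fix i assume i: "i \<in> {..<card I}"
      have "?c (b i) = 0" using \<open>\<forall>i\<in>I. ?c i = 0\<close> bij_betw_apply[OF b i] by blast
      then show "c i = 0" using bij_betw_inv_into_left[OF b i] by simp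
    qed
  qed
  moreover have "\<forall>i<card I. hom_poly s d (g (b i))" using bij_betw_apply[OF b] assms(2) by simp
  ultimately show ?thesis unfolding hilb_ge_def by (intro exI[of _ "\<lambda>i. g (b i)"]) auto
qed

lemma hilb_ge_0: "hilb_ge d X 0"
  by (auto simp: hilb_ge_def indep_fam_def)

text \<open>A linear form that is not identically zero on \<open>Z\<close> is a nonzerodivisor
  modulo the prime vanishing ideal, so multiplication by its powers preserves independence.\<close>

lemma hilb_ge_mono_degree:
  assumes Z: "irreducible_closed s Z" and "hilb_ge d Z N"
  shows "hilb_ge (d + j) Z N"
proof -
  obtain v where v: "v \<noteq> 0" "v \<in> \<Union>Z" using irreducible_closed_nonempty[OF Z] by blast
  obtain l where l: "linform l" "l v \<noteq> 0" using linform_separates[OF v(1)] by blast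
  obtain g where g: "\<forall>i<N. hom_poly s d (g i)" "indep_fam {..<N} g (\<Union>Z)"
    using assms(2) by (auto simp: hilb_ge_def)
  have "indep_fam {..<N} (\<lambda>i v. g i v * l v ^ j) (\<Union>Z)"
    unfolding indep_fam_def
  proof (intro allI impI)
    fix c assume c: "\<forall>y\<in>\<Union>Z. (\<Sum>i<N. c i * (g i y * l y ^ j)) = 0"
    have h: "hom_poly s d (\<lambda>y. \<Sum>i<N. c i * g i y)"
      using g(1) by (intro hom_poly_sum hom_poly_cmult) auto
    have "(\<Sum>i<N. c i * g i y) * l y ^ j = 0" if "y \<in> \<Union>Z" for y
    proof -
      have "(\<Sum>i<N. c i * (g i y * l y ^ j)) = 0" using c that by blast
      then show ?thesis by (simp only: sum_distrib_right mult.assoc)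
    qed
    from irreducible_closed_mult[OF Z h hom_poly_power[OF l(1)] this]
    have "(\<forall>v\<in>\<Union>Z. (\<Sum>i<N. c i * g i v) = 0) \<or> (\<forall>v\<in>\<Union>Z. l v ^ j = 0)" .
    moreover have "l v ^ j \<noteq> 0" using l(2) by simp
    ultimately have "\<forall>v\<in>\<Union>Z. (\<Sum>i<N. c i * g i v) = 0" using v(2) by blast
    then show "\<forall>i\<in>{..<N}. c i = 0" using g(2) unfolding indep_fam_def by blast
  qed
  moreover have "hom_poly s (d + j) (\<lambda>v. g i v * l v ^ j)" if "i < N" for i
    using g(1) that by (intro hom_poly_mult hom_poly_power[OF l(1)]) simp
  ultimately show ?thesis unfolding hilb_ge_def by (intro exI[of _ "\<lambda>i v. g i v * l v ^ j"]) auto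
qed

lemma sum_lessThan_add:
  fixes f :: "nat \<Rightarrow> 'a::comm_monoid_add"
  shows "(\<Sum>i<a + b. f i) = (\<Sum>i<a. f i) + (\<Sum>i<b. f (a + i))"
  by (induction b) (simp_all add: ac_simps)

text \<open>Multiplication by a form that vanishes on \<open>Z\<close> but not on \<open>Z'\<close> embeds the coordinate ring of
  \<open>Z'\<close> into the kernel of its restriction to \<open>Z\<close>.\<close>

lemma hilb_ge_psubset:
  assumes Z': "irreducible_closed s Z'" and "Z \<subseteq> Z'" and f: "hom_poly s e f"
    and fZ: "\<forall>v\<in>\<Union>Z. f v = 0" and fZ': "\<not> (\<forall>v\<in>\<Union>Z'. f v = 0)"
    and "hilb_ge (d + e) Z a" and "hilb_ge d Z' b"
  shows "hilb_ge (d + e) Z' (a + b)"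
proof -
  obtain g where g: "\<forall>i<a. hom_poly s (d + e) (g i)" "indep_fam {..<a} g (\<Union>Z)"
    using assms(6) by (auto simp: hilb_ge_def)
  obtain h where h: "\<forall>i<b. hom_poly s d (h i)" "indep_fam {..<b} h (\<Union>Z')"
    using assms(7) by (auto simp: hilb_ge_def)
  define k where "k = (\<lambda>i v. if i < a then g i v else h (i - a) v * f v)"
  have "hom_poly s (d + e) (k i)" if "i < a + b" for i
  proof (cases "i < a")
    case True
    then have "k i = g i" by (auto simp: k_def)
    then show ?thesis using g(1) True by simp
  next
    case False
    then have "k i = (\<lambda>v. h (i - a) v * f v)" by (auto simp: k_def)
    then show ?thesis using h(1) that False hom_poly_mult[OF _ f] by simp
  qed
  moreover have "indep_fam {..<a + b} k (\<Union>Z')"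
    unfolding indep_fam_def
  proof (intro allI impI)
    fix c assume "\<forall>y\<in>\<Union>Z'. (\<Sum>i<a + b. c i * k i y) = 0"
    then have c: "(\<Sum>i<a. c i * g i y) + (\<Sum>i<b. c (a + i) * h i y) * f y = 0" if "y \<in> \<Union>Z'" for y
      using that by (auto simp add: sum_lessThan_add k_def sum_distrib_right mult.assoc)
    \<comment> \<open>On \<open>Z\<close> the terms with \<open>f\<close> disappear, which kills the
      first \<open>a\<close> coefficients; afterwards \<open>f\<close> can be cancelled on
      \<open>Z'\<close>, which kills the others.\<close>
    have "(\<Sum>i<a. c i * g i y) = 0" if "y \<in> \<Union>Z" for y
    proof -
      have "f y = 0" "y \<in> \<Union>Z'" using that fZ \<open>Z \<subseteq> Z'\<close> by blast+
      then show ?thesis using c[of y] by simp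
    qed
    then have ca: "\<forall>i\<in>{..<a}. c i = 0" using g(2) unfolding indep_fam_def by blast
    have hs: "hom_poly s d (\<lambda>y. \<Sum>i<b. c (a + i) * h i y)"
      using h(1) by (intro hom_poly_sum hom_poly_cmult) auto
    have "(\<Sum>i<b. c (a + i) * h i y) * f y = 0" if "y \<in> \<Union>Z'" for y
      using c[OF that] ca by simp
    from irreducible_closed_mult[OF Z' hs f this] fZ'
    have "\<forall>y\<in>\<Union>Z'. (\<Sum>i<b. c (a + i) * h i y) = 0" by blast
    then have cb: "\<forall>i\<in>{..<b}. c (a + i) = 0"
      using h(2) unfolding indep_fam_def by (elim allE[of _ "\<lambda>i. c (a + i)"]) blast
    show "\<forall>i\<in>{..<a + b}. c i = 0"
    proof
      fix i assume "i \<in> {..<a + b}"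
      then show "c i = 0" using ca cb by (cases "i < a") (auto dest: bspec[of _ _ "i - a"])
    qed
  qed
  ultimately show ?thesis unfolding hilb_ge_def by (intro exI[of _ "k"]) auto
qed

section \<open>Chains of irreducible closed sets and Krull dimension\<close>

definition irr_chain :: "nat \<Rightarrow> (nat \<Rightarrow> 'w set set) \<Rightarrow> 'w set set \<Rightarrow> bool" where
  "irr_chain r Z X \<longleftrightarrow> (\<forall>i\<le>r. irreducible_closed s (Z i) \<and> Z i \<subseteq> X) \<and> (\<forall>i<r. Z i \<subset> Z (Suc i))"

lemma indep_fam_subset: "indep_fam I g Y \<Longrightarrow> Y \<subseteq> Y' \<Longrightarrow> indep_fam I g Y'"
  unfolding indep_fam_def by blast

lemma hilb_ge_subset: "hilb_ge d X N \<Longrightarrow> X \<subseteq> Y \<Longrightarrow> hilb_ge d Y N"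
  unfolding hilb_ge_def by (meson indep_fam_subset Union_mono)



text \<open>Growth of order r in the Hilbert function: each strict inclusion contributes one more
  factor q. The constant \<open>E\<close> adds up the degrees of the forms that separate consecutive
  members.\<close>

lemma irr_chain_hilb_ge:
  assumes "irr_chain r Z X"
  shows "\<exists>E. \<forall>q. hilb_ge (E * q) (Z r) (q ^ r)"
  using assms
proof (induction r)
  case 0
  then have Z0: "irreducible_closed s (Z 0)" by (simp add: irr_chain_def)
  have "hilb_ge 0 (Z 0) (card {()})"
  proof (rule hilb_geI[where g = "\<lambda>_ _. 1"])
    show "indep_fam {()} (\<lambda>_ _. 1) (\<Union>(Z 0))"
      using irreducible_closed_nonempty[OF Z0] unfolding indep_fam_def by auto
  qed (auto intro: hom_poly.const)
  then show ?case by (intro exI[of _ 0]) simp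
next
  case (Suc r)
  have Z: "irreducible_closed s (Z r)" "irreducible_closed s (Z (Suc r))" "Z r \<subset> Z (Suc r)"
    using Suc.prems by (auto simp: irr_chain_def)
  obtain e f where f: "hom_poly s e f" "\<forall>v\<in>\<Union>(Z r). f v = 0" "\<not> (\<forall>v\<in>\<Union>(Z (Suc r)). f v = 0)"
    using zariski_closed_psubset[of "Z r" "Z (Suc r)"] Z by (metis irreducible_closed_def)
  have "irr_chain r Z X" using Suc.prems by (auto simp: irr_chain_def)
  then obtain E where E: "\<And>q. hilb_ge (E * q) (Z r) (q ^ r)" using Suc.IH by blast
  \<comment> \<open>Each multiplication by \<open>f\<close> adds \<open>q ^ r\<close> independent
    forms and raises the degree by \<open>e\<close>; doing it q times gives \<open>q ^ Suc r\<close>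
    in degree \<open>(E + e) * q\<close>.\<close>
  have "hilb_ge (E * q + i * e) (Z (Suc r)) (i * q ^ r)" for q i
  proof (induction i)
    case (Suc i)
    have "hilb_ge (E * q + i * e + e) (Z r) (q ^ r)"
      using hilb_ge_mono_degree[OF Z(1) E[of q], of "i * e + e"] by (simp add: ac_simps)
    from hilb_ge_psubset[OF Z(2) _ f this Suc.IH] Z(3)
    show ?case by (simp add: ac_simps)
  qed (simp add: hilb_ge_0)
  from this[of _ "_"] have "hilb_ge ((E + e) * q) (Z (Suc r)) (q ^ Suc r)" for q
    by (metis distrib_right mult.commute power_Suc)
  then show ?case by blast
qed

lemma irr_chain_length_le:
  assumes "irr_chain r Z X" "\<And>d N. hilb_ge d X N \<Longrightarrow> N \<le> K * (C * d + 1) ^ t"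
  shows "r \<le> t"
proof -
  obtain E where E: "\<And>q. hilb_ge (E * q) (Z r) (q ^ r)" using irr_chain_hilb_ge[OF assms(1)] by blast
  have "Z r \<subseteq> X" using assms(1) by (simp add: irr_chain_def)
  then have "q ^ r \<le> K * ((C * E) * q + 1) ^ t" for q
    using assms(2)[OF hilb_ge_subset[OF E]] by (simp add: mult.assoc)
  then show ?thesis by (rule power_growth_contradiction)
qed

lemma proj_dim_eq: "proj_dim s X = (if X = {} then -1 else int (Sup {r. \<exists>Z. irr_chain r Z X}))"
  by (simp add: proj_dim_def irr_chain_def)

lemma proj_dim_le:
  assumes "\<And>r Z. irr_chain r Z X \<Longrightarrow> r \<le> t"
  shows "proj_dim s X \<le> int t"
proof -
  \<comment> \<open>A nonempty \<open>X\<close> need not contain any irreducible closed set; then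
    the supremum of the empty set of naturals is 0.\<close>
  have "Sup {r. \<exists>Z. irr_chain r Z X} \<le> t"
    by (cases "{r. \<exists>Z. irr_chain r Z X} = {}") (use assms in \<open>auto intro!: cSup_least\<close>)
  then show ?thesis by (simp add: proj_dim_eq)
qed

text \<open>The bound \<open>t\<close> keeps the set of lengths bounded; only then is its supremum
  in the naturals an upper bound.\<close>

lemma proj_dim_ge:
  assumes "\<And>r Z. irr_chain r Z X \<Longrightarrow> r \<le> t" "irr_chain r Z X"
  shows "int r \<le> proj_dim s X"
proof -
  have "X \<noteq> {}" using assms(2) by (force simp: irr_chain_def irreducible_closed_def)
  moreover have "r \<le> Sup {r. \<exists>Z. irr_chain r Z X}"
    by (rule cSup_upper) (use assms in \<open>auto intro: bdd_aboveI[where M = t]\<close>)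
  ultimately show ?thesis by (simp add: proj_dim_eq)
qed

lemma proj_dim_mono:
  assumes "\<And>r Z. irr_chain r Z Y \<Longrightarrow> r \<le> t" "X \<subseteq> Y"
  shows "proj_dim s X \<le> proj_dim s Y"
proof (cases "X = {}")
  case False
  have sub: "irr_chain r Z Y" if "irr_chain r Z X" for r Z
    using that assms(2) by (auto simp: irr_chain_def)
  show ?thesis
  proof (cases "{r. \<exists>Z. irr_chain r Z X} = {}")
    case True
    then show ?thesis using False assms(2) by (auto simp: proj_dim_eq)
  next
    case ne: False
    have "Sup {r. \<exists>Z. irr_chain r Z X} \<le> Sup {r. \<exists>Z. irr_chain r Z Y}"
    proof (rule cSup_subset_mono[OF ne])
      show "bdd_above {r. \<exists>Z. irr_chain r Z Y}" using assms(1) by (auto intro: bdd_aboveI[where M = t])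
    qed (use sub in blast)
    then show ?thesis using False assms(2) by (auto simp: proj_dim_eq)
  qed
qed (simp add: proj_dim_eq)

subsection \<open>Dimension bounds from parametrizations\<close>

lemma in_Union_closure:
  assumes "v \<noteq> 0" "v \<in> A"
  shows "v \<in> \<Union>(zariski_closure s (proj_image A))"
  using subsetD[OF closure_subset proj_pt_in_image[OF assms(2,1)]] in_proj_pt by (rule UnionI)

text \<open>A form of degree d pulls back on each chart to a polynomial of degree at most e * d, and
  these lie in the span of (e * d + 1)^t monomials. A form that vanishes on all chart values
  vanishes on their multiples by homogeneity, and then on the closure.\<close>

lemma hilb_ge_upper_bound:
  fixes \<phi> :: "'c \<Rightarrow> ('i \<Rightarrow> complex) \<Rightarrow> 'w"
  assumes Ch: "finite Ch" "\<And>c. c \<in> Ch \<Longrightarrow> finite (V c) \<and> card (V c) = t \<and> polymap (V c) e (\<phi> c)"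
    and A: "A \<subseteq> {s z (\<phi> c x) | z c x. c \<in> Ch}"
    and N: "hilb_ge d (zariski_closure s (proj_image A)) N"
  shows "N \<le> card Ch * (e * d + 1) ^ t"
proof -
  obtain g where g: "\<forall>i<N. hom_poly s d (g i)"
      "indep_fam {..<N} g (\<Union>(zariski_closure s (proj_image A)))"
    using N by (auto simp: hilb_ge_def)
  let ?g = "\<lambda>i (c, x). g i (\<phi> c x)"
  let ?B = "Sigma Ch (\<lambda>c. PiE (V c) (\<lambda>_. {..e * d}))"
  \<comment> \<open>Functions on the disjoint union of the charts: a monomial on one chart, extended
    by 0 to the others.\<close>
  let ?w = "\<lambda>(c', \<alpha>) (c, x). if c = c' then monom_fun (V c) \<alpha> x else 0"
  have "indep_fam {..<N} ?g (Ch \<times> UNIV)"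
    unfolding indep_fam_def
  proof (intro allI impI)
    fix a assume a: "\<forall>y\<in>Ch \<times> UNIV. (\<Sum>i<N. a i * ?g i y) = 0"
    have h: "hom_poly s d (\<lambda>v. \<Sum>i<N. a i * g i v)"
      using g(1) by (intro hom_poly_sum hom_poly_cmult) auto
    have "(\<Sum>i<N. a i * g i v) = 0" if vA: "v \<in> A" for v
    proof -
      obtain z c x where v: "v = s z (\<phi> c x)" "c \<in> Ch"
        using subsetD[OF A vA] by auto
      have "(\<Sum>i<N. a i * g i (\<phi> c x)) = 0" using a v(2) by force
      then show ?thesis unfolding v(1) by (simp add: hom_poly_scale[OF h])
    qed
    then have "\<forall>v\<in>\<Union>(zariski_closure s (proj_image A)). (\<Sum>i<N. a i * g i v) = 0"
      using closure_vanishing[OF h] by blast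
    then show "\<forall>i\<in>{..<N}. a i = 0" using g(2) unfolding indep_fam_def by (elim allE[of _ a]) blast
  qed
  moreover have finB: "finite ?B" using Ch by (auto intro!: finite_PiE)
  moreover have "\<exists>b. \<forall>y\<in>Ch \<times> UNIV. ?g i y = (\<Sum>\<beta>\<in>?B. b \<beta> * ?w \<beta> y)" if i: "i \<in> {..<N}" for i
  proof -
    have "\<exists>b. \<forall>x. g i (\<phi> c x) = (\<Sum>\<alpha>\<in>PiE (V c) (\<lambda>_. {..e * d}). b \<alpha> * monom_fun (V c) \<alpha> x)"
      if "c \<in> Ch" for c
      using polyfun_monomials[OF polyfun_hom_poly] g(1) Ch(2)[OF that] i by blast
    then obtain b where b: "\<And>c x. c \<in> Ch \<Longrightarrow>
        g i (\<phi> c x) = (\<Sum>\<alpha>\<in>PiE (V c) (\<lambda>_. {..e * d}). b c \<alpha> * monom_fun (V c) \<alpha> x)"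
      by metis
    have "?g i y = (\<Sum>\<beta>\<in>?B. (case \<beta> of (c', \<alpha>) \<Rightarrow> b c' \<alpha>) * ?w \<beta> y)" if y: "y \<in> Ch \<times> UNIV" for y
    proof -
      obtain c x where cx: "y = (c, x)" "c \<in> Ch" using y by auto
      have "(\<Sum>\<beta>\<in>?B. (case \<beta> of (c', \<alpha>) \<Rightarrow> b c' \<alpha>) * ?w \<beta> y)
          = (\<Sum>c'\<in>Ch. \<Sum>\<alpha>\<in>PiE (V c') (\<lambda>_. {..e * d}). b c' \<alpha> * ?w (c', \<alpha>) y)"
        using Ch by (subst sum.Sigma) (auto intro!: finite_PiE sum.cong)
      also have "\<dots> = (\<Sum>c'\<in>Ch. if c' = c then \<Sum>\<alpha>\<in>PiE (V c) (\<lambda>_. {..e * d}). b c \<alpha> * monom_fun (V c) \<alpha> x else 0)"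
        by (intro sum.cong) (auto simp: cx)
      also have "\<dots> = g i (\<phi> c x)" using Ch(1) cx(2) by (simp add: b)
      finally show ?thesis by (simp add: cx)
    qed
    then show ?thesis by blast
  qed
  ultimately have "card {..<N} \<le> card ?B" by (intro indep_fam_card_le) auto
  also have "card ?B = (\<Sum>c\<in>Ch. (e * d + 1) ^ t)"
    using Ch by (subst card_SigmaI) (auto intro!: finite_PiE sum.cong simp: card_PiE)
  finally show ?thesis by simp
qed

text \<open>Since \<open>h i t\<close> is \<open>y i * t\<close> up to higher order, the product is
  of order \<open>sum \<alpha> U\<close> in t; after division by \<open>t ^ \<mu>\<close> only the
  lowest order survives.\<close>

lemma monomial_limit:
  fixes h :: "'i \<Rightarrow> complex \<Rightarrow> complex"
  assumes "finite U" "\<mu> \<le> sum \<alpha> U"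
    and "\<And>i. i \<in> U \<Longrightarrow> ((\<lambda>t. h i t / t) \<longlongrightarrow> y i) (at 0)"
  shows "((\<lambda>t. (\<Prod>i\<in>U. h i t ^ \<alpha> i) / t ^ \<mu>) \<longlongrightarrow> (if sum \<alpha> U = \<mu> then monom_fun U \<alpha> y else 0)) (at 0)"
proof -
  have lim: "((\<lambda>t. (\<Prod>i\<in>U. (h i t / t) ^ \<alpha> i) * t ^ (sum \<alpha> U - \<mu>)) \<longlongrightarrow>
      (\<Prod>i\<in>U. y i ^ \<alpha> i) * 0 ^ (sum \<alpha> U - \<mu>)) (at 0)"
    by (intro tendsto_intros assms(3))
  \<comment> \<open>The two cases are separated by \<open>0 ^ 0 = 1\<close>.\<close>
  have val: "(\<Prod>i\<in>U. y i ^ \<alpha> i) * 0 ^ (sum \<alpha> U - \<mu>) = (if sum \<alpha> U = \<mu> then monom_fun U \<alpha> y else 0)"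
    using assms(2) by (auto simp: monom_fun_def)
  have ev: "\<forall>\<^sub>F t in at 0. (\<Prod>i\<in>U. (h i t / t) ^ \<alpha> i) * t ^ (sum \<alpha> U - \<mu>)
      = (\<Prod>i\<in>U. h i t ^ \<alpha> i) / t ^ \<mu>"
    unfolding eventually_at
  proof (intro exI[of _ 1] conjI ballI impI)
    fix t :: complex assume "t \<noteq> 0 \<and> dist t 0 < 1"
    then have t: "t \<noteq> 0" by simp
    have "(\<Prod>i\<in>U. (h i t / t) ^ \<alpha> i) = (\<Prod>i\<in>U. h i t ^ \<alpha> i) / t ^ sum \<alpha> U"
      by (simp add: power_divide prod_dividef power_sum)
    then show "(\<Prod>i\<in>U. (h i t / t) ^ \<alpha> i) * t ^ (sum \<alpha> U - \<mu>) = (\<Prod>i\<in>U. h i t ^ \<alpha> i) / t ^ \<mu>"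
      using t assms(2) by (simp add: power_diff)
  qed simp
  show ?thesis using Lim_transform_eventually[OF lim ev] unfolding val .
qed

text \<open>After subtracting multiples of \<open>h p\<^sub>0\<close>, the forms \<open>h p\<close> have the parameters as their lowest
  order terms; so do the monomials in them, which are therefore independent on the image.\<close>

lemma hilb_ge_lower_bound:
  assumes U: "finite U" "p0 \<notin> U"
    and h: "\<And>p. p \<in> insert p0 U \<Longrightarrow> linform (h p)"
    and h0: "h p0 (\<phi> (\<lambda>_. 0)) \<noteq> 0"
    and deriv: "\<And>p y. p \<in> insert p0 U \<Longrightarrow>
      ((\<lambda>t. h p (\<phi> (\<lambda>i. t * y i))) has_field_derivative y p) (at 0)"
  shows "hilb_ge (card U * q) (zariski_closure s (proj_image (\<phi> ` {y. \<forall>i. i \<notin> U \<longrightarrow> y i = 0})))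
    ((q + 1) ^ card U)"
proof -
  let ?L = "{y. \<forall>i. i \<notin> U \<longrightarrow> y i = (0::complex)}"
  let ?X = "zariski_closure s (proj_image (\<phi> ` ?L))"
  let ?A = "PiE U (\<lambda>_. {..q})"
  define c where "c p = h p (\<phi> (\<lambda>_. 0))" for p
  \<comment> \<open>Subtracting a multiple of \<open>h p0\<close>, rather than a constant, makes the
    form vanish at the base point and keeps it linear.\<close>
  define k where "k i v = h i v - c i / c p0 * h p0 v" for i v
  \<comment> \<open>The power of \<open>h p0\<close> homogenizes all monomials to
    \<open>card U * q\<close>, the largest total degree in the box of exponents.\<close>
  define g where "g \<alpha> v = h p0 v ^ (card U * q - sum \<alpha> U) * (\<Prod>i\<in>U. k i v ^ \<alpha> i)" for \<alpha> v
  have c0: "c p0 \<noteq> 0" using h0 by (simp add: c_def)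
  have le: "sum \<alpha> U \<le> card U * q" if "\<alpha> \<in> ?A" for \<alpha>
    using sum_bounded_above[of U \<alpha> q] that by (auto simp: PiE_iff)
  have "indep_fam ?A g (\<Union>?X)"
    unfolding indep_fam_def
  proof (rule allI, rule impI, rule ccontr)
    fix a assume a: "\<forall>v\<in>\<Union>?X. (\<Sum>\<alpha>\<in>?A. a \<alpha> * g \<alpha> v) = 0" and ne: "\<not> (\<forall>\<alpha>\<in>?A. a \<alpha> = 0)"
    \<comment> \<open>The lowest total degree that occurs in the relation. Along curves through the
      base point the terms of this degree dominate, so they must satisfy a relation of their
      own.\<close>
    define \<mu> where "\<mu> = (LEAST n. \<exists>\<alpha>\<in>?A. a \<alpha> \<noteq> 0 \<and> sum \<alpha> U = n)"
    have ex: "\<exists>n. \<exists>\<alpha>\<in>?A. a \<alpha> \<noteq> 0 \<and> sum \<alpha> U = n" using ne by blast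
    obtain \<alpha>0 where \<alpha>0: "\<alpha>0 \<in> ?A" "a \<alpha>0 \<noteq> 0" "sum \<alpha>0 U = \<mu>"
      using LeastI_ex[OF ex] unfolding \<mu>_def by blast
    have min: "\<mu> \<le> sum \<alpha> U" if "\<alpha> \<in> ?A" "a \<alpha> \<noteq> 0" for \<alpha>
      unfolding \<mu>_def by (rule Least_le) (use that in blast)
    let ?b = "\<lambda>\<alpha>. a \<alpha> * (if sum \<alpha> U = \<mu> then c p0 ^ (card U * q - \<mu>) else 0)"
    have zero: "(\<Sum>\<alpha>\<in>?A. ?b \<alpha> * monom_fun U \<alpha> y) = 0" if y: "y \<in> ?L" for y
    proof -
      let ?v = "\<lambda>t. \<phi> (\<lambda>i. t * y i)"
      \<comment> \<open>Within \<open>?L\<close> the form \<open>h p0\<close> is constant to first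
        order, so subtracting its multiple leaves the derivative \<open>y i\<close>
        unchanged.\<close>
      have y0: "y p0 = 0" using y U(2) by auto
      have "isCont (\<lambda>t. h p0 (?v t)) 0" using deriv[of p0 y] by (auto intro: DERIV_isCont)
      then have lim0: "((\<lambda>t. h p0 (?v t)) \<longlongrightarrow> c p0) (at 0)"
        by (simp add: isCont_def c_def)
      have limk: "((\<lambda>t. k i (?v t) / t) \<longlongrightarrow> y i) (at 0)" if i: "i \<in> U" for i
      proof -
        have "((\<lambda>t. k i (?v t)) has_field_derivative y i - c i / c p0 * y p0) (at 0)"
          unfolding k_def using i by (intro DERIV_diff DERIV_cmult deriv) auto
        moreover have "k i (?v 0) = 0" using c0 by (simp add: k_def c_def)
        ultimately show ?thesis using y0 by (simp add: has_field_derivative_iff)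
      qed
      have lim: "((\<lambda>t. \<Sum>\<alpha>\<in>?A. a \<alpha> * (h p0 (?v t) ^ (card U * q - sum \<alpha> U) *
          ((\<Prod>i\<in>U. k i (?v t) ^ \<alpha> i) / t ^ \<mu>))) \<longlongrightarrow> (\<Sum>\<alpha>\<in>?A. ?b \<alpha> * monom_fun U \<alpha> y)) (at 0)"
      proof (rule tendsto_sum)
        fix \<alpha> assume \<alpha>: "\<alpha> \<in> ?A"
        show "((\<lambda>t. a \<alpha> * (h p0 (?v t) ^ (card U * q - sum \<alpha> U) *
          ((\<Prod>i\<in>U. k i (?v t) ^ \<alpha> i) / t ^ \<mu>))) \<longlongrightarrow> ?b \<alpha> * monom_fun U \<alpha> y) (at 0)"
        proof (cases "a \<alpha> = 0")
          case False
          have "((\<lambda>t. a \<alpha> * (h p0 (?v t) ^ (card U * q - sum \<alpha> U) *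
            ((\<Prod>i\<in>U. k i (?v t) ^ \<alpha> i) / t ^ \<mu>))) \<longlongrightarrow>
              a \<alpha> * (c p0 ^ (card U * q - sum \<alpha> U) * (if sum \<alpha> U = \<mu> then monom_fun U \<alpha> y else 0))) (at 0)"
            by (intro tendsto_intros lim0 monomial_limit[OF U(1)] min[OF \<alpha> False] limk)
          moreover have "a \<alpha> * (c p0 ^ (card U * q - sum \<alpha> U) * (if sum \<alpha> U = \<mu> then monom_fun U \<alpha> y else 0))
              = ?b \<alpha> * monom_fun U \<alpha> y" by simp
          ultimately show ?thesis by simp
        qed simp
      qed
      have ev: "\<forall>\<^sub>F t in at 0. (\<Sum>\<alpha>\<in>?A. a \<alpha> * (h p0 (?v t) ^ (card U * q - sum \<alpha> U) *
          ((\<Prod>i\<in>U. k i (?v t) ^ \<alpha> i) / t ^ \<mu>))) = 0"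
        using tendsto_imp_eventually_ne[OF lim0 c0]
      proof eventually_elim
        case (elim t)
        then have "?v t \<noteq> 0" using linform_0[OF h[of p0]] by auto
        moreover have "?v t \<in> \<phi> ` ?L" using y by auto
        ultimately have "?v t \<in> \<Union>?X"
          by (intro in_Union_closure)
        then have "(\<Sum>\<alpha>\<in>?A. a \<alpha> * g \<alpha> (?v t)) = 0" by (rule bspec[OF a])
        then have "(\<Sum>\<alpha>\<in>?A. a \<alpha> * g \<alpha> (?v t)) / t ^ \<mu> = 0" by simp
        then show ?case by (simp add: sum_divide_distrib g_def)
      qed
      show ?thesis using Lim_transform_eventually[OF lim ev] by (simp add: tendsto_const_iff)
    qed
    have "(\<Sum>\<alpha>\<in>?A. ?b \<alpha> * monom_fun U \<alpha> x) = 0" for x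
    proof -
      have "monom_fun U \<alpha> (\<lambda>i. if i \<in> U then x i else 0) = monom_fun U \<alpha> x" for \<alpha>
        by (auto simp: monom_fun_def intro!: prod.cong)
      then show ?thesis using zero[of "\<lambda>i. if i \<in> U then x i else 0"] by simp
    qed
    from monomials_independent[OF U(1) this] \<alpha>0 c0 show False by auto
  qed
  moreover have "hom_poly s (card U * q) (g \<alpha>)" if "\<alpha> \<in> ?A" for \<alpha>
  proof -
    have "linform (k i)" if "i \<in> U" for i
      unfolding k_def using that by (intro linform_linear_combination h) auto
    then have "hom_poly s (\<Sum>i\<in>U. \<alpha> i) (\<lambda>v. \<Prod>i\<in>U. k i v ^ \<alpha> i)"
      using U(1) by (intro hom_poly_prod hom_poly_power) auto
    from hom_poly_mult[OF hom_poly_power[OF h, of p0 "card U * q - sum \<alpha> U"] this] le[OF that]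
    show ?thesis by (simp add: g_def[abs_def])
  qed
  ultimately have "hilb_ge (card U * q) ?X (card ?A)"
    using U(1) by (intro hilb_geI) (auto intro: finite_PiE)
  then show ?thesis using U(1) by (simp add: card_PiE)
qed

text \<open>Consecutive sets of the flag differ because equality would give a set with k parameters,
  of growth at most k, as many forms as k + 1 parameters produce. The direction \<open>p0\<close>
  never enters the flag: its form serves as the homogenizing coordinate, which explains
  \<open>card V - 1\<close>.\<close>

lemma irr_chain_of_parametrization:
  assumes V: "finite V" "p0 \<in> V" and \<phi>: "polymap V e \<phi>" and J: "zariski_closed s J"
    and near: "\<And>y. \<forall>\<^sub>F t in at_right 0. proj_pt s (\<phi> (\<lambda>i. complex_of_real t * y i)) \<in> J"
    and h: "\<And>p. p \<in> V \<Longrightarrow> linform (h p)"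
    and h0: "h p0 (\<phi> (\<lambda>_. 0)) \<noteq> 0"
    and deriv: "\<And>p y. p \<in> V \<Longrightarrow> ((\<lambda>t. h p (\<phi> (\<lambda>i. t * y i))) has_field_derivative y p) (at 0)"
  shows "\<exists>Z. irr_chain (card V - 1) Z J"
proof -
  \<comment> \<open>Forms vanishing on \<open>J\<close> vanish at every value of
    \<open>\<phi>\<close>, not only near 0. Hence the closures \<open>Z k\<close> lie in
    \<open>J\<close> although \<open>near\<close> is a local statement.\<close>
  have \<phi>_J: "f (\<phi> y) = 0" if f: "hom_poly s d f" "\<forall>v\<in>\<Union>J. f v = 0" for d f y
  proof (rule polyfun_zero_near_0[OF polyfun_hom_poly[OF f(1) \<phi>]])
    show "\<forall>\<^sub>F t in at_right 0. f (\<phi> (\<lambda>i. complex_of_real t * y i)) = 0"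
      using near[of y] by eventually_elim (use f(2) in_proj_pt in blast)
  qed
  obtain b where b: "bij_betw b {..<card (V - {p0})} (V - {p0})"
    using ex_bij_betw_nat_finite[of "V - {p0}"] V(1) by (auto simp: atLeast0LessThan)
  define U where "U k = b ` {..<k}" for k
  let ?L = "\<lambda>U. {y. \<forall>i. i \<notin> U \<longrightarrow> y i = (0::complex)}"
  define Z where "Z k = zariski_closure s (proj_image (\<phi> ` ?L (U k)))" for k
  let ?\<phi> = "\<lambda>k x. \<phi> (\<lambda>i. if i \<in> U k then x i else 0)"
  let ?r = "card V - 1"
  have card_V: "card (V - {p0}) = ?r" using V by simp
  have U: "U k \<subseteq> V" "p0 \<notin> U k" "card (U k) = k" "finite (U k)" if k: "k \<le> ?r" for k
  proof -
    have sub: "{..<k} \<subseteq> {..<card (V - {p0})}" using k card_V by auto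
    then have "U k \<subseteq> V - {p0}" 
      using image_mono[OF sub, of b] bij_betw_imp_surj_on[OF b] by (simp add: U_def)
    then show "U k \<subseteq> V" "p0 \<notin> U k" by auto
    show "card (U k) = k" unfolding U_def
      using b sub by (subst card_image) (auto simp: bij_betw_def intro: inj_on_subset)
    show "finite (U k)" by (simp add: U_def)
  qed
  have range: "range (?\<phi> k) = \<phi> ` ?L (U k)" for k
  proof
    show "\<phi> ` ?L (U k) \<subseteq> range (?\<phi> k)"
    proof
      fix w assume "w \<in> \<phi> ` ?L (U k)"
      then obtain y where y: "w = \<phi> y" "y \<in> ?L (U k)" by blast
      then have "(\<lambda>i. if i \<in> U k then y i else 0) = y" by auto
      then have "w = ?\<phi> k y" using y(1) by simp
      then show "w \<in> range (?\<phi> k)" by (intro image_eqI[where x = y]) auto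
    qed
  qed auto
  have pm: "polymap (U k) e (?\<phi> k)" for k by (rule polymap_restrict_vars[OF \<phi>])
  have "\<phi> (\<lambda>_. 0) \<noteq> 0" using h0 linform_0[OF h[OF V(2)]] by auto
  then have "?\<phi> k (\<lambda>_. 0) \<noteq> 0" for k by simp
  from irreducible_closure_range[OF pm this]
  have irr: "irreducible_closed s (Z k)" for k by (simp add: Z_def range)
  have sub_J: "Z k \<subseteq> J" for k
    unfolding Z_def
  proof (rule closure_minimal[OF _ J], rule subsetI)
    fix p assume "p \<in> proj_image (\<phi> ` ?L (U k))"
    then obtain y where "p = proj_pt s (\<phi> y)" "\<phi> y \<noteq> 0" by (auto simp: proj_image_def)
    then show "p \<in> J" using zariski_closed_memI[OF J] \<phi>_J by blast
  qed
  have "Z k \<subset> Z (Suc k)" if k: "k < ?r" for k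
  proof
    have "U k \<subseteq> U (Suc k)" by (auto simp: U_def)
    then show "Z k \<subseteq> Z (Suc k)"
      unfolding Z_def by (intro closure_mono proj_image_mono image_mono) auto
    show "Z k \<noteq> Z (Suc k)"
    proof
      assume eq: "Z k = Z (Suc k)"
      have "q ^ Suc k \<le> 1 * (e * Suc k * q + 1) ^ k" for q
      proof -
        have "hilb_ge (card (U (Suc k)) * q) (Z (Suc k)) ((q + 1) ^ card (U (Suc k)))"
          unfolding Z_def
          by (rule hilb_ge_lower_bound[of "U (Suc k)" p0 h])
            (use U[of "Suc k"] k V(2) h h0 deriv in auto)
        then have *: "hilb_ge (Suc k * q) (Z k) ((q + 1) ^ Suc k)" using U[of "Suc k"] k eq by simp
        have "(q + 1) ^ Suc k \<le> card {()} * (e * (Suc k * q) + 1) ^ k"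
        proof (rule hilb_ge_upper_bound[where \<phi> = "\<lambda>_. ?\<phi> k" and V = "\<lambda>_. U k" and A = "\<phi> ` ?L (U k)"])
          show "\<phi> ` ?L (U k) \<subseteq> {s z (?\<phi> k x) | z c x. c \<in> {()}}"
          proof
            fix w assume "w \<in> \<phi> ` ?L (U k)"
            then have "w \<in> range (?\<phi> k)" by (simp only: range)
            then obtain x where "w = s 1 (?\<phi> k x)" by auto
            then show "w \<in> {s z (?\<phi> k x) | z c x. c \<in> {()}}" by blast
          qed
        qed (use U[of k] k pm * in \<open>auto simp: Z_def\<close>)
        moreover have "q ^ Suc k \<le> (q + 1) ^ Suc k" by (rule power_mono) auto
        ultimately show ?thesis by (simp only: card.insert mult.assoc) (auto intro: order_trans)
      qed
      from power_growth_contradiction[OF this] show False by simp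
    qed
  qed
  then have "irr_chain ?r Z J" using irr sub_J by (auto simp: irr_chain_def)
  then show ?thesis by blast
qed

end

subsection \<open>Tensor coordinates\<close>

lemma multilinear_on_sum:
  assumes ml: "multilinear_on sV sW n A g" and "vector_space sV" "vector_space sW"
    and w: "w \<in> PiE {1..n} A" and i: "i \<in> {1..n}" and sub: "module.subspace sV (A i)"
    and "finite F" and b: "\<And>q. q \<in> F \<Longrightarrow> b q \<in> A i"
  shows "g (w(i := \<Sum>q\<in>F. sV (x q) (b q))) = (\<Sum>q\<in>F. sW (x q) (g (w(i := b q))))"
proof -
  interpret V: vector_space sV by fact
  interpret W: vector_space sW by fact
  have addg: "g (w(i := y + z)) = g (w(i := y)) + g (w(i := z))" if "y \<in> A i" "z \<in> A i" for y z
    using ml w i that unfolding multilinear_on_def by blast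
  have scaleg: "g (w(i := sV c y)) = sW c (g (w(i := y)))" if "y \<in> A i" for c y
    using ml w i that unfolding multilinear_on_def by blast
  show ?thesis
    using \<open>finite F\<close> b
  proof (induction F rule: finite_induct)
    case empty
    have "0 \<in> A i" using sub by (rule V.subspace_0)
    then have "g (w(i := 0)) = 0" using scaleg[of 0 0] by (simp del: fun_upd_apply)
    then show ?case by (simp only: sum.empty)
  next
    case (insert q F)
    have "(\<Sum>q\<in>F. sV (x q) (b q)) \<in> A i" "sV (x q) (b q) \<in> A i"
      using insert.prems sub by (auto intro: V.subspace_sum V.subspace_scale)
    then show ?case using insert addg scaleg by (simp del: fun_upd_apply)
  qed
qed

lemma multilinear_on_expand:
  assumes ml: "multilinear_on sV sW n A g" and vs: "vector_space sV" "vector_space sW"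
    and sub: "\<And>i. i \<in> {1..n} \<Longrightarrow> module.subspace sV (A i)"
    and F: "\<And>i. i \<in> {1..n} \<Longrightarrow> finite (F i)"
    and b: "\<And>i q. i \<in> {1..n} \<Longrightarrow> q \<in> F i \<Longrightarrow> b i q \<in> A i"
    and v: "\<And>i. i \<in> {1..n} \<Longrightarrow> v i = (\<Sum>q\<in>F i. sV (x i q) (b i q))"
  shows "g (\<lambda>i\<in>{1..n}. v i)
    = (\<Sum>\<beta>\<in>PiE {1..n} F. sW (\<Prod>i\<in>{1..n}. x i (\<beta> i)) (g (\<lambda>i\<in>{1..n}. b i (\<beta> i))))"
proof -
  interpret V: vector_space sV by fact
  interpret W: vector_space sW by fact
  have v_in: "v i \<in> A i" if "i \<in> {1..n}" for i
    unfolding v[OF that] by (intro V.subspace_sum V.subspace_scale sub b that)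
  \<comment> \<open>The slots in \<open>I\<close> already carry basis vectors, the remaining ones
    still carry \<open>v\<close>; the induction converts one slot at a time.\<close>
  let ?t = "\<lambda>I \<beta>. \<lambda>i\<in>{1..n}. if i \<in> I then b i (\<beta> i) else v i"
  have "g (\<lambda>i\<in>{1..n}. v i) = (\<Sum>\<beta>\<in>PiE I F. sW (\<Prod>i\<in>I. x i (\<beta> i)) (g (?t I \<beta>)))"
    if "finite I" "I \<subseteq> {1..n}" for I
    using that
  proof (induction I rule: finite_induct)
    case empty
    then show ?case by simp
  next
    case (insert j I)
    have j: "j \<in> {1..n}" "j \<notin> I" using insert by auto
    have step: "g (?t I \<beta>) = (\<Sum>q\<in>F j. sW (x j q) (g (?t (insert j I) (\<beta>(j := q)))))"
      if \<beta>: "\<beta> \<in> PiE I F" for \<beta>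
    proof -
      have w: "?t I \<beta> \<in> PiE {1..n} A" using v_in b \<beta> by (auto simp: PiE_iff)
      have "(?t I \<beta>)(j := v j) = ?t I \<beta>" using j by (auto simp: fun_eq_iff)
      then have "g (?t I \<beta>) = g ((?t I \<beta>)(j := \<Sum>q\<in>F j. sV (x j q) (b j q)))" using v[OF j(1)] by simp
      also have "\<dots> = (\<Sum>q\<in>F j. sW (x j q) (g ((?t I \<beta>)(j := b j q))))"
        by (rule multilinear_on_sum[OF ml vs w j(1) sub F b]) (use j in auto)
      also have "\<dots> = (\<Sum>q\<in>F j. sW (x j q) (g (?t (insert j I) (\<beta>(j := q)))))"
      proof (intro sum.cong refl)
        fix q
        have "(?t I \<beta>)(j := b j q) = ?t (insert j I) (\<beta>(j := q))" using j by (auto simp: fun_eq_iff)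
        then show "sW (x j q) (g ((?t I \<beta>)(j := b j q))) = sW (x j q) (g (?t (insert j I) (\<beta>(j := q))))"
          by simp
      qed
      finally show ?thesis .
    qed
    have prod: "(\<Prod>i\<in>insert j I. x i ((\<beta>(j := q)) i)) = x j q * (\<Prod>i\<in>I. x i (\<beta> i))" for \<beta> q
    proof -
      have "(\<Prod>i\<in>I. x i ((\<beta>(j := q)) i)) = (\<Prod>i\<in>I. x i (\<beta> i))" using j by (intro prod.cong) auto
      then show ?thesis using insert.hyps by simp
    qed
    have "g (\<lambda>i\<in>{1..n}. v i) = (\<Sum>\<beta>\<in>PiE I F. sW (\<Prod>i\<in>I. x i (\<beta> i)) (g (?t I \<beta>)))"
      by (rule insert.IH) (use insert.prems in blast)
    also have "\<dots> = (\<Sum>\<beta>\<in>PiE I F. \<Sum>q\<in>F j. sW (\<Prod>i\<in>insert j I. x i ((\<beta>(j := q)) i)) (g (?t (insert j I) (\<beta>(j := q)))))"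
      by (intro sum.cong refl) (simp only: step prod W.scale_sum_right W.scale_scale mult.commute)
    also have "\<dots> = (\<Sum>q\<in>F j. \<Sum>\<beta>\<in>PiE I F. sW (\<Prod>i\<in>insert j I. x i ((\<beta>(j := q)) i)) (g (?t (insert j I) (\<beta>(j := q)))))"
      by (rule sum.swap)
    also have "\<dots> = (\<Sum>(q, \<beta>)\<in>F j \<times> PiE I F. sW (\<Prod>i\<in>insert j I. x i ((\<beta>(j := q)) i)) (g (?t (insert j I) (\<beta>(j := q)))))"
      by (rule sum.cartesian_product)
    also have "\<dots> = (\<Sum>\<beta>\<in>PiE (insert j I) F. sW (\<Prod>i\<in>insert j I. x i (\<beta> i)) (g (?t (insert j I) \<beta>)))"
      unfolding PiE_insert_eq sum.reindex[OF inj_combinator[OF j(2), of F]]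
      by (simp add: case_prod_unfold)
    finally show ?case .
  qed
  from this[of "{1..n}"]
  have "g (\<lambda>i\<in>{1..n}. v i) = (\<Sum>\<beta>\<in>PiE {1..n} F. sW (\<Prod>i\<in>{1..n}. x i (\<beta> i)) (g (?t {1..n} \<beta>)))"
    by simp
  moreover have "?t {1..n} \<beta> = (\<lambda>i\<in>{1..n}. b i (\<beta> i))" for \<beta> by (auto simp: fun_eq_iff)
  ultimately show ?thesis by simp
qed

text \<open>The coordinates \<open>c q\<close> are linear forms on the whole type, extended from a
  basis of \<open>A\<close>; their values outside \<open>A\<close> are arbitrary.\<close>

lemma (in complex_space) dual_basis_of_subspace:
  assumes "subspace A" "finite B" "span B = A"
  shows "\<exists>e c. (\<forall>q<dim A. e q \<in> A \<and> linform (c q)) \<and>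
    (\<forall>p<dim A. \<forall>q<dim A. c p (e q) = (if p = q then 1 else 0)) \<and>
    (\<forall>v\<in>A. v = (\<Sum>q<dim A. s (c q v) (e q)))"
proof -
  obtain C where C: "C \<subseteq> A" "independent C" "A \<subseteq> span C" "card C = dim A"
    using basis_exists[of A] by blast
  have fin: "finite C" using independent_span_bound[OF assms(2) C(2)] C(1) assms(3) by auto
  obtain e where e: "bij_betw e {..<dim A} C"
    using ex_bij_betw_nat_finite[OF fin] C(4) by (auto simp: atLeast0LessThan)
  have "\<exists>l. linform l \<and> (\<forall>x\<in>C. l x = (if x = e q then 1 else 0))" for q
    using linform_extend[OF C(2), of "\<lambda>x. if x = e q then 1 else 0"] by blast
  then obtain c where c: "\<And>q. linform (c q)" "\<And>q x. x \<in> C \<Longrightarrow> c q x = (if x = e q then 1 else 0)"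
    by metis
  have eC: "e q \<in> C" if "q < dim A" for q using bij_betw_apply[OF e] that by blast
  have ce: "c p (e q) = (if p = q then 1 else 0)" if "p < dim A" "q < dim A" for p q
    using c(2)[OF eC[OF that(2)]] bij_betw_imp_inj_on[OF e] that by (auto simp: inj_on_def)
  have "v = (\<Sum>q<dim A. s (c q v) (e q))" if v: "v \<in> A" for v
  proof -
    have "v \<in> span C" using v C(3) by blast
    then obtain r where r: "v = (\<Sum>x\<in>C. s (r x) x)" using span_finite[OF fin] by auto
    then have r': "v = (\<Sum>q<dim A. s (r (e q)) (e q))" 
      using sum.reindex_bij_betw[OF e, of "\<lambda>x. s (r x) x"] by simp
    have "c p v = r (e p)" if "p < dim A" for p
    proof -
      have "c p v = (\<Sum>q<dim A. r (e q) * c p (e q))"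
        unfolding r' linform_sum[OF c(1)] by (simp add: linform_scale[OF c(1)])
      also have "\<dots> = (\<Sum>q<dim A. if q = p then r (e p) else 0)"
        using that by (intro sum.cong) (auto simp: ce)
      finally show ?thesis using that by simp
    qed
    then show ?thesis using r' by simp
  qed
  moreover have "e q \<in> A" if "q < dim A" for q using eC[OF that] C(1) by blast
  ultimately show ?thesis using c(1) ce by blast
qed

locale tensor_space = complex_space sW + V: complex_space sV
  for sV :: "complex \<Rightarrow> 'v::ab_group_add \<Rightarrow> 'v" and sW :: "complex \<Rightarrow> 'w::ab_group_add \<Rightarrow> 'w" +
  fixes n :: nat and A :: "nat \<Rightarrow> 'v set" and \<tau> :: "(nat \<Rightarrow> 'v) \<Rightarrow> 'w"
    and e :: "nat \<Rightarrow> nat \<Rightarrow> 'v" and crd :: "nat \<Rightarrow> nat \<Rightarrow> 'v \<Rightarrow> complex"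
  assumes A_subspace: "i \<in> {1..n} \<Longrightarrow> V.subspace (A i)"
    and A_finite: "i \<in> {1..n} \<Longrightarrow> \<exists>B. finite B \<and> V.span B = A i"
    and tensor: "tensor_product sV sW n A \<tau>"
    and e_in: "i \<in> {1..n} \<Longrightarrow> q < V.dim (A i) \<Longrightarrow> e i q \<in> A i"
    and crd_linform: "i \<in> {1..n} \<Longrightarrow> q < V.dim (A i) \<Longrightarrow> V.linform (crd i q)"
    and crd_e: "i \<in> {1..n} \<Longrightarrow> p < V.dim (A i) \<Longrightarrow> q < V.dim (A i) \<Longrightarrow>
      crd i p (e i q) = (if p = q then 1 else 0)"
    and crd_expand: "i \<in> {1..n} \<Longrightarrow> v \<in> A i \<Longrightarrow> v = (\<Sum>q<V.dim (A i). sV (crd i q v) (e i q))"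
begin

definition a :: "nat \<Rightarrow> nat" where "a i = V.dim (A i)"

definition Idx :: "(nat \<Rightarrow> nat) set" where "Idx = PiE {1..n} (\<lambda>i. {..<a i})"

text \<open>The tensor coordinate at position \<open>\<alpha>\<close>: the linear form that the
  universal property assigns to the product of coordinate functions.\<close>

definition ht :: "(nat \<Rightarrow> nat) \<Rightarrow> 'w \<Rightarrow> complex" where
  "ht \<alpha> = (SOME h. linform h \<and> (\<forall>v\<in>PiE {1..n} A. h (\<tau> v) = (\<Prod>i\<in>{1..n}. crd i (\<alpha> i) (v i))))"

definition bt :: "(nat \<Rightarrow> nat) \<Rightarrow> 'w" where "bt \<alpha> = \<tau> (\<lambda>i\<in>{1..n}. e i (\<alpha> i))"

lemma finite_Idx: "finite Idx"
  by (auto simp: Idx_def intro: finite_PiE)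

lemma tau_multilinear: "multilinear_on sV sW n A \<tau>"
  using tensor by (simp add: tensor_product_def)

lemma ht_props:
  assumes "\<alpha> \<in> Idx"
  shows "linform (ht \<alpha>) \<and> (\<forall>v\<in>PiE {1..n} A. ht \<alpha> (\<tau> v) = (\<Prod>i\<in>{1..n}. crd i (\<alpha> i) (v i)))"
proof -
  have lin: "V.linform (crd i (\<alpha> i))" if "i \<in> {1..n}" for i
    using assms that crd_linform[OF that, of "\<alpha> i"] by (auto simp: Idx_def a_def PiE_iff)
  have upd: "(\<Prod>j\<in>{1..n}. crd j (\<alpha> j) ((v(i := x)) j)) = crd i (\<alpha> i) x * (\<Prod>j\<in>{1..n}-{i}. crd j (\<alpha> j) (v j))"
    if "i \<in> {1..n}" for v i x
  proof -
    have "(\<Prod>j\<in>{1..n}-{i}. crd j (\<alpha> j) ((v(i := x)) j)) = (\<Prod>j\<in>{1..n}-{i}. crd j (\<alpha> j) (v j))"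
      by (intro prod.cong) auto
    then show ?thesis using that by (subst prod.remove[of _ i]) (simp_all only: finite_atLeastAtMost fun_upd_same)
  qed
  have "multilinear_on sV (*) n A (\<lambda>v. \<Prod>i\<in>{1..n}. crd i (\<alpha> i) (v i))"
    unfolding multilinear_on_def
  proof (intro ballI conjI allI)
    fix v i x y assume i: "i \<in> {1..n}"
    show "(\<Prod>j\<in>{1..n}. crd j (\<alpha> j) ((v(i := x + y)) j))
      = (\<Prod>j\<in>{1..n}. crd j (\<alpha> j) ((v(i := x)) j)) + (\<Prod>j\<in>{1..n}. crd j (\<alpha> j) ((v(i := y)) j))"
      unfolding upd[OF i] V.linform_add[OF lin[OF i]] by (rule distrib_right)
  next
    fix v i c x assume i: "i \<in> {1..n}"
    show "(\<Prod>j\<in>{1..n}. crd j (\<alpha> j) ((v(i := sV c x)) j)) = c * (\<Prod>j\<in>{1..n}. crd j (\<alpha> j) ((v(i := x)) j))"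
      unfolding upd[OF i] V.linform_scale[OF lin[OF i]] by (rule mult.assoc)
  qed
  then have "\<exists>h. linform h \<and> (\<forall>v\<in>PiE {1..n} A. h (\<tau> v) = (\<Prod>i\<in>{1..n}. crd i (\<alpha> i) (v i)))"
    using tensor unfolding tensor_product_def by blast
  then show ?thesis unfolding ht_def by (rule someI_ex)
qed

lemmas ht_linform = ht_props[THEN conjunct1]
  and ht_tau = ht_props[THEN conjunct2, rule_format]

lemma tau_expand:
  assumes "v \<in> PiE {1..n} A"
  shows "\<tau> v = (\<Sum>\<alpha>\<in>Idx. sW (ht \<alpha> (\<tau> v)) (bt \<alpha>))"
proof -
  have "(\<lambda>i\<in>{1..n}. v i) = v" using assms by (auto simp: fun_eq_iff PiE_def extensional_def)
  moreover have "\<tau> (\<lambda>i\<in>{1..n}. v i)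
      = (\<Sum>\<beta>\<in>Idx. sW (\<Prod>i\<in>{1..n}. crd i (\<beta> i) (v i)) (\<tau> (\<lambda>i\<in>{1..n}. e i (\<beta> i))))"
    unfolding Idx_def
    by (rule multilinear_on_expand[OF tau_multilinear V.vector_space_axioms vector_space_axioms A_subspace])
      (use assms e_in crd_expand in \<open>auto simp: a_def PiE_iff\<close>)
  moreover have "\<dots> = (\<Sum>\<alpha>\<in>Idx. sW (ht \<alpha> (\<tau> v)) (bt \<alpha>))"
    by (intro sum.cong refl) (simp only: ht_tau[OF _ assms] bt_def)
  ultimately show ?thesis by (simp only:)
qed

text \<open>The uniqueness half of the universal property: a linear form detecting the difference of
  the two sides would kill every \<open>\<tau> v\<close>, just like the zero form, and so be
  zero.\<close>

lemma expand: "w = (\<Sum>\<alpha>\<in>Idx. sW (ht \<alpha> w) (bt \<alpha>))"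
proof (rule ccontr)
  assume "\<not> ?thesis"
  then have "w - (\<Sum>\<alpha>\<in>Idx. sW (ht \<alpha> w) (bt \<alpha>)) \<noteq> 0" by simp
  then obtain l where l: "linform l" "l (w - (\<Sum>\<alpha>\<in>Idx. sW (ht \<alpha> w) (bt \<alpha>))) \<noteq> 0"
    by (rule linform_separates)
  define h where "h w = l w - (\<Sum>\<alpha>\<in>Idx. ht \<alpha> w * l (bt \<alpha>))" for w
  have h: "h w = l (w - (\<Sum>\<alpha>\<in>Idx. sW (ht \<alpha> w) (bt \<alpha>)))" for w
    by (simp add: h_def linform_diff[OF l(1)] linform_sum[OF l(1)] linform_scale[OF l(1)])
  have "linform h"
    using l(1) ht_linform unfolding h_def linform_iff
    by (simp add: sum.distrib algebra_simps sum_distrib_left)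
  moreover have "\<forall>v\<in>PiE {1..n} A. h (\<tau> v) = 0"
    using tau_expand linform_0[OF l(1)] unfolding h by (metis diff_self)
  moreover have "\<exists>!h. linform h \<and> (\<forall>v\<in>PiE {1..n} A. h (\<tau> v) = 0)"
  proof -
    have "multilinear_on sV (*) n A (\<lambda>_. 0)" by (simp add: multilinear_on_def)
    then show ?thesis using tensor unfolding tensor_product_def by blast
  qed
  ultimately have "h = (\<lambda>_. 0)" using linform_zero by blast
  then show False using l(2) h[of w] by simp
qed

lemma polymapI:
  assumes "\<And>\<alpha>. \<alpha> \<in> Idx \<Longrightarrow> polyfun U d (\<lambda>x. ht \<alpha> (\<phi> x))"
  shows "polymap U d \<phi>"
  unfolding polymap_def
proof (intro allI impI)
  fix l assume l: "linform l"
  have "l (\<phi> x) = (\<Sum>\<alpha>\<in>Idx. l (bt \<alpha>) * ht \<alpha> (\<phi> x))" for x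
    by (subst expand) (simp add: linform_sum[OF l] linform_scale[OF l] mult.commute)
  moreover have "polyfun U d (\<lambda>x. \<Sum>\<alpha>\<in>Idx. l (bt \<alpha>) * ht \<alpha> (\<phi> x))"
    by (intro polyfun_sum polyfun_cmult assms)
  ultimately show "polyfun U d (\<lambda>x. l (\<phi> x))" by simp
qed

subsection \<open>Charts of subspace varieties\<close>

text \<open>A subspace of \<open>A i\<close> in general position to the span of the \<open>e i c\<close> with \<open>c \<notin> P i\<close> has a
  unique basis of the form \<open>vec P u i q\<close> with \<open>q \<in> P i\<close>.\<close>

definition vec :: "(nat \<Rightarrow> nat set) \<Rightarrow> (nat \<Rightarrow> nat \<Rightarrow> nat \<Rightarrow> complex) \<Rightarrow> nat \<Rightarrow> nat \<Rightarrow> 'v" where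
  "vec P u i q = e i q + (\<Sum>c\<in>{..<a i} - P i. sV (u i q c) (e i c))"

text \<open>A Tucker decomposition: \<open>S\<close> is the core tensor, and \<open>u\<close> holds
  affine coordinates on the Grassmannians of the factors.\<close>

definition chart :: "(nat \<Rightarrow> nat set) \<Rightarrow> ((nat \<Rightarrow> nat) \<Rightarrow> complex) \<Rightarrow>
    (nat \<Rightarrow> nat \<Rightarrow> nat \<Rightarrow> complex) \<Rightarrow> 'w" where
  "chart P S u = (\<Sum>\<beta>\<in>PiE {1..n} P. sW (S \<beta>) (\<tau> (\<lambda>i\<in>{1..n}. vec P u i (\<beta> i))))"

definition raw :: "(nat \<Rightarrow> nat) \<Rightarrow> 'w set" where
  "raw k = {T. \<exists>A'. (\<forall>i\<in>{1..n}. V.subspace (A' i) \<and> A' i \<subseteq> A i \<and> V.dim (A' i) = k i) \<and>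
    T \<in> span (\<tau> ` PiE {1..n} A')}"

lemma subspace_variety_eq: "subspace_variety sV sW n A \<tau> k = zariski_closure sW (proj_image (raw k))"
  unfolding subspace_variety_def proj_image_def raw_def by simp

lemma vec_in: "i \<in> {1..n} \<Longrightarrow> P i \<subseteq> {..<a i} \<Longrightarrow> q \<in> P i \<Longrightarrow> vec P u i q \<in> A i"
  unfolding vec_def using e_in[of i] A_subspace[of i]
  by (intro V.subspace_add V.subspace_sum V.subspace_scale) (auto simp: a_def)

text \<open>The coordinate matrix of the frame is in reduced echelon form, with an identity block in
  the pivot columns \<open>P i\<close> and \<open>u\<close> elsewhere.\<close>

lemma crd_vec:
  assumes "i \<in> {1..n}" "P i \<subseteq> {..<a i}" "q \<in> P i" "p < a i"
  shows "crd i p (vec P u i q) = (if p \<in> P i then (if p = q then 1 else 0) else u i q p)"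
proof -
  have l: "V.linform (crd i p)" using crd_linform assms by (simp add: a_def)
  have "crd i p (vec P u i q) = crd i p (e i q) + (\<Sum>c\<in>{..<a i} - P i. u i q c * crd i p (e i c))"
    unfolding vec_def by (simp add: V.linform_add[OF l] V.linform_sum[OF l] V.linform_scale[OF l])
  also have "(\<Sum>c\<in>{..<a i} - P i. u i q c * crd i p (e i c))
      = (\<Sum>c\<in>{..<a i} - P i. if c = p then u i q p else 0)"
    using assms crd_e[of i p] by (intro sum.cong) (auto simp: a_def)
  also have "\<dots> = (if p \<in> P i then 0 else u i q p)" using assms(4) by simp
  also have "crd i p (e i q) = (if p = q then 1 else 0)"
    using assms crd_e[of i p q] by (auto simp: a_def)
  finally show ?thesis using assms(3) by auto
qed

lemma ht_chart:
  assumes P: "\<And>i. i \<in> {1..n} \<Longrightarrow> P i \<subseteq> {..<a i}" and \<alpha>: "\<alpha> \<in> Idx"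
  shows "ht \<alpha> (chart P S u) = (\<Sum>\<beta>\<in>PiE {1..n} P. S \<beta> *
    (\<Prod>i\<in>{1..n}. if \<alpha> i \<in> P i then (if \<alpha> i = \<beta> i then 1 else 0) else u i (\<beta> i) (\<alpha> i)))"
proof -
  note l = ht_linform[OF \<alpha>]
  have "ht \<alpha> (chart P S u) = (\<Sum>\<beta>\<in>PiE {1..n} P. S \<beta> * ht \<alpha> (\<tau> (\<lambda>i\<in>{1..n}. vec P u i (\<beta> i))))"
    unfolding chart_def by (simp add: linform_sum[OF l] linform_scale[OF l])
  also have "\<dots> = (\<Sum>\<beta>\<in>PiE {1..n} P. S \<beta> *
    (\<Prod>i\<in>{1..n}. if \<alpha> i \<in> P i then (if \<alpha> i = \<beta> i then 1 else 0) else u i (\<beta> i) (\<alpha> i)))"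
  proof (rule sum.cong[OF refl])
    fix \<beta> assume \<beta>: "\<beta> \<in> PiE {1..n} P"
    have "(\<lambda>i\<in>{1..n}. vec P u i (\<beta> i)) \<in> PiE {1..n} A" using \<beta> P vec_in by (auto simp: PiE_iff)
    then have "ht \<alpha> (\<tau> (\<lambda>i\<in>{1..n}. vec P u i (\<beta> i))) = (\<Prod>i\<in>{1..n}. crd i (\<alpha> i) (vec P u i (\<beta> i)))"
      using ht_tau[OF \<alpha>] by simp
    also have "\<dots> = (\<Prod>i\<in>{1..n}. if \<alpha> i \<in> P i then (if \<alpha> i = \<beta> i then 1 else 0) else u i (\<beta> i) (\<alpha> i))"
      using \<alpha> \<beta> P by (intro prod.cong refl crd_vec) (auto simp: Idx_def PiE_iff)
    finally show "S \<beta> * ht \<alpha> (\<tau> (\<lambda>i\<in>{1..n}. vec P u i (\<beta> i))) = S \<beta> *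
      (\<Prod>i\<in>{1..n}. if \<alpha> i \<in> P i then (if \<alpha> i = \<beta> i then 1 else 0) else u i (\<beta> i) (\<alpha> i))" by simp
  qed
  finally show ?thesis .
qed

lemma vec_family:
  assumes "i \<in> {1..n}" "P i \<subseteq> {..<a i}"
  shows "inj_on (vec P u i) (P i)" "V.independent (vec P u i ` P i)"
proof -
  have c: "crd i q (vec P u i p) = (if p = q then 1 else 0)" if "q \<in> P i" "p \<in> P i" for p q
    using crd_vec[of i P p q u] assms that by auto
  show inj: "inj_on (vec P u i) (P i)"
  proof (rule inj_onI)
    fix p q assume pq: "p \<in> P i" "q \<in> P i" "vec P u i p = vec P u i q"
    have "crd i p (vec P u i q) = 1" using c[of p p] pq by simp
    then show "p = q" using c[of p q] pq by (metis zero_neq_one)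
  qed
  show "V.independent (vec P u i ` P i)"
  proof (rule V.independent_if_scalars_zero)
    show "finite (vec P u i ` P i)" using assms finite_subset by blast
    fix f x assume f: "(\<Sum>x\<in>vec P u i ` P i. sV (f x) x) = 0" and "x \<in> vec P u i ` P i"
    then obtain q where q: "q \<in> P i" "x = vec P u i q" by blast
    have l: "V.linform (crd i q)" using crd_linform[of i q] assms q by (auto simp: a_def)
    have "0 = crd i q (\<Sum>p\<in>P i. sV (f (vec P u i p)) (vec P u i p))"
      using f by (simp add: sum.reindex[OF inj] V.linform_0[OF l])
    also have "\<dots> = (\<Sum>p\<in>P i. f (vec P u i p) * crd i q (vec P u i p))"
      by (simp add: V.linform_sum[OF l] V.linform_scale[OF l])
    also have "\<dots> = (\<Sum>p\<in>P i. if p = q then f (vec P u i q) else 0)"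
      using q by (intro sum.cong) (auto simp: c)
    also have "\<dots> = f x" using q assms finite_subset[of "P i"] by simp
    finally show "f x = 0" by simp
  qed
qed

lemma chart_in_raw:
  assumes P: "\<And>i. i \<in> {1..n} \<Longrightarrow> P i \<subseteq> {..<a i} \<and> card (P i) = k i"
  shows "chart P S u \<in> raw k"
proof -
  define A' where "A' i = V.span (vec P u i ` P i)" for i
  have "V.subspace (A' i) \<and> A' i \<subseteq> A i \<and> V.dim (A' i) = k i" if i: "i \<in> {1..n}" for i
  proof (intro conjI)
    show "A' i \<subseteq> A i"
      unfolding A'_def using vec_in i P A_subspace by (intro V.span_minimal) auto
    show "V.dim (A' i) = k i"
      unfolding A'_def using vec_family[of i P u] i P
      by (simp add: V.dim_span_eq_card_independent card_image del: V.dim_span)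
  qed (simp add: A'_def)
  moreover have "chart P S u \<in> span (\<tau> ` PiE {1..n} A')"
    unfolding chart_def
    by (intro span_sum span_scale span_base imageI) (auto simp only: A'_def PiE_iff restrict_PiE_iff restrict_apply' intro!: V.span_base)
  ultimately show ?thesis unfolding raw_def by blast
qed

text \<open>Reduced echelon form by maximality instead of row operations: the complement of a
  largest coordinate set \<open>C\<close> whose span meets \<open>A'\<close> trivially is a set of
  pivots, and the pivot coordinates identify \<open>A'\<close> with the functions on
  \<open>P\<close>.\<close>

lemma pivots:
  assumes i: "i \<in> {1..n}" and A': "V.subspace A'" "A' \<subseteq> A i"
  shows "\<exists>P \<subseteq> {..<a i}. \<exists>u. card P = V.dim A' \<and>
    (\<forall>q\<in>P. e i q + (\<Sum>c\<in>{..<a i} - P. sV (u q c) (e i c)) \<in> A') \<and>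
    (\<forall>v\<in>A'. v = (\<Sum>q\<in>P. sV (crd i q v) (e i q + (\<Sum>c\<in>{..<a i} - P. sV (u q c) (e i c)))))"
proof -
  \<comment> \<open>\<open>A'\<close> meets the span of the \<open>e i c\<close>, \<open>c \<in> C\<close>, only in 0\<close>
  let ?free = "\<lambda>C. \<forall>v\<in>A'. (\<forall>q\<in>{..<a i} - C. crd i q v = 0) \<longrightarrow> v = 0"
  have exp: "v = (\<Sum>q<a i. sV (crd i q v) (e i q))" if "v \<in> A'" for v
    using crd_expand[OF i] that A'(2) unfolding a_def by blast
  have "v = 0" if "v \<in> A'" "\<forall>q\<in>{..<a i} - {}. crd i q v = 0" for v
    by (subst exp[OF that(1)]) (use that(2) in simp)
  then have "?free {}" by blast
  then obtain C where C: "C \<subseteq> {..<a i}" "?free C" "\<And>D. D \<subseteq> {..<a i} \<Longrightarrow> ?free D \<Longrightarrow> card D \<le> card C"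
    using ex_has_greatest_nat[of "\<lambda>C. C \<subseteq> {..<a i} \<and> ?free C" "{}" card "Suc (a i)"]
      card_mono[of "{..<a i}"] by (auto simp: less_Suc_eq_le)
  define P where "P = {..<a i} - C"
  have P: "P \<subseteq> {..<a i}" "{..<a i} - P = C" "finite P" using C(1) by (auto simp: P_def)
  have finC: "finite C" using C(1) finite_subset by blast
  have "\<exists>v\<in>A'. crd i q v = 1 \<and> (\<forall>p\<in>P - {q}. crd i p v = 0)" if q: "q \<in> P" for q
  proof -
    have "card (insert q C) > card C" using q finC by (simp add: P_def)
    \<comment> \<open>Maximality yields a nonzero vector whose pivot coordinates other than
      \<open>q\<close> vanish. Its coordinate at \<open>q\<close> is nonzero because
      \<open>C\<close> itself is free, so it can be scaled to 1.\<close>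
    then have "\<not> ?free (insert q C)" using C(1) C(3)[of "insert q C"] q by (auto simp: P_def)
    then obtain v where v: "v \<in> A'" "\<forall>p\<in>{..<a i} - insert q C. crd i p v = 0" "v \<noteq> 0" by blast
    have "crd i q v \<noteq> 0" using C(2) v q by (auto simp: P_def)
    moreover have "\<forall>p\<in>P. crd i p (sV (inverse (crd i q v)) v) = inverse (crd i q v) * crd i p v"
      using crd_linform[OF i] P(1) by (auto simp: V.linform_iff a_def)
    ultimately show ?thesis
      using v q P_def V.subspace_scale[OF A'(1) v(1)]
      by (intro bexI[of _ "sV (inverse (crd i q v)) v"]) auto
  qed
  then obtain f where f: "\<And>q. q \<in> P \<Longrightarrow> f q \<in> A'" "\<And>q. q \<in> P \<Longrightarrow> crd i q (f q) = 1"
      "\<And>p q. q \<in> P \<Longrightarrow> p \<in> P \<Longrightarrow> p \<noteq> q \<Longrightarrow> crd i p (f q) = 0"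
    by (metis DiffI singletonD)
  define u where "u q c = crd i c (f q)" for q c
  have split: "(\<Sum>q<a i. g q) = (\<Sum>q\<in>P. g q) + (\<Sum>c\<in>C. g c)" for g :: "nat \<Rightarrow> 'v"
    using C(1) by (subst sum.subset_diff[of C "{..<a i}"]) (auto simp: P_def)
  have f_eq: "f q = e i q + (\<Sum>c\<in>C. sV (u q c) (e i c))" if q: "q \<in> P" for q
  proof -
    have "(\<Sum>p\<in>P. sV (crd i p (f q)) (e i p)) = (\<Sum>p\<in>P. if p = q then e i q else 0)"
      using f q by (intro sum.cong) auto
    then show ?thesis using exp[OF f(1)[OF q]] split q P(3) by (simp add: u_def)
  qed
  have repr: "v = (\<Sum>q\<in>P. sV (crd i q v) (f q))" if v: "v \<in> A'" for v
  proof -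
    let ?w = "v - (\<Sum>q\<in>P. sV (crd i q v) (f q))"
    have "?w \<in> A'" using v f A'(1) by (intro V.subspace_diff V.subspace_sum V.subspace_scale)
    moreover have "crd i p ?w = 0" if p: "p \<in> {..<a i} - C" for p
    proof -
      have l: "V.linform (crd i p)" using crd_linform[OF i, of p] p by (simp add: a_def)
      have "crd i p (\<Sum>q\<in>P. sV (crd i q v) (f q)) = (\<Sum>q\<in>P. crd i q v * crd i p (f q))"
        by (simp add: V.linform_sum[OF l] V.linform_scale[OF l])
      also have "\<dots> = (\<Sum>q\<in>P. if q = p then crd i p v else 0)"
        using f p by (intro sum.cong) (auto simp: P_def)
      also have "\<dots> = crd i p v" using p P(3) by (simp add: P_def)
      finally show ?thesis by (simp add: V.linform_diff[OF l])
    qed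
    ultimately have "?w = 0" using C(2) by blast
    then show ?thesis by simp
  qed
  have vec: "f q = vec (\<lambda>_. P) (\<lambda>_. u) i q" if "q \<in> P" for q
    using f_eq[OF that] P(2) by (simp add: vec_def)
  have fam: "inj_on f P" "V.independent (f ` P)"
    using vec_family[of i "\<lambda>_. P" "\<lambda>_. u"] i P(1) vec by (auto cong: image_cong inj_on_cong)
  have "card P = V.dim A'"
  proof -
    have "A' \<subseteq> V.span (f ` P)"
    proof
      fix v assume "v \<in> A'"
      then show "v \<in> V.span (f ` P)"
        by (subst repr) (auto intro: V.span_sum V.span_scale V.span_base)
    qed
    then have "card (f ` P) = V.dim A'" using f(1) fam(2) by (intro V.basis_card_eq_dim) auto
    then show ?thesis using fam(1) by (simp add: card_image)
  qed
  moreover have "\<forall>v\<in>A'. v = (\<Sum>q\<in>P. sV (crd i q v) (e i q + (\<Sum>c\<in>C. sV (u q c) (e i c))))"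
    using repr by (simp add: f_eq)
  ultimately show ?thesis using P f(1) f_eq by (intro exI[of _ P] conjI exI[of _ u]) auto
qed

lemma chart_subspace: "subspace {chart P S u | S. True}"
proof -
  have "chart P (\<lambda>_. 0) u = 0" by (simp add: chart_def)
  moreover have "chart P S u + chart P S' u = chart P (\<lambda>\<beta>. S \<beta> + S' \<beta>) u" for S S'
    by (simp add: chart_def scale_left_distrib sum.distrib)
  moreover have "sW c (chart P S u) = chart P (\<lambda>\<beta>. c * S \<beta>) u" for c S
    by (simp add: chart_def scale_sum_right)
  ultimately show ?thesis unfolding subspace_def by (auto; metis)
qed

lemma chart_scale: "sW c (chart P S u) = chart P (\<lambda>\<beta>. c * S \<beta>) u"
  by (simp add: chart_def scale_sum_right)

lemma chart_cong:
  assumes "\<And>\<beta>. \<beta> \<in> PiE {1..n} P \<Longrightarrow> S \<beta> = S' \<beta>"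
  shows "chart P S u = chart P S' u"
  unfolding chart_def using assms by (intro sum.cong) auto

text \<open>With the pivots of each factor fixed, a product of vectors has a product array as core;
  charts with fixed \<open>P\<close> and \<open>u\<close> form a subspace, so the whole span is
  reached.\<close>

lemma raw_is_chart:
  assumes "T \<in> raw k"
  shows "\<exists>P\<in>PiE {1..n} (\<lambda>i. {Q. Q \<subseteq> {..<a i} \<and> card Q = k i}). \<exists>S u. T = chart P S u"
proof -
  obtain A' where A': "\<And>i. i \<in> {1..n} \<Longrightarrow> V.subspace (A' i) \<and> A' i \<subseteq> A i \<and> V.dim (A' i) = k i"
    and T: "T \<in> span (\<tau> ` PiE {1..n} A')" using assms unfolding raw_def by blast
  have "\<exists>Pu. \<forall>i\<in>{1..n}. fst (Pu i) \<subseteq> {..<a i} \<and> card (fst (Pu i)) = k i \<and>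
      (\<forall>v\<in>A' i. v = (\<Sum>q\<in>fst (Pu i). sV (crd i q v) (e i q + (\<Sum>c\<in>{..<a i} - fst (Pu i). sV (snd (Pu i) q c) (e i c)))))"
  proof (rule bchoice, rule ballI)
    fix i assume i: "i \<in> {1..n}"
    obtain P u where "P \<subseteq> {..<a i}" "card P = V.dim (A' i)"
      "\<forall>v\<in>A' i. v = (\<Sum>q\<in>P. sV (crd i q v) (e i q + (\<Sum>c\<in>{..<a i} - P. sV (u q c) (e i c))))"
      using pivots[OF i, of "A' i"] A'[OF i] by blast
    then show "\<exists>Pu. fst Pu \<subseteq> {..<a i} \<and> card (fst Pu) = k i \<and>
      (\<forall>v\<in>A' i. v = (\<Sum>q\<in>fst Pu. sV (crd i q v) (e i q + (\<Sum>c\<in>{..<a i} - fst Pu. sV (snd Pu q c) (e i c)))))"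
      using A'[OF i] by (intro exI[of _ "(P, u)"]) auto
  qed
  then obtain Pu where Pu: "\<And>i. i \<in> {1..n} \<Longrightarrow> fst (Pu i) \<subseteq> {..<a i} \<and> card (fst (Pu i)) = k i"
      "\<And>i v. i \<in> {1..n} \<Longrightarrow> v \<in> A' i \<Longrightarrow>
        v = (\<Sum>q\<in>fst (Pu i). sV (crd i q v) (e i q + (\<Sum>c\<in>{..<a i} - fst (Pu i). sV (snd (Pu i) q c) (e i c))))"
    by blast
  define P where "P = (\<lambda>i\<in>{1..n}. fst (Pu i))"
  define u where "u i = snd (Pu i)" for i
  have P: "P i \<subseteq> {..<a i}" "card (P i) = k i" if "i \<in> {1..n}" for i
    using Pu(1)[OF that] that by (simp_all add: P_def)
  have "\<tau> v = chart P (\<lambda>\<beta>. \<Prod>i\<in>{1..n}. crd i (\<beta> i) (v i)) u" if v: "v \<in> PiE {1..n} A'" for v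
  proof -
    have "(\<lambda>i\<in>{1..n}. v i) = v" using v by (simp only: PiE_restrict)
    moreover have "\<tau> (\<lambda>i\<in>{1..n}. v i) = chart P (\<lambda>\<beta>. \<Prod>i\<in>{1..n}. crd i (\<beta> i) (v i)) u"
      unfolding chart_def
    proof (rule multilinear_on_expand[OF tau_multilinear V.vector_space_axioms vector_space_axioms A_subspace])
      fix i assume i: "i \<in> {1..n}"
      show "finite (P i)" using P[OF i] finite_subset by blast
      show "vec P u i q \<in> A i" if "q \<in> P i" for q using vec_in i P that by blast
      have "v i \<in> A' i" using v i by (auto simp: PiE_iff)
      from Pu(2)[OF i this] show "v i = (\<Sum>q\<in>P i. sV (crd i q (v i)) (vec P u i q))"
        using i by (simp add: vec_def P_def u_def)
    qed
    ultimately show ?thesis by simp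
  qed
  then have "\<tau> ` PiE {1..n} A' \<subseteq> {chart P S u | S. True}" by blast
  then have "span (\<tau> ` PiE {1..n} A') \<subseteq> {chart P S u | S. True}"
    by (rule span_minimal[OF _ chart_subspace])
  then obtain S where "T = chart P S u" using T by blast
  moreover have "P \<in> PiE {1..n} (\<lambda>i. {Q. Q \<subseteq> {..<a i} \<and> card Q = k i})"
    using P by (auto simp: PiE_iff P_def)
  ultimately show ?thesis by blast
qed

section \<open>Parameter counts and dimension bounds for subspace varieties\<close>

definition params :: "(nat \<Rightarrow> nat set) \<Rightarrow> ((nat \<Rightarrow> nat) + nat \<times> nat \<times> nat) set" where
  "params P = PiE {1..n} P <+> (SIGMA i:{1..n}. P i \<times> ({..<a i} - P i))"

text \<open>The dimension of the space of core tensors plus the dimensions of the Grassmannians of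
  \<open>k i\<close>-planes in \<open>A i\<close>. Scaling will cost one.\<close>

definition nparams :: "(nat \<Rightarrow> nat) \<Rightarrow> nat" where
  "nparams k = (\<Prod>i\<in>{1..n}. k i) + (\<Sum>i\<in>{1..n}. k i * (a i - k i))"

lemma params_card:
  assumes "\<And>i. i \<in> {1..n} \<Longrightarrow> P i \<subseteq> {..<a i} \<and> card (P i) = k i"
  shows "finite (params P)" "card (params P) = nparams k"
proof -
  have fin: "finite (P i)" if "i \<in> {1..n}" for i using assms[OF that] finite_subset by blast
  have f1: "finite (PiE {1..n} P)" using fin by (intro finite_PiE) auto
  have f2: "finite (SIGMA i:{1..n}. P i \<times> ({..<a i} - P i))"
    using fin by (intro finite_SigmaI) auto
  show "finite (params P)" using f1 f2 by (simp add: params_def)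
  have "card (P i \<times> ({..<a i} - P i)) = k i * (a i - k i)" if "i \<in> {1..n}" for i
    using assms[OF that] fin[OF that] by (simp add: card_cartesian_product card_Diff_subset)
  then have "card (SIGMA i:{1..n}. P i \<times> ({..<a i} - P i)) = (\<Sum>i\<in>{1..n}. k i * (a i - k i))"
    using fin by (subst card_SigmaI) auto
  moreover have "card (PiE {1..n} P) = (\<Prod>i\<in>{1..n}. k i)"
    using assms by (subst card_PiE) auto
  ultimately show "card (params P) = nparams k"
    unfolding params_def nparams_def using card_Plus[OF f1 f2] by simp
qed

lemma ht_chart_zero:
  assumes P: "\<And>i. i \<in> {1..n} \<Longrightarrow> P i \<subseteq> {..<a i}" and \<alpha>: "\<alpha> \<in> Idx"
  shows "ht \<alpha> (chart P S (\<lambda>_ _ _. 0)) = (if \<alpha> \<in> PiE {1..n} P then S \<alpha> else 0)"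
proof -
  have ext: "\<alpha> \<in> extensional {1..n}" using \<alpha> by (auto simp: Idx_def PiE_iff)
  have fin: "finite (PiE {1..n} P)"
    using P by (intro finite_PiE) (auto intro: finite_subset[of _ "{..<_}"])
  have "ht \<alpha> (chart P S (\<lambda>_ _ _. 0)) = (\<Sum>\<beta>\<in>PiE {1..n} P. S \<beta> *
      (\<Prod>i\<in>{1..n}. if \<alpha> i \<in> P i then (if \<alpha> i = \<beta> i then 1 else 0) else 0))"
    by (rule ht_chart) (use P \<alpha> in auto)
  also have "\<dots> = (\<Sum>\<beta>\<in>PiE {1..n} P. if \<beta> = \<alpha> then S \<alpha> else 0)"
  proof (rule sum.cong[OF refl])
    fix \<beta> assume \<beta>: "\<beta> \<in> PiE {1..n} P"
    show "S \<beta> * (\<Prod>i\<in>{1..n}. if \<alpha> i \<in> P i then (if \<alpha> i = \<beta> i then 1 else 0) else 0)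
      = (if \<beta> = \<alpha> then S \<alpha> else 0)"
    proof (cases "\<beta> = \<alpha>")
      case True
      have "(\<Prod>i\<in>{1..n}. if \<alpha> i \<in> P i then (if \<alpha> i = \<alpha> i then 1 else 0) else 0) = (1::complex)"
        using \<beta> True by (intro prod.neutral) (auto simp: PiE_iff)
      then show ?thesis using True by (simp only: mult_1_right if_True simp_thms)
    next
      case False
      then obtain i where "i \<in> {1..n}" "\<alpha> i \<noteq> \<beta> i"
        using \<beta> ext by (metis PiE_iff extensionalityI)
      then have "(\<Prod>i\<in>{1..n}. if \<alpha> i \<in> P i then (if \<alpha> i = \<beta> i then 1 else 0) else 0) = (0::complex)"
        by (intro prod_zero) auto
      then show ?thesis using False by (simp del: One_nat_def)
    qed
  qed
  also have "\<dots> = (if \<alpha> \<in> PiE {1..n} P then S \<alpha> else 0)" using fin by simp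
  finally show ?thesis .
qed

text \<open>The degree is one for the core entry and at most one for the slope in each of the n
  slots.\<close>

lemma polyfun_ht_chart:
  assumes P: "\<And>i. i \<in> {1..n} \<Longrightarrow> P i \<subseteq> {..<a i}" and \<alpha>: "\<alpha> \<in> Idx"
    and S: "\<And>\<beta>. \<beta> \<in> PiE {1..n} P \<Longrightarrow> polyfun U 1 (\<lambda>x. S x \<beta>)"
    and u: "\<And>i q c. i \<in> {1..n} \<Longrightarrow> q \<in> P i \<Longrightarrow> c \<in> {..<a i} - P i \<Longrightarrow> polyfun U 1 (\<lambda>x. u x i q c)"
  shows "polyfun U (1 + n) (\<lambda>x. ht \<alpha> (chart P (S x) (u x)))"
proof (subst ht_chart)
  show "polyfun U (1 + n) (\<lambda>x. \<Sum>\<beta>\<in>PiE {1..n} P. S x \<beta> * (\<Prod>i\<in>{1..n}. if \<alpha> i \<in> P i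
      then (if \<alpha> i = \<beta> i then 1 else 0) else u x i (\<beta> i) (\<alpha> i)))"
  proof (rule polyfun_sum)
  fix \<beta> assume \<beta>: "\<beta> \<in> PiE {1..n} P"
  have "polyfun U (card {1..n} * 1) (\<lambda>x. \<Prod>i\<in>{1..n}. if \<alpha> i \<in> P i
      then (if \<alpha> i = \<beta> i then 1 else 0) else u x i (\<beta> i) (\<alpha> i))"
  proof (rule polyfun_prod)
    fix i assume i: "i \<in> {1..n}"
    have "\<beta> i \<in> P i" "\<alpha> i \<in> {..<a i}" using \<alpha> \<beta> i by (auto simp: Idx_def PiE_iff)
    then show "polyfun U 1 (\<lambda>x. if \<alpha> i \<in> P i then (if \<alpha> i = \<beta> i then 1 else 0) else u x i (\<beta> i) (\<alpha> i))"
      using u[OF i, of "\<beta> i" "\<alpha> i"] by (cases "\<alpha> i \<in> P i") (auto intro: polyfun.const)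
  qed
  from polyfun_mult[OF S[OF \<beta>] this] show "polyfun U (1 + n) (\<lambda>x. S x \<beta> * (\<Prod>i\<in>{1..n}. if \<alpha> i \<in> P i
      then (if \<alpha> i = \<beta> i then 1 else 0) else u x i (\<beta> i) (\<alpha> i)))" by simp
  qed
qed (use P \<alpha> in auto)

text \<open>A chart is given by pivots \<open>P\<close> and a core position \<open>\<gamma>\<close>
  whose entry is normalised to 1; this removes one parameter, and the finitely many pairs cover
  \<open>raw k\<close> up to scaling.\<close>

lemma subspace_variety_chain_le:
  assumes k: "\<And>i. i \<in> {1..n} \<Longrightarrow> 1 \<le> k i"
    and chain: "irr_chain r Z (subspace_variety sV sW n A \<tau> k)"
  shows "r \<le> nparams k - 1"
proof -
  let ?Ps = "PiE {1..n} (\<lambda>i. {Q. Q \<subseteq> {..<a i} \<and> card Q = k i})"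
  define Ch where "Ch = Sigma ?Ps (\<lambda>P. PiE {1..n} P)"
  define \<phi> where "\<phi> = (\<lambda>(P, \<gamma>) x. chart P (\<lambda>\<beta>. if \<beta> = \<gamma> then 1 else x (Inl \<beta>)) (\<lambda>i q c. x (Inr (i, q, c))))"
  define U where "U = (\<lambda>(P, \<gamma>). params P - {Inl \<gamma>})"
  have P: "P i \<subseteq> {..<a i} \<and> card (P i) = k i" if "P \<in> ?Ps" "i \<in> {1..n}" for P i
    using that by (auto simp: PiE_iff)
  have finPs: "finite ?Ps" by (intro finite_PiE) auto
  have "finite (PiE {1..n} P)" if "P \<in> ?Ps" for P
    using P[OF that] by (intro finite_PiE) (auto intro: finite_subset[of _ "{..<_}"])
  then have finCh: "finite Ch" unfolding Ch_def using finPs by (intro finite_SigmaI)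
  have charts: "finite (U c) \<and> card (U c) = nparams k - 1 \<and> polymap (U c) (1 + n) (\<phi> c)" if c: "c \<in> Ch" for c
  proof -
    obtain P \<gamma> where c_eq: "c = (P, \<gamma>)" and PP: "P \<in> ?Ps" and \<gamma>: "\<gamma> \<in> PiE {1..n} P"
      using c by (auto simp: Ch_def)
    have pc: "finite (params P)" "card (params P) = nparams k" using params_card[of P k] P[OF PP] by auto
    have "Inl \<gamma> \<in> params P" using \<gamma> by (auto simp: params_def)
    moreover have "polymap (U c) (1 + n) (\<phi> c)"
    proof (rule polymapI)
      fix \<alpha> assume \<alpha>: "\<alpha> \<in> Idx"
      show "polyfun (U c) (1 + n) (\<lambda>x. ht \<alpha> (\<phi> c x))"
        unfolding \<phi>_def c_eq prod.case
      proof (rule polyfun_ht_chart[OF _ \<alpha>])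
        fix \<beta> assume "\<beta> \<in> PiE {1..n} P"
        then show "polyfun (U (P, \<gamma>)) 1 (\<lambda>x. if \<beta> = \<gamma> then 1 else x (Inl \<beta>))"
          using polyfun_var[of "Inl \<beta>" "U (P, \<gamma>)"]
          by (cases "\<beta> = \<gamma>") (auto intro!: polyfun.const simp: U_def params_def)
      next
        fix i q c' assume "i \<in> {1..n}" "q \<in> P i" "c' \<in> {..<a i} - P i"
        then show "polyfun (U (P, \<gamma>)) 1 (\<lambda>x. x (Inr (i, q, c')))"
          by (intro polyfun_var) (auto simp: U_def params_def)
      qed (use P[OF PP] in auto)
    qed
    ultimately show ?thesis using pc by (simp add: U_def c_eq)
  qed
  have cover: "raw k \<subseteq> {sW z (\<phi> c x) | z c x. c \<in> Ch}"
  proof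
    fix T assume "T \<in> raw k"
    then obtain P S u where PP: "P \<in> ?Ps" and T: "T = chart P S u" using raw_is_chart by blast
    have "\<exists>q. q \<in> P i" if "i \<in> {1..n}" for i
      using P[OF PP that] k[OF that] by (metis card.empty ex_in_conv not_one_le_zero)
    then have "PiE {1..n} P \<noteq> {}" unfolding PiE_eq_empty_iff by blast
    \<comment> \<open>If the whole core vanishes any position serves, since the tensor is then 0
      times a chart value.\<close>
    then obtain \<gamma> where \<gamma>: "\<gamma> \<in> PiE {1..n} P" "S \<gamma> \<noteq> 0 \<or> (\<forall>\<beta>\<in>PiE {1..n} P. S \<beta> = 0)" by blast
    define x where "x = case_sum (\<lambda>\<beta>. S \<beta> / S \<gamma>) (\<lambda>(i, q, c). u i q c)"
    have "T = sW (S \<gamma>) (\<phi> (P, \<gamma>) x)"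
      unfolding T \<phi>_def prod.case chart_scale x_def using \<gamma> by (auto intro!: chart_cong)
    moreover have "(P, \<gamma>) \<in> Ch" using PP \<gamma> by (auto simp: Ch_def)
    ultimately show "T \<in> {sW z (\<phi> c x) | z c x. c \<in> Ch}" by blast
  qed
  show ?thesis
  proof (rule irr_chain_length_le[OF chain])
    fix d N assume N: "hilb_ge d (subspace_variety sV sW n A \<tau> k) N"
    show "N \<le> card Ch * ((1 + n) * d + 1) ^ (nparams k - 1)"
      by (rule hilb_ge_upper_bound[where V = U and \<phi> = \<phi>, OF finCh _ cover N[unfolded subspace_variety_eq]])
        (rule charts)
  qed
qed

text \<open>Projective space itself is the subspace variety for \<open>k = a\<close>, where the
  Grassmannian terms of \<open>nparams\<close> vanish; every irreducible closed set lies in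
  it.\<close>

lemma chain_length_le:
  assumes "\<And>i. i \<in> {1..n} \<Longrightarrow> 1 \<le> a i" "irr_chain r Z X"
  shows "r \<le> (\<Prod>i\<in>{1..n}. a i) - 1"
proof -
  have "bt \<alpha> \<in> \<tau> ` PiE {1..n} A" if "\<alpha> \<in> Idx" for \<alpha>
  proof -
    have "(\<lambda>i\<in>{1..n}. e i (\<alpha> i)) \<in> PiE {1..n} A"
      using that e_in by (auto simp: Idx_def a_def PiE_iff)
    then show ?thesis unfolding bt_def by blast
  qed
  then have "w \<in> span (\<tau> ` PiE {1..n} A)" for w
    by (subst expand) (intro span_sum span_scale span_base)
  then have "w \<in> raw a" for w 
    unfolding raw_def using A_subspace by (auto simp: a_def simp del: One_nat_def intro!: exI[of _ A])
  then have "raw a = UNIV" by blast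
  then have "proj_space sW \<subseteq> subspace_variety sV sW n A \<tau> a"
    unfolding subspace_variety_eq proj_space_eq using closure_subset by simp
  then have "irr_chain r Z (subspace_variety sV sW n A \<tau> a)"
    using assms(2) zariski_closed_subset unfolding irr_chain_def irreducible_closed_def
    by (meson order_trans)
  then have "r \<le> nparams a - 1" using assms(1) by (intro subspace_variety_chain_le)
  then show ?thesis by (simp add: nparams_def)
qed

lemma subspace_variety_dim_ge:
  assumes k: "\<And>i. i \<in> {1..n} \<Longrightarrow> 1 \<le> k i \<and> k i \<le> a i"
  shows "int (\<Prod>i\<in>{1..n}. k i) - 1 \<le> proj_dim sW (subspace_variety sV sW n A \<tau> k)"
proof -
  let ?P = "\<lambda>i. {..<k i}"
  let ?V = "PiE {1..n} ?P"
  let ?X = "subspace_variety sV sW n A \<tau> k"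
  define \<gamma> :: "nat \<Rightarrow> nat" where "\<gamma> = (\<lambda>i\<in>{1..n}. 0)"
  \<comment> \<open>With zero slopes the coordinates are the core entries. The shift at
    \<open>\<gamma>\<close> makes the base point nonzero, so that it defines a projective
    point.\<close>
  define \<phi> where "\<phi> x = chart ?P (\<lambda>\<beta>. (if \<beta> = \<gamma> then 1 else 0) + x \<beta>) (\<lambda>_ _ _. 0)" for x
  have \<gamma>: "\<gamma> \<in> ?V" using k by (auto simp: \<gamma>_def PiE_iff Suc_le_eq)
  have fin: "finite ?V" by (intro finite_PiE) auto
  have P: "?P i \<subseteq> {..<a i}" if "i \<in> {1..n}" for i using k[OF that] by auto
  have V_Idx: "?V \<subseteq> Idx" unfolding Idx_def using P by (intro PiE_mono)
  have ht\<phi>: "ht \<alpha> (\<phi> x) = (if \<alpha> = \<gamma> then 1 else 0) + x \<alpha>" if \<alpha>: "\<alpha> \<in> ?V" for \<alpha> x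
    unfolding \<phi>_def using ht_chart_zero[of ?P \<alpha>] P \<alpha> V_Idx by auto
  have pm: "polymap ?V (1 + n) \<phi>"
  proof (rule polymapI)
    fix \<alpha> assume \<alpha>: "\<alpha> \<in> Idx"
    show "polyfun ?V (1 + n) (\<lambda>x. ht \<alpha> (\<phi> x))"
      unfolding \<phi>_def
      by (rule polyfun_ht_chart[OF _ \<alpha>]) (use P in \<open>auto intro: polyfun.const polyfun.add polyfun_var[simplified]\<close>)
  qed
  have "\<exists>Z. irr_chain (card ?V - 1) Z ?X"
  proof (rule irr_chain_of_parametrization[OF fin \<gamma> pm, where h = ht])
    show "zariski_closed sW ?X" unfolding subspace_variety_eq
      by (intro zariski_closed_closure proj_image_subset)
    show "linform (ht p)" if "p \<in> ?V" for p using V_Idx that ht_linform by blast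
    show "ht \<gamma> (\<phi> (\<lambda>_. 0)) \<noteq> 0" by (simp add: ht\<phi>[OF \<gamma>])
    show "((\<lambda>t. ht p (\<phi> (\<lambda>i. t * y i))) has_field_derivative y p) (at 0)" if "p \<in> ?V" for p y
      unfolding ht\<phi>[OF that] by (auto intro!: derivative_eq_intros)
    show "\<forall>\<^sub>F t in at_right 0. proj_pt sW (\<phi> (\<lambda>i. complex_of_real t * y i)) \<in> ?X" for y
    proof -
      have "((\<lambda>t. 1 + complex_of_real t * y \<gamma>) \<longlongrightarrow> 1 + complex_of_real 0 * y \<gamma>) (at_right 0)"
        by (intro tendsto_intros)
      then have "\<forall>\<^sub>F t in at_right 0. 1 + complex_of_real t * y \<gamma> \<noteq> 0"
        by (rule tendsto_imp_eventually_ne) simp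
      then show ?thesis
      proof eventually_elim
        case (elim t)
        let ?w = "\<phi> (\<lambda>i. complex_of_real t * y i)"
        have "ht \<gamma> ?w \<noteq> 0" unfolding ht\<phi>[OF \<gamma>] using elim by simp
        then have "?w \<noteq> 0" using linform_0[OF ht_linform, of \<gamma>] \<gamma> V_Idx by auto
        moreover have "?w \<in> raw k" unfolding \<phi>_def using P by (intro chart_in_raw) auto
        ultimately show ?case unfolding subspace_variety_eq
          by (intro subsetD[OF closure_subset] proj_pt_in_image)
      qed
    qed
  qed
  then obtain Z where "irr_chain (card ?V - 1) Z ?X" by blast
  moreover have "card ?V = (\<Prod>i\<in>{1..n}. k i)" by (subst card_PiE) auto
  ultimately have "int ((\<Prod>i\<in>{1..n}. k i) - 1) \<le> proj_dim sW ?X"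
    using k by (intro proj_dim_ge[OF chain_length_le]) (auto intro: order_trans)
  then show ?thesis by linarith
qed

subsection \<open>Concise dimension vectors\<close>

lemma extend_subspace:
  assumes i: "i \<in> {1..n}" and B: "V.independent B" "B \<subseteq> A i" and p: "card B \<le> p" "p \<le> a i"
  shows "\<exists>D. V.subspace D \<and> D \<subseteq> A i \<and> B \<subseteq> D \<and> V.dim D = p"
proof -
  obtain C where C: "B \<subseteq> C" "C \<subseteq> A i" "V.independent C" "A i \<subseteq> V.span C"
    using V.maximal_independent_subset_extend[OF B(2,1)] by blast
  have cardC: "card C = a i" unfolding a_def using C by (intro V.basis_card_eq_dim) auto
  obtain F where "finite F" "V.span F = A i" using A_finite[OF i] by blast
  then have finC: "finite C" using V.independent_span_bound[of F C] C by auto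
  obtain D0 where D0: "B \<subseteq> D0" "D0 \<subseteq> C" "card D0 = p"
    using exists_subset_between[OF p(1) _ C(1) finC] p(2) cardC by auto
  have "V.independent D0" using V.independent_mono[OF C(3) D0(2)] .
  then have "V.dim (V.span D0) = p" using V.dim_span_eq_card_independent D0(3) by blast
  moreover have "V.span D0 \<subseteq> A i" using D0 C A_subspace[OF i] by (intro V.span_minimal) auto
  ultimately show ?thesis using D0(1) V.span_superset by (intro exI[of _ "V.span D0"]) auto
qed

lemma raw_mono:
  assumes k: "\<And>i. i \<in> {1..n} \<Longrightarrow> k' i \<le> k i \<and> k i \<le> a i"
  shows "raw k' \<subseteq> raw k"
proof
  fix T assume "T \<in> raw k'"
  then obtain A' where A': "\<And>i. i \<in> {1..n} \<Longrightarrow> V.subspace (A' i) \<and> A' i \<subseteq> A i \<and> V.dim (A' i) = k' i"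
    and T: "T \<in> span (\<tau> ` PiE {1..n} A')" unfolding raw_def by blast
  have "\<exists>D. V.subspace D \<and> D \<subseteq> A i \<and> V.dim D = k i \<and> A' i \<subseteq> D" if i: "i \<in> {1..n}" for i
  proof -
    obtain B where B: "B \<subseteq> A' i" "V.independent B" "A' i \<subseteq> V.span B" "card B = V.dim (A' i)"
      using V.basis_exists[of "A' i"] by blast
    have "B \<subseteq> A i" "card B \<le> k i" "k i \<le> a i" using B A'[OF i] k[OF i] by auto
    then obtain D where D: "V.subspace D" "D \<subseteq> A i" "B \<subseteq> D" "V.dim D = k i"
      using extend_subspace[OF i B(2)] by blast
    then have "V.span B \<subseteq> D" by (intro V.span_minimal)
    then show ?thesis using D B by blast
  qed
  then obtain D where D: "\<And>i. i \<in> {1..n} \<Longrightarrow>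
      V.subspace (D i) \<and> D i \<subseteq> A i \<and> V.dim (D i) = k i \<and> A' i \<subseteq> D i" by metis
  then have "\<tau> ` PiE {1..n} A' \<subseteq> \<tau> ` PiE {1..n} D" by (intro image_mono PiE_mono) blast
  then have "T \<in> span (\<tau> ` PiE {1..n} D)" using T span_mono by blast
  then show "T \<in> raw k" unfolding raw_def using D by blast
qed

text \<open>The flattening in slot \<open>i\<close> has at most \<open>p\<close> rows
  \<open>w \<beta>\<close>, one for each choice of the other indices. They span a space of dimension
  at most \<open>p\<close>, which replaces the given subspace of the factor after enlargement to
  dimension exactly \<open>p\<close>.\<close>

lemma raw_reduce:
  assumes i: "i \<in> {1..n}" and le: "\<And>l. l \<in> {1..n} \<Longrightarrow> k l \<le> a l"
    and p: "p = (\<Prod>l\<in>{1..n} - {i}. k l)" "p \<le> k i"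
  shows "raw k \<subseteq> raw (k(i := p))"
proof
  fix T assume "T \<in> raw k"
  then obtain P S u where P: "P \<in> PiE {1..n} (\<lambda>i. {Q. Q \<subseteq> {..<a i} \<and> card Q = k i})"
    and T: "T = chart P S u" using raw_is_chart by blast
  have Pl: "P l \<subseteq> {..<a l}" "card (P l) = k l" "finite (P l)" if "l \<in> {1..n}" for l
  proof -
    show "P l \<subseteq> {..<a l}" "card (P l) = k l" using P that by (auto simp: PiE_iff)
    then show "finite (P l)" using finite_subset by blast
  qed
  let ?J = "{1..n} - {i}"
  have ins: "insert i ?J = {1..n}" using i by auto
  define w where "w \<beta> = (\<Sum>q\<in>P i. sV (S (\<beta>(i := q))) (vec P u i q))" for \<beta>
  have wA: "w ` PiE ?J P \<subseteq> A i"
    unfolding w_def using vec_in[OF i] Pl[OF i] A_subspace[OF i]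
    by (auto intro!: V.subspace_sum V.subspace_scale)
  have finJ: "finite (PiE ?J P)" using Pl by (intro finite_PiE) auto
  have cardJ: "card (PiE ?J P) = p" unfolding p(1) using Pl by (subst card_PiE) auto
  obtain B where B: "B \<subseteq> w ` PiE ?J P" "V.independent B" "w ` PiE ?J P \<subseteq> V.span B"
    using V.maximal_independent_subset[of "w ` PiE ?J P"] by blast
  have "card B \<le> card (w ` PiE ?J P)" using B(1) finJ by (intro card_mono) auto
  also have "\<dots> \<le> p" using card_image_le[OF finJ, of w] cardJ by simp
  finally have "card B \<le> p" .
  then obtain D where D: "V.subspace D" "D \<subseteq> A i" "B \<subseteq> D" "V.dim D = p"
    using extend_subspace[OF i B(2) subset_trans[OF B(1) wA], of p] p(2) le[OF i] by auto
  have wD: "w \<beta> \<in> D" if "\<beta> \<in> PiE ?J P" for \<beta>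
    using that B(3) V.span_minimal[OF D(3,1)] by blast
  define A' where "A' l = (if l = i then D else V.span (vec P u l ` P l))" for l
  have "V.subspace (A' l) \<and> A' l \<subseteq> A l \<and> V.dim (A' l) = (k(i := p)) l" if l: "l \<in> {1..n}" for l
  proof (cases "l = i")
    case False
    have "V.span (vec P u l ` P l) \<subseteq> A l"
      using vec_in[OF l] Pl[OF l] A_subspace[OF l] by (intro V.span_minimal) auto
    moreover have "V.dim (V.span (vec P u l ` P l)) = k l"
      using vec_family[of l P u] l Pl[OF l]
      by (simp add: V.dim_span_eq_card_independent card_image del: V.dim_span)
    ultimately show ?thesis using False by (simp add: A'_def)
  qed (simp add: A'_def D)
  moreover have "T \<in> span (\<tau> ` PiE {1..n} A')"
  proof -
    let ?t = "\<lambda>\<beta>. \<lambda>l\<in>{1..n}. if l = i then w \<beta> else vec P u l (\<beta> l)"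
    have T_sum: "T = (\<Sum>\<beta>\<in>PiE ?J P. \<tau> (?t \<beta>))"
    proof -
      have "T = (\<Sum>\<beta>\<in>PiE (insert i ?J) P. sW (S \<beta>) (\<tau> (\<lambda>l\<in>{1..n}. vec P u l (\<beta> l))))"
        unfolding T chart_def ins ..
      also have "\<dots> = (\<Sum>(q, \<beta>)\<in>P i \<times> PiE ?J P. sW (S (\<beta>(i := q))) (\<tau> (\<lambda>l\<in>{1..n}. vec P u l ((\<beta>(i := q)) l))))"
      proof -
        have inj: "inj_on (\<lambda>(q, \<beta>). \<beta>(i := q)) (P i \<times> PiE ?J P)" by (rule inj_combinator) simp
        show ?thesis unfolding PiE_insert_eq sum.reindex[OF inj] by (simp add: case_prod_unfold)
      qed
      also have "\<dots> = (\<Sum>q\<in>P i. \<Sum>\<beta>\<in>PiE ?J P. sW (S (\<beta>(i := q))) (\<tau> (\<lambda>l\<in>{1..n}. vec P u l ((\<beta>(i := q)) l))))"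
        by (rule sum.cartesian_product[symmetric])
      also have "\<dots> = (\<Sum>\<beta>\<in>PiE ?J P. \<Sum>q\<in>P i. sW (S (\<beta>(i := q))) (\<tau> (\<lambda>l\<in>{1..n}. vec P u l ((\<beta>(i := q)) l))))"
        by (rule sum.swap)
      also have "\<dots> = (\<Sum>\<beta>\<in>PiE ?J P. \<tau> (?t \<beta>))"
      proof (rule sum.cong[OF refl])
        fix \<beta> assume \<beta>: "\<beta> \<in> PiE ?J P"
        have t_in: "?t \<beta> \<in> PiE {1..n} A"
          using vec_in Pl \<beta> wA by (auto simp: PiE_iff restrict_PiE_iff)
        have upd: "(?t \<beta>)(i := vec P u i q) = (\<lambda>l\<in>{1..n}. vec P u l ((\<beta>(i := q)) l))" for q
          using i by (auto simp: fun_eq_iff)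
        have "?t \<beta> = (?t \<beta>)(i := w \<beta>)" using i by (auto simp: fun_eq_iff)
        then have "\<tau> (?t \<beta>) = \<tau> ((?t \<beta>)(i := \<Sum>q\<in>P i. sV (S (\<beta>(i := q))) (vec P u i q)))"
          unfolding w_def by simp
        also have "\<dots> = (\<Sum>q\<in>P i. sW (S (\<beta>(i := q))) (\<tau> ((?t \<beta>)(i := vec P u i q))))"
          by (rule multilinear_on_sum[OF tau_multilinear V.vector_space_axioms vector_space_axioms t_in i
              A_subspace[OF i] Pl(3)[OF i] vec_in[OF i]]) (use Pl[OF i] in auto)
        finally show "(\<Sum>q\<in>P i. sW (S (\<beta>(i := q))) (\<tau> (\<lambda>l\<in>{1..n}. vec P u l ((\<beta>(i := q)) l)))) = \<tau> (?t \<beta>)"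
          unfolding upd by simp
      qed
      finally show ?thesis .
    qed
    have "?t \<beta> \<in> PiE {1..n} A'" if "\<beta> \<in> PiE ?J P" for \<beta>
      using wD[OF that] that by (auto simp: A'_def PiE_iff restrict_PiE_iff intro!: V.span_base)
    then show ?thesis unfolding T_sum by (intro span_sum span_base imageI)
  qed
  ultimately show "T \<in> raw (k(i := p))" unfolding raw_def by blast
qed

text \<open>For positive \<open>k\<close>, this is the condition under which a tensor of these
  dimensions can have all flattenings injective.\<close>

definition concise :: "(nat \<Rightarrow> nat) \<Rightarrow> bool" where
  "concise k \<longleftrightarrow> (\<forall>i\<in>{1..n}. k i \<le> (\<Prod>l\<in>{1..n} - {i}. k l))"

text \<open>Lowering one entry may violate the condition at another, so the reduction is repeated;
  it stops because the sum of the entries drops.\<close>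

lemma exists_concise:
  assumes "\<And>i. i \<in> {1..n} \<Longrightarrow> 1 \<le> k i \<and> k i \<le> a i"
  shows "\<exists>k'. (\<forall>i\<in>{1..n}. 1 \<le> k' i \<and> k' i \<le> k i) \<and> concise k' \<and> raw k \<subseteq> raw k'"
  using assms
proof (induction "sum k {1..n}" arbitrary: k rule: less_induct)
  case less
  show ?case
  proof (cases "concise k")
    case False
    then obtain i where i: "i \<in> {1..n}" "(\<Prod>l\<in>{1..n} - {i}. k l) < k i" by (auto simp: concise_def)
    define p where "p = (\<Prod>l\<in>{1..n} - {i}. k l)"
    let ?k = "k(i := p)"
    have p: "1 \<le> p" "p < k i"
      using i less.prems by (auto simp: p_def Suc_le_eq intro!: prod_pos)
    have "sum ?k {1..n} < sum k {1..n}"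
      by (rule sum_strict_mono_ex1) (use i p in auto)
    moreover have "\<And>l. l \<in> {1..n} \<Longrightarrow> 1 \<le> ?k l \<and> ?k l \<le> a l"
      using less.prems p i(1) less_imp_le le_trans by (metis fun_upd_apply)
    ultimately obtain k' where k': "\<forall>l\<in>{1..n}. 1 \<le> k' l \<and> k' l \<le> ?k l" "concise k'" "raw ?k \<subseteq> raw k'"
      using less.hyps[of ?k] by blast
    have "raw k \<subseteq> raw ?k" using less.prems p by (intro raw_reduce[OF i(1) _ p_def]) auto
    moreover have "k' l \<le> k l" if "l \<in> {1..n}" for l
      using bspec[OF k'(1) that] p by (auto split: if_splits)
    ultimately show ?thesis using k' by (intro exI[of _ k']) auto
  qed (use less.prems in blast)
qed

end

text \<open>The tensor with coefficient 1 on such a set \<open>G\<close> and 0 elsewhere has injective flattenings.\<close>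

lemma exists_code:
  fixes P :: "nat \<Rightarrow> nat set"
  assumes I: "finite I" "I \<noteq> {}" and P: "\<And>i. i \<in> I \<Longrightarrow> finite (P i) \<and> P i \<noteq> {}"
    and le: "\<And>i. i \<in> I \<Longrightarrow> card (P i) \<le> (\<Prod>l\<in>I - {i}. card (P l))"
  shows "\<exists>G \<subseteq> PiE I P. (\<forall>i\<in>I. \<forall>q\<in>P i. \<exists>g\<in>G. g i = q) \<and>
    (\<forall>g\<in>G. \<forall>g'\<in>G. \<forall>i\<in>I. (\<forall>l\<in>I. l \<noteq> i \<longrightarrow> g l = g' l) \<longrightarrow> g = g')"
proof -
  \<comment> \<open>The slot with the largest block will be a bijective function of all the
    others.\<close>
  obtain j where j: "j \<in> I" "\<And>i. i \<in> I \<Longrightarrow> card (P i) \<le> card (P j)"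
  proof -
    let ?M = "Max ((\<lambda>i. card (P i)) ` I)"
    have "?M \<in> (\<lambda>i. card (P i)) ` I" using I by (intro Max_in) auto
    then obtain j where "j \<in> I" "card (P j) = ?M" by force
    then show thesis using that I by simp
  qed
  let ?J = "I - {j}"
  let ?K = "card (P j)"
  have "\<exists>e. bij_betw e {..<card (P i)} (P i)" if "i \<in> I" for i
    using ex_bij_betw_nat_finite[of "P i"] P[OF that] by (auto simp: atLeast0LessThan)
  then obtain e where e: "\<And>i. i \<in> I \<Longrightarrow> bij_betw (e i) {..<card (P i)} (P i)" by metis
  \<comment> \<open>A diagonal, clipped at the end of each block: since block \<open>j\<close> is
    the largest, it passes through every element of every other block.\<close>
  define f where "f t = (\<lambda>i\<in>?J. e i (min t (card (P i) - 1)))" for t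
  have f: "f t \<in> PiE ?J P" for t
    unfolding f_def restrict_PiE_iff
  proof
    fix i assume i: "i \<in> ?J"
    then have "min t (card (P i) - 1) < card (P i)" using P[of i] by (auto simp: card_gt_0_iff min_less_iff_disj)
    then show "e i (min t (card (P i) - 1)) \<in> P i" using bij_betw_apply[OF e, of i] i by auto
  qed
  have "card (f ` {..<?K}) \<le> ?K" using card_image_le[of "{..<?K}" f] by simp
  moreover have "?K \<le> card (PiE ?J P)" using le[OF j(1)] I by (simp add: card_PiE)
  moreover have "f ` {..<?K} \<subseteq> PiE ?J P" using f by blast
  moreover have "finite (PiE ?J P)" using I P by (intro finite_PiE) auto
  \<comment> \<open>Clipping may create repetitions; the image is padded to exactly
    \<open>?K\<close> words, which fits by the assumption \<open>le\<close> for \<open>j\<close>.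
    The code is the graph of \<open>\<theta>\<close> on \<open>F\<close>, so equality in slot
    \<open>j\<close> forces equality everywhere.\<close>
  ultimately obtain F where F: "f ` {..<?K} \<subseteq> F" "F \<subseteq> PiE ?J P" "card F = ?K"
    using exists_subset_between by metis
  have finF: "finite F" using F(2) \<open>finite (PiE ?J P)\<close> finite_subset by blast
  obtain \<theta> where \<theta>: "bij_betw \<theta> F (P j)"
    using finite_same_card_bij[OF finF _ F(3)] P[OF j(1)] by blast
  define G where "G = (\<lambda>x. x(j := \<theta> x)) ` F"
  show ?thesis
  proof (intro exI[of _ G] conjI ballI impI)
    show "G \<subseteq> PiE I P"
    proof
      fix g assume "g \<in> G"
      then obtain x where x: "g = x(j := \<theta> x)" "x \<in> F" by (auto simp: G_def)
      have "\<theta> x \<in> P j" "x \<in> PiE ?J P" using bij_betw_apply[OF \<theta> x(2)] F(2) x(2) by auto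
      then have "g \<in> PiE (insert j ?J) P" unfolding x(1) by (rule PiE_fun_upd)
      then show "g \<in> PiE I P" using j(1) by (simp add: insert_absorb)
    qed
  next
    fix i q assume i: "i \<in> I" and q: "q \<in> P i"
    show "\<exists>g\<in>G. g i = q"
    proof (cases "i = j")
      case True
      then have "q \<in> \<theta> ` F" using \<theta> q by (simp add: bij_betw_def)
      then obtain x where "x \<in> F" "\<theta> x = q" by blast
      then show ?thesis using True by (auto simp: G_def)
    next
      case False
      obtain t where t: "t < card (P i)" "e i t = q" 
        using e[OF i] q unfolding bij_betw_def by (metis image_iff lessThan_iff)
      then have "f t i = q" using i False by (simp add: f_def min_absorb1)
      moreover have "f t \<in> F" using F(1) t(1) j(2)[OF i] by auto
      ultimately show ?thesis using False by (auto simp: G_def)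
    qed
  next
    fix g g' i assume g: "g \<in> G" "g' \<in> G" and i: "i \<in> I" and eq': "\<forall>l\<in>I. l \<noteq> i \<longrightarrow> g l = g' l"
    have eq: "g l = g' l" if "l \<in> I" "l \<noteq> i" for l using eq' that by blast
    obtain x x' where x: "g = x(j := \<theta> x)" "x \<in> F" "g' = x'(j := \<theta> x')" "x' \<in> F"
      using g by (auto simp: G_def)
    have "x = x'"
    proof (cases "i = j")
      case True
      show ?thesis
      proof (rule PiE_ext)
        show "x \<in> PiE ?J P" "x' \<in> PiE ?J P" using F(2) x by auto
        fix l assume "l \<in> ?J"
        then show "x l = x' l" using eq[of l] x True by auto
      qed
    next
      case False
      then have "\<theta> x = \<theta> x'" using eq[OF j(1)] x by simp
      then show ?thesis using \<theta> x by (auto simp: bij_betw_def inj_on_def)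
    qed
    then show "g = g'" using x by simp
  qed
qed

section \<open>Independence near a base point and first order expansions\<close>

lemma (in vector_space) independent_family:
  fixes T :: "'i \<Rightarrow> 'b"
  assumes "finite J" and zero: "\<And>c. (\<Sum>j\<in>J. scale (c j) (T j)) = 0 \<Longrightarrow> \<forall>j\<in>J. c j = 0"
  shows "inj_on T J" "independent (T ` J)"
proof -
  show inj: "inj_on T J"
  proof (rule inj_onI, rule ccontr)
    fix i j assume ij: "i \<in> J" "j \<in> J" "T i = T j" "i \<noteq> j"
    define c :: "'i \<Rightarrow> 'a" where "c l = (if l = i then 1 else if l = j then -1 else 0)" for l
    have "(\<Sum>l\<in>J. scale (c l) (T l)) = (\<Sum>l\<in>J. (if l = i then T i else 0) + (if l = j then - T j else 0))"
      by (intro sum.cong) (use ij in \<open>auto simp: c_def\<close>)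
    also have "\<dots> = T i - T j" using assms(1) ij by (simp add: sum.distrib)
    finally have "\<forall>l\<in>J. c l = 0" using ij by (intro zero) simp
    then show False using ij by (auto simp: c_def)
  qed
  show "independent (T ` J)"
  proof (rule independent_if_scalars_zero)
    fix f x assume "(\<Sum>x\<in>T ` J. scale (f x) x) = 0" and x: "x \<in> T ` J"
    then have "(\<Sum>j\<in>J. scale (f (T j)) (T j)) = 0" by (simp add: sum.reindex[OF inj])
    then show "f x = 0" using zero[of "\<lambda>j. f (T j)"] x by blast
  qed (use assms(1) in simp)
qed

text \<open>Diagonal dominance: in the row of the largest coefficient the errors add up to at most
  card J / (card J + 1) times that coefficient.\<close>

lemma near_identity_kernel:
  fixes M :: "'j \<Rightarrow> 'j \<Rightarrow> complex"
  assumes J: "finite J"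
    and near: "\<And>j l. j \<in> J \<Longrightarrow> l \<in> J \<Longrightarrow> cmod (M j l - (if j = l then 1 else 0)) < 1 / (card J + 1)"
    and zero: "\<And>j. j \<in> J \<Longrightarrow> (\<Sum>l\<in>J. c l * M j l) = 0"
  shows "\<forall>j\<in>J. c j = 0"
proof (rule ccontr)
  assume nz: "\<not> (\<forall>j\<in>J. c j = 0)"
  then have ne: "J \<noteq> {}" by auto
  let ?m = "Max ((\<lambda>j. cmod (c j)) ` J)"
  have "?m \<in> (\<lambda>j. cmod (c j)) ` J" using J ne by (intro Max_in) auto
  then obtain j where j: "j \<in> J" "cmod (c j) = ?m" by force
  have le: "cmod (c l) \<le> cmod (c j)" if "l \<in> J" for l using J that by (simp add: j(2))
  have pos: "cmod (c j) > 0" 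
  proof -
    obtain l where "l \<in> J" "cmod (c l) > 0" using nz by auto
    then show ?thesis using le[of l] by linarith
  qed
  have "(\<Sum>l\<in>J. c l * (M j l - (if j = l then 1 else 0))) = - c j"
  proof -
    have "(\<Sum>l\<in>J. c l * (if j = l then 1 else 0)) = (\<Sum>l\<in>J. if l = j then c j else 0)"
      by (intro sum.cong) auto
    then show ?thesis using zero[OF j(1)] J j(1) by (simp add: right_diff_distrib sum_subtractf)
  qed
  then have "cmod (c j) = cmod (\<Sum>l\<in>J. c l * (M j l - (if j = l then 1 else 0)))" by simp
  also have "\<dots> \<le> (\<Sum>l\<in>J. cmod (c l * (M j l - (if j = l then 1 else 0))))" by (rule norm_sum)
  also have "\<dots> \<le> (\<Sum>l\<in>J. cmod (c j) * (1 / (card J + 1)))"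
    unfolding norm_mult by (intro sum_mono mult_mono le less_imp_le[OF near] j(1)) auto
  also have "\<dots> = cmod (c j) * (card J / (card J + 1))" by simp
  also have "\<dots> < cmod (c j) * 1" using pos by (intro mult_strict_left_mono) auto
  finally show False by simp
qed

lemma prod_if_scale:
  fixes t :: complex
  shows "finite I \<Longrightarrow> (\<Prod>i\<in>I. if Q i then f i else t * g i)
    = t ^ card {i \<in> I. \<not> Q i} * (\<Prod>i\<in>I. if Q i then f i else g i)"
proof (induction I rule: finite_induct)
  case (insert i I)
  have "{l \<in> insert i I. \<not> Q l} = (if Q i then {l \<in> I. \<not> Q l} else insert i {l \<in> I. \<not> Q l})" by auto
  then have "card {l \<in> insert i I. \<not> Q l} = (if Q i then card {l \<in> I. \<not> Q l} else Suc (card {l \<in> I. \<not> Q l}))"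
    using insert.hyps by simp
  then show ?case using insert by simp
qed simp

text \<open>Here \<open>r\<close> will count the slots outside a block. With none the core parameter
  \<open>y\<close> is seen, with exactly one the base value \<open>b\<close> of the core, and with
  more nothing to first order.\<close>

lemma DERIV_monomial_at_0:
  fixes b y K :: complex
  shows "((\<lambda>t. (b + t * y) * (t ^ r * K)) has_field_derivative
    (if r = 0 then y else if r = 1 then b else 0) * K) (at 0)"
proof -
  consider "r = 0" | "r = 1" | r' where "r = Suc (Suc r')" by (metis One_nat_def not0_implies_Suc)
  then show ?thesis by cases (auto intro!: derivative_eq_intros)
qed

subsection \<open>The join\<close>

context tensor_space
begin

text \<open>Independence in coefficient form also excludes repetitions, and with
  \<open>1 \<le> m\<close> it makes the sum nonzero, hence a point.\<close>

lemma join_contains: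
  assumes T: "\<And>j. j \<in> {1..m} \<Longrightarrow> T j \<in> affine_cone sW (X j)" and m: "1 \<le> m"
    and indep: "\<And>c. (\<Sum>j\<in>{1..m}. sW (c j) (T j)) = 0 \<Longrightarrow> \<forall>j\<in>{1..m}. c j = 0"
  shows "proj_pt sW (\<Sum>j\<in>{1..m}. T j) \<in> proj_join sW m X"
proof -
  have inj: "inj_on T {1..m}" by (rule independent_family(1)) (simp, rule indep)
  have ind: "independent (T ` {1..m})" by (rule independent_family(2)) (simp, rule indep)
  have "(\<Sum>j\<in>{1..m}. T j) \<noteq> 0"
  proof
    assume "(\<Sum>j\<in>{1..m}. T j) = 0"
    then have "(\<Sum>j\<in>{1..m}. sW 1 (T j)) = 0" by (simp only: scale_one)
    from indep[OF this] m show False by simp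
  qed
  then have "proj_pt sW (\<Sum>j\<in>{1..m}. T j) \<in> proj_span sW (T ` {1..m})"
    unfolding proj_span_eq by (intro proj_pt_in_image span_sum span_base) auto
  moreover have "proj_span sW (T ` {1..m}) \<in> {proj_span sW (P ` {1..m}) | P.
      (\<forall>j\<in>{1..m}. P j \<in> affine_cone sW (X j)) \<and> inj_on P {1..m} \<and> \<not> dependent (P ` {1..m})}"
    by (intro CollectI exI[of _ T] conjI ballI refl T inj ind)
  ultimately show ?thesis unfolding proj_join_def by (rule subsetD[OF closure_subset, OF UnionI[rotated]])
qed

lemma join_closed: "zariski_closed sW (proj_join sW m X)"
  unfolding proj_join_def proj_span_eq by (rule zariski_closed_closure) (use proj_image_subset in blast)

text \<open>Around the sum of the coded tensors, in pairwise disjoint blocks, every parameter of every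
  summand is the linear part of one coordinate. The positions with exactly one index outside a
  block determine that block because \<open>n \<ge> 3\<close>.\<close>

lemma join_chain_disjoint_blocks:
  assumes n: "3 \<le> n" and m: "1 \<le> m"
    and P: "\<And>j i. j \<in> {1..m} \<Longrightarrow> i \<in> {1..n} \<Longrightarrow>
      P j i \<subseteq> {..<a i} \<and> card (P j i) = k j i \<and> 1 \<le> k j i"
    and disj: "\<And>j l i. j \<in> {1..m} \<Longrightarrow> l \<in> {1..m} \<Longrightarrow> i \<in> {1..n} \<Longrightarrow> j \<noteq> l \<Longrightarrow> P j i \<inter> P l i = {}"
    and concise: "\<And>j. j \<in> {1..m} \<Longrightarrow> concise (k j)"
    and X: "\<And>j. j \<in> {1..m} \<Longrightarrow> raw (k j) \<subseteq> affine_cone sW (X j)"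
  shows "\<exists>Z. irr_chain ((\<Sum>j\<in>{1..m}. nparams (k j)) - 1) Z (proj_join sW m X)"
proof -
  have P_sub: "P j i \<subseteq> {..<a i}" if "j \<in> {1..m}" "i \<in> {1..n}" for j i using P that by blast
  have *: "\<exists>G \<subseteq> PiE {1..n} (P j). (\<forall>i\<in>{1..n}. \<forall>q\<in>P j i. \<exists>g\<in>G. g i = q) \<and>
      (\<forall>g\<in>G. \<forall>g'\<in>G. \<forall>i\<in>{1..n}. (\<forall>l\<in>{1..n}. l \<noteq> i \<longrightarrow> g l = g' l) \<longrightarrow> g = g')" if j: "j \<in> {1..m}" for j
  proof (rule exists_code[of "{1..n}" "P j"])
    show "finite (P j i) \<and> P j i \<noteq> {}" if i: "i \<in> {1..n}" for i
      using P[OF j i] finite_subset[of "P j i"] by auto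
    show "card (P j i) \<le> (\<Prod>l\<in>{1..n} - {i}. card (P j l))" if i: "i \<in> {1..n}" for i
      using concise[OF j] P[OF j] i by (simp add: concise_def)
  qed (use n in auto)
  have "\<exists>G. \<forall>j\<in>{1..m}. G j \<subseteq> PiE {1..n} (P j) \<and> (\<forall>i\<in>{1..n}. \<forall>q\<in>P j i. \<exists>g\<in>G j. g i = q) \<and>
      (\<forall>g\<in>G j. \<forall>g'\<in>G j. \<forall>i\<in>{1..n}. (\<forall>l\<in>{1..n}. l \<noteq> i \<longrightarrow> g l = g' l) \<longrightarrow> g = g')"
    by (rule bchoice) (use * in blast)
  then obtain G where G_all: "\<forall>j\<in>{1..m}. G j \<subseteq> PiE {1..n} (P j) \<and>
      (\<forall>i\<in>{1..n}. \<forall>q\<in>P j i. \<exists>g\<in>G j. g i = q) \<and>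
      (\<forall>g\<in>G j. \<forall>g'\<in>G j. \<forall>i\<in>{1..n}. (\<forall>l\<in>{1..n}. l \<noteq> i \<longrightarrow> g l = g' l) \<longrightarrow> g = g')" ..
  have G: "G j \<subseteq> PiE {1..n} (P j)" "\<forall>i\<in>{1..n}. \<forall>q\<in>P j i. \<exists>g\<in>G j. g i = q"
    "\<forall>g\<in>G j. \<forall>g'\<in>G j. \<forall>i\<in>{1..n}. (\<forall>l\<in>{1..n}. l \<noteq> i \<longrightarrow> g l = g' l) \<longrightarrow> g = g'"
    if "j \<in> {1..m}" for j using bspec[OF G_all that] by blast+
  \<comment> \<open>A code word passing through \<open>q\<close> in slot \<open>i\<close>; it serves
    as witness for the slope parameters of the frame vector \<open>q\<close>.\<close>
  define pick where "pick j i q = (SOME g. g \<in> G j \<and> g i = q)" for j i q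
  have pick: "pick j i q \<in> G j \<and> pick j i q i = q" if "j \<in> {1..m}" "i \<in> {1..n}" "q \<in> P j i" for j i q
  proof -
    have "\<exists>g. g \<in> G j \<and> g i = q" using G(2)[OF that(1)] that by blast
    then show ?thesis unfolding pick_def by (rule someI_ex)
  qed
  have "\<exists>\<gamma>. \<gamma> \<in> G j" if j: "j \<in> {1..m}" for j
  proof -
    have one: "1 \<in> {1..n}" using n by auto
    then have "P j 1 \<noteq> {}" using P[OF j, of 1] by force
    then show ?thesis using G(2)[OF j] one by blast
  qed
  then obtain \<gamma> where \<gamma>: "\<And>j. j \<in> {1..m} \<Longrightarrow> \<gamma> j \<in> G j" by metis
  have Pi_Idx: "PiE {1..n} (P j) \<subseteq> Idx" if "j \<in> {1..m}" for j
    unfolding Idx_def using P_sub[OF that] by (intro PiE_mono)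

  define V where "V = Sigma {1..m} (\<lambda>j. params (P j))"
  \<comment> \<open>The coordinate in which a parameter is read off: a core entry at its own
    position, a slope \<open>(i, q, c)\<close> at the chosen code word with slot \<open>i\<close>
    moved out of the block to \<open>c\<close>.\<close>
  define pos where "pos = (\<lambda>(j, p). case p of Inl \<beta> \<Rightarrow> \<beta> | Inr (i, q, c) \<Rightarrow> (pick j i q)(i := c))"
  define T where "T j x = chart (P j) (\<lambda>\<beta>. (if \<beta> \<in> G j then 1 else 0) + x (j, Inl \<beta>))
    (\<lambda>i q c. x (j, Inr (i, q, c)))" for j x
  define \<phi> where "\<phi> x = (\<Sum>j\<in>{1..m}. T j x)" for x

  have "finite (params (P j)) \<and> card (params (P j)) = nparams (k j)" if "j \<in> {1..m}" for j
    using params_card[of "P j" "k j"] P[OF that] by blast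
  then have V: "finite V" "card V = (\<Sum>j\<in>{1..m}. nparams (k j))"
    unfolding V_def by (auto simp: card_SigmaI simp del: One_nat_def)
  have p0: "(1, Inl (\<gamma> 1)) \<in> V" using G(1)[of 1] \<gamma>[of 1] m by (auto simp: V_def params_def)

  have polyT: "polyfun V (1 + n) (\<lambda>x. ht \<alpha> (T j x))" if \<alpha>: "\<alpha> \<in> Idx" and j: "j \<in> {1..m}" for \<alpha> j
    unfolding T_def
  proof (rule polyfun_ht_chart[OF P_sub[OF j] \<alpha>])
    show "polyfun V 1 (\<lambda>x. (if \<beta> \<in> G j then 1 else 0) + x (j, Inl \<beta>))" if "\<beta> \<in> PiE {1..n} (P j)" for \<beta>
      using that j by (intro polyfun.add polyfun.const polyfun_var) (auto simp: V_def params_def)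
    show "polyfun V 1 (\<lambda>x. x (j, Inr (i, q, c)))"
      if "i \<in> {1..n}" "q \<in> P j i" "c \<in> {..<a i} - P j i" for i q c
      using that j by (intro polyfun_var) (auto simp: V_def params_def)
  qed
  have ht\<phi>: "ht \<alpha> (\<phi> x) = (\<Sum>j\<in>{1..m}. ht \<alpha> (T j x))" if "\<alpha> \<in> Idx" for \<alpha> x
    unfolding \<phi>_def by (rule linform_sum[OF ht_linform[OF that]])
  have pm: "polymap V (1 + n) \<phi>"
  proof (rule polymapI)
    fix \<alpha> assume \<alpha>: "\<alpha> \<in> Idx"
    show "polyfun V (1 + n) (\<lambda>x. ht \<alpha> (\<phi> x))"
      unfolding ht\<phi>[OF \<alpha>] by (intro polyfun_sum polyT \<alpha>)
  qed

  \<comment> \<open>Coordinates at one code word per block form an identity matrix on the base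
    tensors, so the summands are independent at 0 and, by continuity, nearby.\<close>
  have T0: "ht (\<gamma> j) (T l (\<lambda>_. 0)) = (if j = l then 1 else 0)" if jl: "j \<in> {1..m}" "l \<in> {1..m}" for j l
  proof -
    have \<gamma>j: "\<gamma> j \<in> PiE {1..n} (P j)" "\<gamma> j \<in> Idx" using \<gamma>[OF jl(1)] G(1)[OF jl(1)] Pi_Idx[OF jl(1)] by auto
    have "\<gamma> j \<notin> PiE {1..n} (P l)" if "j \<noteq> l"
      using disj[OF jl _ that, of 1] \<gamma>j(1) n by (force simp: PiE_iff)
    then show ?thesis
      using ht_chart_zero[OF P_sub[OF jl(2)] \<gamma>j(2)] \<gamma>j(1) \<gamma>[OF jl(1)] by (auto simp: T_def)
  qed

  have near: "\<forall>\<^sub>F t in at_right 0. proj_pt sW (\<phi> (\<lambda>p. complex_of_real t * y p)) \<in> proj_join sW m X" for y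
  proof -
    let ?x = "\<lambda>t p. complex_of_real t * y p"
    have "\<forall>\<^sub>F t in at_right 0. cmod (ht (\<gamma> j) (T l (?x t)) - (if j = l then 1 else 0)) < 1 / (card {1..m} + 1)"
      if jl: "j \<in> {1..m}" "l \<in> {1..m}" for j l
    proof -
      have "\<gamma> j \<in> Idx" using \<gamma>[OF jl(1)] G(1)[OF jl(1)] Pi_Idx[OF jl(1)] by auto
      then obtain Q where Q: "\<And>t. ht (\<gamma> j) (T l (\<lambda>p. 0 + t * y p)) = poly Q t"
        using polyfun_line[OF polyT[OF _ jl(2)], of "\<gamma> j" "\<lambda>_. 0" y] by blast
      have "((\<lambda>t. poly Q (complex_of_real t)) \<longlongrightarrow> poly Q (complex_of_real 0)) (at_right 0)"
        by (intro tendsto_intros)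
      moreover have "poly Q (complex_of_real 0) = (if j = l then 1 else 0)"
        using Q[of 0] T0[OF jl] by simp
      ultimately have "((\<lambda>t. ht (\<gamma> j) (T l (?x t))) \<longlongrightarrow> (if j = l then 1 else 0)) (at_right 0)"
        using Q by simp
      from tendstoD[OF this, of "1 / (card {1..m} + 1)"] show ?thesis by (simp add: dist_norm)
    qed
    then have "\<forall>\<^sub>F t in at_right 0. \<forall>j\<in>{1..m}. \<forall>l\<in>{1..m}.
        cmod (ht (\<gamma> j) (T l (?x t)) - (if j = l then 1 else 0)) < 1 / (card {1..m} + 1)"
      by (simp add: eventually_ball_finite_distrib del: One_nat_def)
    then show ?thesis
    proof eventually_elim
      case (elim t)
      show ?case
        unfolding \<phi>_def
      proof (rule join_contains)
        show "T j (?x t) \<in> affine_cone sW (X j)" if j: "j \<in> {1..m}" for j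
          unfolding T_def using X[OF j] chart_in_raw[of "P j" "k j"] P[OF j] by blast
        fix c assume c: "(\<Sum>j\<in>{1..m}. sW (c j) (T j (?x t))) = 0"
        show "\<forall>j\<in>{1..m}. c j = 0"
        proof (rule near_identity_kernel[where M = "\<lambda>j l. ht (\<gamma> j) (T l (?x t))"])
          fix j assume j: "j \<in> {1..m}"
          have "\<gamma> j \<in> Idx" using \<gamma>[OF j] G(1)[OF j] Pi_Idx[OF j] by auto
          note l = ht_linform[OF this]
          have "(\<Sum>l\<in>{1..m}. c l * ht (\<gamma> j) (T l (?x t))) = ht (\<gamma> j) (\<Sum>l\<in>{1..m}. sW (c l) (T l (?x t)))"
            by (simp add: linform_sum[OF l] linform_scale[OF l])
          then show "(\<Sum>l\<in>{1..m}. c l * ht (\<gamma> j) (T l (?x t))) = 0" using c linform_0[OF l] by simp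
        qed (use elim in auto)
      qed (rule m)
    qed
  qed

  \<comment> \<open>\<open>K j \<beta> y \<alpha>\<close> is the coefficient of \<open>S \<beta>\<close> in coordinate \<open>\<alpha>\<close>; it has degree \<open>r j \<alpha>\<close> in \<open>y\<close>\<close>
  define K where "K j \<beta> y \<alpha> = (\<Prod>i\<in>{1..n}. if \<alpha> i \<in> P j i
    then (if \<alpha> i = \<beta> i then 1 else 0) else y (j, Inr (i, \<beta> i, \<alpha> i)))" for j \<beta> \<alpha> and y :: "nat \<times> ((nat \<Rightarrow> nat) + nat \<times> nat \<times> nat) \<Rightarrow> complex"
  define r where "r j \<alpha> = card {i \<in> {1..n}. \<alpha> i \<notin> P j i}" for j \<alpha>
  have deriv_T: "((\<lambda>t. ht \<alpha> (T j (\<lambda>p. t * y p))) has_field_derivative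
      (\<Sum>\<beta>\<in>PiE {1..n} (P j). (if r j \<alpha> = 0 then y (j, Inl \<beta>) else if r j \<alpha> = 1
        then (if \<beta> \<in> G j then 1 else 0) else 0) * K j \<beta> y \<alpha>)) (at 0)"
    if \<alpha>: "\<alpha> \<in> Idx" and j: "j \<in> {1..m}" for \<alpha> j y
  proof -
    have "ht \<alpha> (T j (\<lambda>p. t * y p)) = (\<Sum>\<beta>\<in>PiE {1..n} (P j).
        ((if \<beta> \<in> G j then 1 else 0) + t * y (j, Inl \<beta>)) * (t ^ r j \<alpha> * K j \<beta> y \<alpha>))" for t
      unfolding T_def
    proof (subst ht_chart)
      show "P j i \<subseteq> {..<a i}" if "i \<in> {1..n}" for i using P_sub[OF j that] .
    qed (simp_all only: \<alpha> K_def r_def prod_if_scale finite_atLeastAtMost)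
    then show ?thesis by (simp only:) (intro DERIV_sum DERIV_monomial_at_0)
  qed
  \<comment> \<open>At least \<open>n - 1 \<ge> 2\<close> slots lie outside any other block, so the
    other summands contribute only in order two at this position.\<close>
  have r_other: "2 \<le> r l \<alpha>"
    if "j \<in> {1..m}" "l \<in> {1..m}" "l \<noteq> j" "\<And>i. i \<in> {1..n} - {i0} \<Longrightarrow> \<alpha> i \<in> P j i" for j l \<alpha> i0
  proof -
    have "card ({1..n} - {i0}) \<le> r l \<alpha>"
      unfolding r_def
    proof (rule card_mono)
      show "{1..n} - {i0} \<subseteq> {i \<in> {1..n}. \<alpha> i \<notin> P l i}"
        using disj[OF that(1,2)] that(3,4) by fast
    qed simp
    then show ?thesis using n by (simp add: card_Diff_singleton_if split: if_splits)
  qed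
  have deriv: "((\<lambda>t. ht (pos p) (\<phi> (\<lambda>i. t * y i))) has_field_derivative y p) (at 0)"
    and pos_Idx: "pos p \<in> Idx" if p: "p \<in> V" for p y
  proof -
    obtain j p' where jp: "p = (j, p')" "j \<in> {1..m}" "p' \<in> params (P j)" using p by (auto simp: V_def)
    have main: "pos p \<in> Idx \<and> (\<forall>l\<in>{1..m}. l \<noteq> j \<longrightarrow> 2 \<le> r l (pos p)) \<and>
      (\<Sum>\<beta>\<in>PiE {1..n} (P j). (if r j (pos p) = 0 then y (j, Inl \<beta>) else if r j (pos p) = 1
        then (if \<beta> \<in> G j then 1 else 0) else 0) * K j \<beta> y (pos p)) = y p"
    proof (cases p')
      case (Inl \<beta>0)
      then have \<beta>0: "\<beta>0 \<in> PiE {1..n} (P j)" and pos: "pos p = \<beta>0"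
        using jp by (auto simp: params_def pos_def)
      have in_P: "\<beta>0 i \<in> P j i" if "i \<in> {1..n}" for i using \<beta>0 that by (auto simp: PiE_iff)
      have "r j \<beta>0 = 0" unfolding r_def using in_P by auto
      moreover have "K j \<beta> y \<beta>0 = (if \<beta> = \<beta>0 then 1 else 0)" if \<beta>: "\<beta> \<in> PiE {1..n} (P j)" for \<beta>
      proof (cases "\<beta> = \<beta>0")
        case True
        then show ?thesis unfolding K_def using in_P by (simp del: One_nat_def)
      next
        case False
        then obtain i where "i \<in> {1..n}" "\<beta>0 i \<noteq> \<beta> i" using \<beta> \<beta>0 PiE_ext by metis
        then have "K j \<beta> y \<beta>0 = 0" unfolding K_def using in_P by (intro prod_zero) auto
        then show ?thesis using False by simp
      qed
      ultimately have "(\<Sum>\<beta>\<in>PiE {1..n} (P j). (if r j (pos p) = 0 then y (j, Inl \<beta>) else if r j (pos p) = 1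
          then (if \<beta> \<in> G j then 1 else 0) else 0) * K j \<beta> y (pos p))
          = (\<Sum>\<beta>\<in>PiE {1..n} (P j). if \<beta> = \<beta>0 then y (j, Inl \<beta>0) else 0)"
        unfolding pos by (intro sum.cong) auto
      also have "\<dots> = y p" using \<beta>0 finite_subset[OF Pi_Idx[OF jp(2)] finite_Idx] by (simp add: jp(1) Inl)
      \<comment> \<open>The exempted slot is taken to be \<open>0\<close>, which is no slot, since
        here all indices lie in the block.\<close>
      finally show ?thesis
        using r_other[of j _ 0 \<beta>0] jp(2) in_P Pi_Idx[OF jp(2)] \<beta>0 unfolding pos by blast
    next
      case (Inr iqc)
      obtain i q c where iqc: "iqc = (i, q, c)" by (cases iqc)
      then have i: "i \<in> {1..n}" and q: "q \<in> P j i" and c: "c < a i" "c \<notin> P j i"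
        using jp Inr by (auto simp: params_def)
      define g where "g = pick j i q"
      have g: "g \<in> G j" "g i = q" using pick[OF jp(2) i q] by (simp_all add: g_def)
      have gP: "g \<in> PiE {1..n} (P j)" using g G(1)[OF jp(2)] by blast
      have pos: "pos p = g(i := c)" by (simp add: pos_def jp(1) Inr iqc g_def)
      have in_P: "(g(i := c)) l \<in> P j l" if "l \<in> {1..n} - {i}" for l using gP that by (auto simp: PiE_iff)
      have idx: "g(i := c) \<in> Idx"
        using gP Pi_Idx[OF jp(2)] c(1) i by (auto simp: Idx_def PiE_iff extensional_def)
      have "{l \<in> {1..n}. (g(i := c)) l \<notin> P j l} = {i}" using in_P i c(2) by auto
      then have r1: "r j (g(i := c)) = 1" by (simp add: r_def)
      \<comment> \<open>Only \<open>g\<close> contributes: another code word contributing at this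
        position would agree with \<open>g\<close> in all slots but \<open>i\<close>, which the code
        excludes.\<close>
      have K: "(if \<beta> \<in> G j then 1 else 0) * K j \<beta> y (g(i := c)) = (if \<beta> = g then y p else 0)"
        if \<beta>: "\<beta> \<in> PiE {1..n} (P j)" for \<beta>
      proof (cases "\<beta> = g")
        case True
        have one: "(\<Prod>l\<in>{1..n} - {i}. if (g(i := c)) l \<in> P j l then (if (g(i := c)) l = g l then 1 else 0)
            else y (j, Inr (l, g l, (g(i := c)) l))) = 1"
        proof (rule prod.neutral, rule ballI)
          fix l assume l: "l \<in> {1..n} - {i}"
          have "(g(i := c)) l = g l" "g l \<in> P j l" using in_P[OF l] l by auto
          then show "(if (g(i := c)) l \<in> P j l then (if (g(i := c)) l = g l then 1 else 0)
            else y (j, Inr (l, g l, (g(i := c)) l))) = 1" by (simp only: if_True simp_thms)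
        qed
        have "K j g y (g(i := c)) = y (j, Inr (i, g i, c))"
          unfolding K_def prod.remove[OF finite_atLeastAtMost i] one
          by (simp only: fun_upd_same c(2) if_False mult_1_right)
        then show ?thesis using True g jp(1) Inr iqc by simp
      next
        case False
        have "K j \<beta> y (g(i := c)) = 0" if \<beta>G: "\<beta> \<in> G j"
        proof -
          obtain l where l: "l \<in> {1..n}" "l \<noteq> i" "\<beta> l \<noteq> g l"
            using bspec[OF bspec[OF bspec[OF G(3)[OF jp(2)] \<beta>G] g(1)] i] False by blast
          then show ?thesis unfolding K_def using in_P[of l] by (intro prod_zero) auto
        qed
        then show ?thesis using False by simp
      qed
      have "(\<Sum>\<beta>\<in>PiE {1..n} (P j). (if r j (pos p) = 0 then y (j, Inl \<beta>) else if r j (pos p) = 1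
          then (if \<beta> \<in> G j then 1 else 0) else 0) * K j \<beta> y (pos p))
          = (\<Sum>\<beta>\<in>PiE {1..n} (P j). if \<beta> = g then y p else 0)"
        unfolding pos r1 using K by (intro sum.cong) auto
      also have "\<dots> = y p" using gP finite_subset[OF Pi_Idx[OF jp(2)] finite_Idx] by simp
      finally show ?thesis using r_other[OF jp(2) _ _ in_P] idx unfolding pos by blast
    qed
    then show idx: "pos p \<in> Idx" by blast
    have "((\<lambda>t. ht (pos p) (\<phi> (\<lambda>i. t * y i))) has_field_derivative
      (\<Sum>l\<in>{1..m}. \<Sum>\<beta>\<in>PiE {1..n} (P l). (if r l (pos p) = 0 then y (l, Inl \<beta>) else if r l (pos p) = 1
        then (if \<beta> \<in> G l then 1 else 0) else 0) * K l \<beta> y (pos p))) (at 0)"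
      unfolding ht\<phi>[OF idx] by (intro DERIV_sum deriv_T[OF idx])
    also have "(\<Sum>l\<in>{1..m}. \<Sum>\<beta>\<in>PiE {1..n} (P l). (if r l (pos p) = 0 then y (l, Inl \<beta>) else if r l (pos p) = 1
        then (if \<beta> \<in> G l then 1 else 0) else 0) * K l \<beta> y (pos p)) = (\<Sum>l\<in>{1..m}. if l = j then y p else 0)"
    proof (rule sum.cong[OF refl])
      fix l assume l: "l \<in> {1..m}"
      show "(\<Sum>\<beta>\<in>PiE {1..n} (P l). (if r l (pos p) = 0 then y (l, Inl \<beta>) else if r l (pos p) = 1
        then (if \<beta> \<in> G l then 1 else 0) else 0) * K l \<beta> y (pos p)) = (if l = j then y p else 0)"
      proof (cases "l = j")
        case False
        then have "2 \<le> r l (pos p)" using main l by blast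
        then show ?thesis using False by simp
      next
        case True
        show ?thesis unfolding True using main by (simp only: if_True simp_thms)
      qed
    qed
    also have "\<dots> = y p" using jp(2) by simp
    finally show "((\<lambda>t. ht (pos p) (\<phi> (\<lambda>i. t * y i))) has_field_derivative y p) (at 0)" .
  qed
  have "1 \<in> {1..m}" using m by simp
  moreover from this have "\<gamma> 1 \<in> Idx" using \<gamma> G(1) Pi_Idx by blast
  ultimately have "ht (\<gamma> 1) (\<phi> (\<lambda>_. 0)) = (\<Sum>j\<in>{1..m}. if 1 = j then 1 else 0)"
    by (simp only: ht\<phi> T0 cong: sum.cong)
  also have "\<dots> = 1" using m by simp
  finally have h0: "ht (pos (1, Inl (\<gamma> 1))) (\<phi> (\<lambda>_. 0)) \<noteq> 0" by (simp add: pos_def)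
  have "\<exists>Z. irr_chain (card V - 1) Z (proj_join sW m X)"
    using ht_linform[OF pos_Idx]
    by (intro irr_chain_of_parametrization[OF V(1) p0 pm join_closed near, of "\<lambda>p. ht (pos p)"] h0 deriv)
  then show ?thesis by (simp only: V(2))
qed

lemma join_chain:
  assumes n: "3 \<le> n" and m: "1 \<le> m"
    and k: "\<And>i j. i \<in> {1..n} \<Longrightarrow> j \<in> {1..m} \<Longrightarrow> 1 \<le> k j i"
    and sum_le: "\<And>i. i \<in> {1..n} \<Longrightarrow> (\<Sum>j\<in>{1..m}. k j i) \<le> a i"
    and concise: "\<And>j. j \<in> {1..m} \<Longrightarrow> concise (k j)"
    and X: "\<And>j. j \<in> {1..m} \<Longrightarrow> raw (k j) \<subseteq> affine_cone sW (X j)"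
  shows "\<exists>Z. irr_chain ((\<Sum>j\<in>{1..m}. nparams (k j)) - 1) Z (proj_join sW m X)"
proof -
  \<comment> \<open>Consecutive intervals of length \<open>k j i\<close> serve as blocks;
    \<open>sum_le\<close> says that they fit into \<open>{..<a i}\<close>.\<close>
  define start where "start j i = (\<Sum>l\<in>{1..<j}. k l i)" for j i
  have stop: "start j i + k j i \<le> start l i" if "1 \<le> j" "j < l" for j l i
  proof -
    have "start j i + k j i = (\<Sum>l\<in>{1..<Suc j}. k l i)" using that by (simp add: start_def)
    also have "\<dots> \<le> start l i" unfolding start_def using that by (intro sum_mono2) auto
    finally show ?thesis .
  qed
  have start_le: "start j i + k j i \<le> a i" if "j \<in> {1..m}" "i \<in> {1..n}" for j i
  proof -
    have "start j i + k j i \<le> start (Suc m) i" using stop[of j "Suc m"] that by simp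
    also have "\<dots> = (\<Sum>j\<in>{1..m}. k j i)" by (simp add: start_def atLeastLessThanSuc_atLeastAtMost)
    finally show ?thesis using sum_le[OF that(2)] by simp
  qed
  show ?thesis
  proof (rule join_chain_disjoint_blocks[OF n m, where P = "\<lambda>j i. {start j i..<start j i + k j i}"])
    fix j l i assume jl: "j \<in> {1..m}" "l \<in> {1..m}" "j \<noteq> l"
    then consider "j < l" | "l < j" by linarith
    then show "{start j i..<start j i + k j i} \<inter> {start l i..<start l i + k l i} = {}"
      using stop[of j l i] stop[of l j i] jl by cases auto
  next
    fix j i assume ji: "j \<in> {1..m}" "i \<in> {1..n}"
    show "{start j i..<start j i + k j i} \<subseteq> {..<a i} \<and> card {start j i..<start j i + k j i} = k j i \<and> 1 \<le> k j i"
      using start_le[OF ji] k[OF ji(2,1)] by auto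
  qed (use concise X in auto)
qed

section \<open>Bounds on the defect\<close>

lemma raw_subset_cone: "raw k \<subseteq> affine_cone sW (subspace_variety sV sW n A \<tau> k)"
proof
  fix v assume "v \<in> raw k"
  then show "v \<in> affine_cone sW (subspace_variety sV sW n A \<tau> k)"
    unfolding affine_cone_def subspace_variety_eq
    using subsetD[OF closure_subset proj_pt_in_image[of v "raw k"]] by auto
qed

text \<open>A single nonzero vector is independent. This settles the case \<open>m = 1\<close> for
  every \<open>n\<close>, by monotonicity of the dimension.\<close>

lemma subset_join_1:
  assumes "zariski_closed sW (X 1)"
  shows "X 1 \<subseteq> proj_join sW 1 X"
proof
  fix p assume p: "p \<in> X 1"
  then obtain v where v: "p = proj_pt sW v" "v \<noteq> 0"
    using zariski_closed_subset[OF assms] by (auto simp: proj_space_def)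
  have "proj_pt sW (\<Sum>j\<in>{1..1::nat}. v) \<in> proj_join sW 1 X"
    by (rule join_contains) (use p v in \<open>auto simp: affine_cone_def\<close>)
  then show "p \<in> proj_join sW 1 X" using v(1) by simp
qed

text \<open>The summands -1 of the m varieties cancel \<open>+ m\<close>, and the -1 in the
  dimension of the ambient projective space cancels the remaining one.\<close>

lemma join_defect_ge:
  assumes m: "1 \<le> m" and k: "\<And>i j. i \<in> {1..n} \<Longrightarrow> j \<in> {1..m} \<Longrightarrow> 1 \<le> k j i \<and> k j i \<le> a i"
  shows "int (\<Sum>j\<in>{1..m}. \<Prod>i\<in>{1..n}. k j i) - int (\<Prod>i\<in>{1..n}. a i)
    \<le> join_defect sW m (\<lambda>j. subspace_variety sV sW n A \<tau> (k j))"
proof -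
  let ?X = "\<lambda>j. subspace_variety sV sW n A \<tau> (k j)"
  have a1: "1 \<le> a i" if "i \<in> {1..n}" for i using k[OF that, of 1] m by auto
  then have pos: "1 \<le> (\<Prod>i\<in>{1..n}. a i)" by (intro prod_ge_1)
  have "proj_dim sW (proj_join sW m ?X) \<le> int ((\<Prod>i\<in>{1..n}. a i) - 1)"
    by (rule proj_dim_le) (rule chain_length_le[OF a1])
  moreover have "(\<Sum>j\<in>{1..m}. int (\<Prod>i\<in>{1..n}. k j i) - 1) \<le> (\<Sum>j\<in>{1..m}. proj_dim sW (?X j))"
    by (intro sum_mono subspace_variety_dim_ge k)
  moreover have "(\<Sum>j\<in>{1..m}. int (\<Prod>i\<in>{1..n}. k j i) - 1)
      = int (\<Sum>j\<in>{1..m}. \<Prod>i\<in>{1..n}. k j i) - int m"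
    by (simp add: sum_subtractf)
  ultimately show ?thesis unfolding join_defect_def using pos by linarith
qed

text \<open>For \<open>m > 1\<close>, the variety bounds \<open>nparams (k' j) - 1\<close> and the
  chain of length \<open>(\<Sum>j\<in>{1..m}. nparams (k' j)) - 1\<close> in the join cancel
  exactly.\<close>

lemma join_defect_le_0:
  assumes m: "1 \<le> m" and k: "\<And>i j. i \<in> {1..n} \<Longrightarrow> j \<in> {1..m} \<Longrightarrow> 1 \<le> k j i \<and> k j i \<le> a i"
    and nm: "3 \<le> n \<or> m = 1" and sum_le: "\<And>i. i \<in> {1..n} \<Longrightarrow> (\<Sum>j\<in>{1..m}. k j i) \<le> a i"
  shows "join_defect sW m (\<lambda>j. subspace_variety sV sW n A \<tau> (k j)) \<le> 0"
proof -
  let ?X = "\<lambda>j. subspace_variety sV sW n A \<tau> (k j)"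
  have "1 \<le> a i" if "i \<in> {1..n}" for i using k[OF that, of 1] m by auto
  then have len: "r \<le> (\<Prod>i\<in>{1..n}. a i) - 1" if "irr_chain r Z Y" for r Z Y
    using that by (rule chain_length_le)
  show ?thesis
  proof (cases "m = 1")
    case True
    have "zariski_closed sW (?X 1)"
      unfolding subspace_variety_eq by (intro zariski_closed_closure proj_image_subset)
    then have "proj_dim sW (?X 1) \<le> proj_dim sW (proj_join sW 1 ?X)"
      by (intro proj_dim_mono[OF len] subset_join_1[where X = ?X])
    then show ?thesis unfolding join_defect_def True by simp
  next
    case False
    \<comment> \<open>The concise vector serves on both sides:
      \<open>raw (k j) \<subseteq> raw (k' j)\<close> bounds the variety from above, and
      \<open>k' \<le> k\<close> gives the reverse inclusion, needed for the chain in the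
      join.\<close>
    have "\<exists>k'. (\<forall>i\<in>{1..n}. 1 \<le> k' i \<and> k' i \<le> k j i) \<and> concise k' \<and> raw (k j) \<subseteq> raw k'"
      if "j \<in> {1..m}" for j
      by (rule exists_concise) (rule k[OF _ that])
    then obtain k' where k': "\<And>i j. i \<in> {1..n} \<Longrightarrow> j \<in> {1..m} \<Longrightarrow> 1 \<le> k' j i \<and> k' j i \<le> k j i"
      "\<And>j. j \<in> {1..m} \<Longrightarrow> concise (k' j)" "\<And>j. j \<in> {1..m} \<Longrightarrow> raw (k j) \<subseteq> raw (k' j)"
      by metis
    have np: "1 \<le> nparams (k' j)" if "j \<in> {1..m}" for j
    proof -
      have "1 \<le> (\<Prod>i\<in>{1..n}. k' j i)" using k'(1)[OF _ that] by (intro prod_ge_1) blast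
      then show ?thesis by (simp add: nparams_def)
    qed
    have X_le: "proj_dim sW (?X j) \<le> int (nparams (k' j)) - 1" if j: "j \<in> {1..m}" for j
    proof -
      have "proj_dim sW (?X j) \<le> int (nparams (k' j) - 1)"
      proof (rule proj_dim_le)
        fix r Z assume "irr_chain r Z (?X j)"
        moreover have "?X j \<subseteq> subspace_variety sV sW n A \<tau> (k' j)"
          unfolding subspace_variety_eq by (intro closure_mono proj_image_mono k'(3) j)
        ultimately have "irr_chain r Z (subspace_variety sV sW n A \<tau> (k' j))"
          unfolding irr_chain_def by blast
        then show "r \<le> nparams (k' j) - 1" using k'(1)[OF _ j] by (intro subspace_variety_chain_le) blast
      qed
      then show ?thesis using np[OF j] by linarith
    qed
    have ex: "\<exists>Z. irr_chain ((\<Sum>j\<in>{1..m}. nparams (k' j)) - 1) Z (proj_join sW m ?X)"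
    proof (rule join_chain)
      show "(\<Sum>j\<in>{1..m}. k' j i) \<le> a i" if i: "i \<in> {1..n}" for i
        using sum_mono[of "{1..m}" "\<lambda>j. k' j i" "\<lambda>j. k j i"] k'(1)[OF i] sum_le[OF i] by fastforce
      show "raw (k' j) \<subseteq> affine_cone sW (?X j)" if j: "j \<in> {1..m}" for j
        using raw_mono[of "k' j" "k j"] k'(1)[OF _ j] k[OF _ j] raw_subset_cone[of "k j"] by blast
    qed (use nm False m k' in auto)
    have "int ((\<Sum>j\<in>{1..m}. nparams (k' j)) - 1) \<le> proj_dim sW (proj_join sW m ?X)"
      by (rule exE[OF ex], rule proj_dim_ge[rotated], assumption, rule len)
    moreover have "(\<Sum>j\<in>{1..m}. proj_dim sW (?X j)) \<le> (\<Sum>j\<in>{1..m}. int (nparams (k' j)) - 1)"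
      by (intro sum_mono X_le)
    moreover have "(\<Sum>j\<in>{1..m}. int (nparams (k' j)) - 1) = int (\<Sum>j\<in>{1..m}. nparams (k' j)) - int m"
      by (simp add: sum_subtractf)
    moreover have "1 \<le> (\<Sum>j\<in>{1..m}. nparams (k' j))"
      using np[of 1] m member_le_sum[of 1 "{1..m}" "\<lambda>j. nparams (k' j)"] by auto
    ultimately show ?thesis unfolding join_defect_def by linarith
  qed
qed

end

theorem proposition2p18:
  fixes sV :: "complex \<Rightarrow> 'v::ab_group_add \<Rightarrow> 'v"
    and sW :: "complex \<Rightarrow> 'w::ab_group_add \<Rightarrow> 'w"
    and n m :: nat
    and A :: "nat \<Rightarrow> 'v set"
    and \<tau> :: "(nat \<Rightarrow> 'v) \<Rightarrow> 'w"
    and k :: "nat \<Rightarrow> nat \<Rightarrow> nat"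
  assumes "vector_space sV" and "vector_space sW"
    and "\<And>i. i \<in> {1..n} \<Longrightarrow> module.subspace sV (A i)"
    and "\<And>i. i \<in> {1..n} \<Longrightarrow> \<exists>B. finite B \<and> module.span sV B = A i"
    and "tensor_product sV sW n A \<tau>"
    and "1 \<le> m" and "int m \<le> proj_dim sW (proj_space sW)"
    and "\<And>i j. i \<in> {1..n} \<Longrightarrow> j \<in> {1..m} \<Longrightarrow> 1 \<le> k j i \<and> k j i \<le> vector_space.dim sV (A i)"
  shows
    "let X = (\<lambda>j. subspace_variety sV sW n A \<tau> (k j));
         a = (\<lambda>i. vector_space.dim sV (A i))
     in (3 \<le> n \<or> m = 1 \<longrightarrow>
          (\<forall>i\<in>{1..n}. a i \<ge> (\<Sum>j\<in>{1..m}. k j i)) \<longrightarrow> \<not> join_defective sW m X) \<and>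
        ((\<Prod>i\<in>{1..n}. a i) < (\<Sum>j\<in>{1..m}. \<Prod>i\<in>{1..n}. k j i) \<longrightarrow> join_defective sW m X) \<and>
        join_defect sW m X \<ge>
          int (\<Sum>j\<in>{1..m}. \<Prod>i\<in>{1..n}. k j i) - int (\<Prod>i\<in>{1..n}. a i)"
proof -
  interpret V: complex_space sV using assms(1) by (simp add: complex_space_def)
  interpret W: complex_space sW using assms(2) by (simp add: complex_space_def)
  \<comment> \<open>Basis and coordinate forms are packed into a pair, so that a single choice over
    the slots yields both.\<close>
  have "\<exists>ec. (\<forall>q<V.dim (A i). fst ec q \<in> A i \<and> V.linform (snd ec q)) \<and>
      (\<forall>p<V.dim (A i). \<forall>q<V.dim (A i). snd ec p (fst ec q) = (if p = q then 1 else 0)) \<and>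
      (\<forall>v\<in>A i. v = (\<Sum>q<V.dim (A i). sV (snd ec q v) (fst ec q)))" if i: "i \<in> {1..n}" for i
  proof -
    obtain B where "finite B" "V.span B = A i" using assms(4)[OF i] by blast
    from V.dual_basis_of_subspace[OF assms(3)[OF i] this] show ?thesis
      by (elim exE) (rule exI[of _ "(_, _)"], simp only: fst_conv snd_conv)
  qed
  then have "\<forall>i\<in>{1..n}. \<exists>ec. (\<forall>q<V.dim (A i). fst ec q \<in> A i \<and> V.linform (snd ec q)) \<and>
      (\<forall>p<V.dim (A i). \<forall>q<V.dim (A i). snd ec p (fst ec q) = (if p = q then 1 else 0)) \<and>
      (\<forall>v\<in>A i. v = (\<Sum>q<V.dim (A i). sV (snd ec q v) (fst ec q)))" by (rule ballI)
  from bchoice[OF this] obtain ec where ec: "\<forall>i\<in>{1..n}.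
      (\<forall>q<V.dim (A i). fst (ec i) q \<in> A i \<and> V.linform (snd (ec i) q)) \<and>
      (\<forall>p<V.dim (A i). \<forall>q<V.dim (A i). snd (ec i) p (fst (ec i) q) = (if p = q then 1 else 0)) \<and>
      (\<forall>v\<in>A i. v = (\<Sum>q<V.dim (A i). sV (snd (ec i) q v) (fst (ec i) q)))" ..
  interpret tensor_space sV sW n A \<tau> "\<lambda>i. fst (ec i)" "\<lambda>i. snd (ec i)"
  proof (intro tensor_space.intro tensor_space_axioms.intro)
    show "complex_space sW" "complex_space sV" by unfold_locales
    show "V.subspace (A i)" if "i \<in> {1..n}" for i using assms(3)[OF that] .
    show "\<exists>B. finite B \<and> V.span B = A i" if "i \<in> {1..n}" for i using assms(4)[OF that] .
    show "tensor_product sV sW n A \<tau>" by (rule assms(5))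
    fix i assume i: "i \<in> {1..n}"
    note e = bspec[OF ec i]
    show "fst (ec i) q \<in> A i" "V.linform (snd (ec i) q)" if "q < V.dim (A i)" for q
      using e that by blast+
    show "snd (ec i) p (fst (ec i) q) = (if p = q then 1 else 0)"
      if "p < V.dim (A i)" "q < V.dim (A i)" for p q using e that by blast
    show "v = (\<Sum>q<V.dim (A i). sV (snd (ec i) q v) (fst (ec i) q))" if "v \<in> A i" for v
      using e that by blast
  qed
  have k: "1 \<le> k j i \<and> k j i \<le> a i" if "i \<in> {1..n}" "j \<in> {1..m}" for i j
    using assms(8)[OF that] by (simp add: a_def)
  let ?X = "\<lambda>j. subspace_variety sV sW n A \<tau> (k j)"
  have ge: "int (\<Sum>j\<in>{1..m}. \<Prod>i\<in>{1..n}. k j i) - int (\<Prod>i\<in>{1..n}. a i) \<le> join_defect sW m ?X"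
    by (rule join_defect_ge[OF assms(6) k])
  have le: "join_defect sW m ?X \<le> 0"
    if "3 \<le> n \<or> m = 1" "\<forall>i\<in>{1..n}. (\<Sum>j\<in>{1..m}. k j i) \<le> a i"
    by (rule join_defect_le_0[OF assms(6) k that(1)]) (use that(2) in auto)
  have "\<not> join_defect sW m ?X > 0"
    if "3 \<le> n \<or> m = 1" "\<forall>i\<in>{1..n}. (\<Sum>j\<in>{1..m}. k j i) \<le> a i"
    using le[OF that] by simp
  moreover have "join_defect sW m ?X > 0"
    if "(\<Prod>i\<in>{1..n}. a i) < (\<Sum>j\<in>{1..m}. \<Prod>i\<in>{1..n}. k j i)"
    using ge that by linarith
  ultimately show ?thesis
    unfolding Let_def join_defective_def a_def[symmetric] using ge by blast
qed

end
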